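(* Let $(G,K,\sigma)$ be a symmetric triple of compact type with $K=G^{\sigma}$ and $\dim(G/K)\ge 2$. Then the Cartan map $\Phi:G\to G$, $\Phi(p)=p\cdot\sigma(p^{-1})$, is harmonic, i.e. its tension field satisfies $\tau(\Phi)=0$.
   Context: A symmetric triple $(G,K,\sigma)$ consists of a Lie group $G$, an involutive automorphism $\sigma$ of $G$ and a compact subgroup $K$ of $G$ such that the fixed point set $G^{\sigma}=\{p\in G : \sigma(p)=p\}$ is compact and $G^{\sigma}_0\subset K\subset G^{\sigma}$, where $G^{\sigma}_0$ is the identity component of $G^\sigma$. The Cartan decomposition is $\mathfrak g=\mathfrak k\oplus\mathfrak p$, where $\mathfrak k$ and $\mathfrak p$ are the eigenspaces of $d\sigma_e$ for the eigenvalues $+1$ and $-1$. The triple is of compact type if the Killing form of $\mathfrak g$ is negative definite on $\mathfrak p$. Here $G$ is compact, and it is equipped with a bi-invariant Riemannian metric for which $\mathfrak k$ and $\mathfrak p$ are orthogonal (for example the metric induced by a negative multiple of the Killing form when $G$ is semisimple). For a smooth map $\varphi:(M,g)\to(N,h)$ between Riemannian manifolds the tension field is $\tau(\varphi)=\operatorname{trace}_g(\nabla d\varphi)$, where $\nabla d\varphi(X,Y)=\nabla^{\varphi}_X(d\varphi(Y))-d\varphi(\nabla_XY)$, with $\nabla$ the Levi-Civita connection of $(M,g)$ and $\nabla^{\varphi}$ the pull-back to $\varphi^{-1}TN$ of the Levi-Civita connection of $(N,h)$. The map $\varphi$ is harmonic if $\tau(\varphi)=0$. *)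

theory Defs
  imports
    "HOL-Analysis.Analysis"
    "HOL-Algebra.Left_Coset"
    "HOL-Library.Function_Algebras"
begin

section \<open>Pointwise real vector space structure on functions\<close>

instantiation "fun" :: (type, scaleR) scaleR
begin
definition scaleR_fun_def: "r *\<^sub>R f = (\<lambda>x. r *\<^sub>R f x)"
instance ..
end

lemma scaleR_fun_apply [simp]: "(r *\<^sub>R f) x = r *\<^sub>R f x"
  by (simp add: scaleR_fun_def)

instance "fun" :: (type, real_vector) real_vector
  by standard (simp_all add: fun_eq_iff algebra_simps)

section \<open>Smooth maps between open subsets of normed spaces\<close>

primrec Ck_on ::
  "nat \<Rightarrow> 'e::real_normed_vector set \<Rightarrow> ('e \<Rightarrow> 'f::real_normed_vector) \<Rightarrow> bool"
where
  "Ck_on 0 S f \<longleftrightarrow> continuous_on S f"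
| "Ck_on (Suc k) S f \<longleftrightarrow>
     (\<forall>x\<in>S. f differentiable (at x)) \<and>
     (\<forall>v. Ck_on k S (\<lambda>x. frechet_derivative f (at x) v))"

definition smooth_on ::
  "'e::real_normed_vector set \<Rightarrow> ('e \<Rightarrow> 'f::real_normed_vector) \<Rightarrow> bool" where
  "smooth_on S f \<longleftrightarrow> open S \<and> (\<forall>k. Ck_on k S f)"

section \<open>Smooth manifolds\<close>

text \<open>A chart is its domain together with its coordinate map. Manifolds are modelled on a
  type \<open>'e\<close> of class \<open>euclidean_space\<close>, so they have dimension \<open>DIM('e)\<close>. The atlas need
  not be maximal.\<close>

type_synonym ('a, 'e) chart = "'a set \<times> ('a \<Rightarrow> 'e)"

definition chart_inv :: "('a, 'e) chart \<Rightarrow> 'e \<Rightarrow> 'a" where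
  "chart_inv c = inv_into (fst c) (snd c)"

record ('a, 'e) manifold =
  man_top :: "'a topology"
  man_atlas :: "('a, 'e) chart set"

definition chart_on :: "'a topology \<Rightarrow> ('a, 'e::euclidean_space) chart \<Rightarrow> bool" where
  "chart_on T c \<longleftrightarrow>
     openin T (fst c) \<and> open (snd c ` fst c) \<and>
     homeomorphic_map (subtopology T (fst c)) (top_of_set (snd c ` fst c)) (snd c)"

definition smooth_manifold :: "('a, 'e::euclidean_space) manifold \<Rightarrow> bool" where
  "smooth_manifold M \<longleftrightarrow>
     Hausdorff_space (man_top M) \<and> second_countable (man_top M) \<and>
     (\<forall>c\<in>man_atlas M. chart_on (man_top M) c) \<and>
     (\<Union>c\<in>man_atlas M. fst c) = topspace (man_top M) \<and>
     (\<forall>c\<in>man_atlas M. \<forall>d\<in>man_atlas M.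
        smooth_on (snd c ` (fst c \<inter> fst d)) (snd d \<circ> chart_inv c))"

definition prod_manifold ::
  "('a, 'e) manifold \<Rightarrow> ('b, 'f) manifold \<Rightarrow> ('a \<times> 'b, 'e \<times> 'f) manifold" where
  "prod_manifold M N =
     \<lparr>man_top = prod_topology (man_top M) (man_top N),
      man_atlas = {(fst c \<times> fst d, map_prod (snd c) (snd d)) | c d.
                     c \<in> man_atlas M \<and> d \<in> man_atlas N}\<rparr>"

definition smooth_map ::
  "('a, 'e::euclidean_space) manifold \<Rightarrow> ('b, 'f::euclidean_space) manifold \<Rightarrow> ('a \<Rightarrow> 'b) \<Rightarrow> bool"
where
  "smooth_map M N \<phi> \<longleftrightarrow>
     continuous_map (man_top M) (man_top N) \<phi> \<and>
     (\<forall>c\<in>man_atlas M. \<forall>d\<in>man_atlas N.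
        smooth_on (snd c ` {p \<in> fst c. \<phi> p \<in> fst d}) (snd d \<circ> \<phi> \<circ> chart_inv c))"

definition smooth_function :: "('a, 'e::euclidean_space) manifold \<Rightarrow> ('a \<Rightarrow> real) \<Rightarrow> bool" where
  "smooth_function M f \<longleftrightarrow>
     (\<forall>c\<in>man_atlas M. smooth_on (snd c ` fst c) (f \<circ> chart_inv c))"

section \<open>Tangent vectors and differentials\<close>

text \<open>A tangent vector at \<open>p\<close> assigns to every chart around \<open>p\<close> its components in that chart,
  the components in different charts being related by the Jacobian of the change of
  coordinates. It takes the value \<open>0\<close> on everything that is not a chart around \<open>p\<close>, so that
  the tangent space is a subspace of the vector space of all such assignments.\<close>

type_synonym ('a, 'e) tangent = "('a, 'e) chart \<Rightarrow> 'e"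

definition charts_at :: "('a, 'e) manifold \<Rightarrow> 'a \<Rightarrow> ('a, 'e) chart set" where
  "charts_at M p = {c \<in> man_atlas M. p \<in> fst c}"

definition some_chart_at :: "('a, 'e) manifold \<Rightarrow> 'a \<Rightarrow> ('a, 'e) chart" where
  "some_chart_at M p = (SOME c. c \<in> charts_at M p)"

definition tangent_space ::
  "('a, 'e::euclidean_space) manifold \<Rightarrow> 'a \<Rightarrow> ('a, 'e) tangent set" where
  "tangent_space M p =
     {v. (\<forall>c\<in>charts_at M p. \<forall>d\<in>charts_at M p.
            v d = frechet_derivative (snd d \<circ> chart_inv c) (at (snd c p)) (v c)) \<and>
         (\<forall>c. c \<notin> charts_at M p \<longrightarrow> v c = 0)}"

text \<open>The tangent vector at \<open>p\<close> with components \<open>u\<close> in the chart \<open>c\<close>.\<close>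

definition coord_vector ::
  "('a, 'e::euclidean_space) manifold \<Rightarrow> ('a, 'e) chart \<Rightarrow> 'a \<Rightarrow> 'e \<Rightarrow> ('a, 'e) tangent" where
  "coord_vector M c p u =
     (\<lambda>d. if d \<in> charts_at M p
          then frechet_derivative (snd d \<circ> chart_inv c) (at (snd c p)) u else 0)"

text \<open>The differential of \<open>\<phi>\<close> at \<open>p\<close>, and the derivative of a real function in the direction of
  a tangent vector at \<open>p\<close>. By the chain rule the choice of chart around \<open>p\<close> is immaterial.\<close>

definition differential ::
  "('a, 'e::euclidean_space) manifold \<Rightarrow> ('b, 'f::euclidean_space) manifold \<Rightarrow> ('a \<Rightarrow> 'b) \<Rightarrow> 'a
     \<Rightarrow> ('a, 'e) tangent \<Rightarrow> ('b, 'f) tangent" where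
  "differential M N \<phi> p v =
     (let c = some_chart_at M p in
      (\<lambda>d. if d \<in> charts_at N (\<phi> p)
           then frechet_derivative (snd d \<circ> \<phi> \<circ> chart_inv c) (at (snd c p)) (v c) else 0))"

definition dir_deriv ::
  "('a, 'e::euclidean_space) manifold \<Rightarrow> 'a \<Rightarrow> ('a, 'e) tangent \<Rightarrow> ('a \<Rightarrow> real) \<Rightarrow> real" where
  "dir_deriv M p v f =
     (let c = some_chart_at M p in frechet_derivative (f \<circ> chart_inv c) (at (snd c p)) (v c))"

section \<open>Vector fields and sections along maps\<close>

text \<open>Smooth sections of the pull-back bundle \<open>\<phi>\<inverse>TN\<close>; only the values on the points of the
  manifold matter. Vector fields on \<open>M\<close> are the sections along the identity.\<close>

definition smooth_section ::
  "('a, 'e::euclidean_space) manifold \<Rightarrow> ('b, 'f::euclidean_space) manifold \<Rightarrow> ('a \<Rightarrow> 'b)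
     \<Rightarrow> ('a \<Rightarrow> ('b, 'f) tangent) \<Rightarrow> bool" where
  "smooth_section M N \<phi> W \<longleftrightarrow>
     (\<forall>p\<in>topspace (man_top M). W p \<in> tangent_space N (\<phi> p)) \<and>
     (\<forall>c\<in>man_atlas M. \<forall>d\<in>man_atlas N.
        smooth_on (snd c ` {p \<in> fst c. \<phi> p \<in> fst d}) (\<lambda>x. W (chart_inv c x) d))"

abbreviation smooth_vector_field ::
  "('a, 'e::euclidean_space) manifold \<Rightarrow> ('a \<Rightarrow> ('a, 'e) tangent) \<Rightarrow> bool" where
  "smooth_vector_field M X \<equiv> smooth_section M M id X"

text \<open>In each chart the components of the bracket are \<open>DY(X) - DX(Y)\<close>.\<close>

definition field_bracket ::
  "('a, 'e::euclidean_space) manifold \<Rightarrow> ('a \<Rightarrow> ('a, 'e) tangent) \<Rightarrow> ('a \<Rightarrow> ('a, 'e) tangent)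
     \<Rightarrow> 'a \<Rightarrow> ('a, 'e) tangent" where
  "field_bracket M X Y p =
     (\<lambda>c. if c \<in> charts_at M p
          then frechet_derivative (\<lambda>x. Y (chart_inv c x) c) (at (snd c p)) (X p c)
             - frechet_derivative (\<lambda>x. X (chart_inv c x) c) (at (snd c p)) (Y p c)
          else 0)"

section \<open>Riemannian metrics and connections\<close>

type_synonym ('a, 'e) metric_tensor = "'a \<Rightarrow> ('a, 'e) tangent \<Rightarrow> ('a, 'e) tangent \<Rightarrow> real"

definition riemannian_metric ::
  "('a, 'e::euclidean_space) manifold \<Rightarrow> ('a, 'e) metric_tensor \<Rightarrow> bool" where
  "riemannian_metric M g \<longleftrightarrow>
     (\<forall>p\<in>topspace (man_top M).
        (\<forall>u\<in>tangent_space M p. \<forall>v\<in>tangent_space M p. g p u v = g p v u) \<and>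
        (\<forall>u\<in>tangent_space M p. \<forall>v\<in>tangent_space M p. \<forall>w\<in>tangent_space M p.
           g p (u + v) w = g p u w + g p v w) \<and>
        (\<forall>r. \<forall>u\<in>tangent_space M p. \<forall>v\<in>tangent_space M p. g p (r *\<^sub>R u) v = r * g p u v) \<and>
        (\<forall>u\<in>tangent_space M p. u \<noteq> 0 \<longrightarrow> 0 < g p u u)) \<and>
     (\<forall>c\<in>man_atlas M. \<forall>u v.
        smooth_on (snd c ` fst c)
          (\<lambda>x. g (chart_inv c x) (coord_vector M c (chart_inv c x) u)
                                 (coord_vector M c (chart_inv c x) v)))"

text \<open>Connections on the pull-back bundle \<open>\<phi>\<inverse>TN\<close>; affine connections on \<open>M\<close> are the connections
  along the identity.\<close>

definition connection_along ::
  "('a, 'e::euclidean_space) manifold \<Rightarrow> ('b, 'f::euclidean_space) manifold \<Rightarrow> ('a \<Rightarrow> 'b)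
     \<Rightarrow> (('a \<Rightarrow> ('a, 'e) tangent) \<Rightarrow> ('a \<Rightarrow> ('b, 'f) tangent) \<Rightarrow> ('a \<Rightarrow> ('b, 'f) tangent)) \<Rightarrow> bool"
where
  "connection_along M N \<phi> D \<longleftrightarrow>
     (\<forall>X W. smooth_vector_field M X \<and> smooth_section M N \<phi> W \<longrightarrow> smooth_section M N \<phi> (D X W)) \<and>
     (\<forall>X Y W. smooth_vector_field M X \<and> smooth_vector_field M Y \<and> smooth_section M N \<phi> W \<longrightarrow>
        (\<forall>p\<in>topspace (man_top M). D (\<lambda>q. X q + Y q) W p = D X W p + D Y W p)) \<and>
     (\<forall>f X W. smooth_function M f \<and> smooth_vector_field M X \<and> smooth_section M N \<phi> W \<longrightarrow>
        (\<forall>p\<in>topspace (man_top M). D (\<lambda>q. f q *\<^sub>R X q) W p = f p *\<^sub>R D X W p)) \<and>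
     (\<forall>X V W. smooth_vector_field M X \<and> smooth_section M N \<phi> V \<and> smooth_section M N \<phi> W \<longrightarrow>
        (\<forall>p\<in>topspace (man_top M). D X (\<lambda>q. V q + W q) p = D X V p + D X W p)) \<and>
     (\<forall>f X W. smooth_function M f \<and> smooth_vector_field M X \<and> smooth_section M N \<phi> W \<longrightarrow>
        (\<forall>p\<in>topspace (man_top M).
           D X (\<lambda>q. f q *\<^sub>R W q) p = dir_deriv M p (X p) f *\<^sub>R W p + f p *\<^sub>R D X W p))"

definition is_levi_civita ::
  "('a, 'e::euclidean_space) manifold \<Rightarrow> ('a, 'e) metric_tensor
     \<Rightarrow> (('a \<Rightarrow> ('a, 'e) tangent) \<Rightarrow> ('a \<Rightarrow> ('a, 'e) tangent) \<Rightarrow> ('a \<Rightarrow> ('a, 'e) tangent)) \<Rightarrow> bool"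
where
  "is_levi_civita M g D \<longleftrightarrow>
     connection_along M M id D \<and>
     (\<forall>X Y. smooth_vector_field M X \<and> smooth_vector_field M Y \<longrightarrow>
        (\<forall>p\<in>topspace (man_top M). D X Y p - D Y X p = field_bracket M X Y p)) \<and>
     (\<forall>X Y Z. smooth_vector_field M X \<and> smooth_vector_field M Y \<and> smooth_vector_field M Z \<longrightarrow>
        (\<forall>p\<in>topspace (man_top M).
           dir_deriv M p (X p) (\<lambda>q. g q (Y q) (Z q)) =
             g p (D X Y p) (Z p) + g p (Y p) (D X Z p)))"

text \<open>The pull-back of an affine connection \<open>D\<close> on \<open>N\<close>: the connection on \<open>\<phi>\<inverse>TN\<close> whose value on a
  section \<open>V \<circ> \<phi>\<close> in the direction \<open>X\<close> is the derivative of \<open>V\<close> in the direction \<open>d\<phi>(X)\<close>. As \<open>D\<close>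
  is tensorial in its direction, any field \<open>Z\<close> with \<open>Z (\<phi> p) = d\<phi>(X p)\<close> may be used at \<open>p\<close>.\<close>

definition is_pullback_connection ::
  "('a, 'e::euclidean_space) manifold \<Rightarrow> ('b, 'f::euclidean_space) manifold \<Rightarrow> ('a \<Rightarrow> 'b)
     \<Rightarrow> (('b \<Rightarrow> ('b, 'f) tangent) \<Rightarrow> ('b \<Rightarrow> ('b, 'f) tangent) \<Rightarrow> ('b \<Rightarrow> ('b, 'f) tangent))
     \<Rightarrow> (('a \<Rightarrow> ('a, 'e) tangent) \<Rightarrow> ('a \<Rightarrow> ('b, 'f) tangent) \<Rightarrow> ('a \<Rightarrow> ('b, 'f) tangent)) \<Rightarrow> bool"
where
  "is_pullback_connection M N \<phi> D P \<longleftrightarrow>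
     connection_along M N \<phi> P \<and>
     (\<forall>X V Z. smooth_vector_field M X \<and> smooth_vector_field N V \<and> smooth_vector_field N Z \<longrightarrow>
        (\<forall>p\<in>topspace (man_top M).
           Z (\<phi> p) = differential M N \<phi> p (X p) \<longrightarrow> P X (\<lambda>q. V (\<phi> q)) p = D Z V (\<phi> p)))"

text \<open>Both connections exist (for smooth \<open>M\<close>, \<open>N\<close>, \<open>\<phi>\<close> and Riemannian metrics) and their values on
  smooth fields and sections at points of the manifold are uniquely determined, so the choice
  below is immaterial.\<close>

definition levi_civita ::
  "('a, 'e::euclidean_space) manifold \<Rightarrow> ('a, 'e) metric_tensor
     \<Rightarrow> ('a \<Rightarrow> ('a, 'e) tangent) \<Rightarrow> ('a \<Rightarrow> ('a, 'e) tangent) \<Rightarrow> ('a \<Rightarrow> ('a, 'e) tangent)" where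
  "levi_civita M g = (SOME D. is_levi_civita M g D)"

definition pullback_connection ::
  "('a, 'e::euclidean_space) manifold \<Rightarrow> ('b, 'f::euclidean_space) manifold \<Rightarrow> ('a \<Rightarrow> 'b)
     \<Rightarrow> (('b \<Rightarrow> ('b, 'f) tangent) \<Rightarrow> ('b \<Rightarrow> ('b, 'f) tangent) \<Rightarrow> ('b \<Rightarrow> ('b, 'f) tangent))
     \<Rightarrow> ('a \<Rightarrow> ('a, 'e) tangent) \<Rightarrow> ('a \<Rightarrow> ('b, 'f) tangent) \<Rightarrow> ('a \<Rightarrow> ('b, 'f) tangent)" where
  "pullback_connection M N \<phi> D = (SOME P. is_pullback_connection M N \<phi> D P)"

section \<open>Tension field and harmonic maps\<close>

definition second_fundamental_form ::
  "('a, 'e::euclidean_space) manifold \<Rightarrow> ('a, 'e) metric_tensor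
     \<Rightarrow> ('b, 'f::euclidean_space) manifold \<Rightarrow> ('b, 'f) metric_tensor \<Rightarrow> ('a \<Rightarrow> 'b)
     \<Rightarrow> ('a \<Rightarrow> ('a, 'e) tangent) \<Rightarrow> ('a \<Rightarrow> ('a, 'e) tangent) \<Rightarrow> 'a \<Rightarrow> ('b, 'f) tangent" where
  "second_fundamental_form M g N h \<phi> X Y p =
     pullback_connection M N \<phi> (levi_civita N h) X (\<lambda>q. differential M N \<phi> q (Y q)) p
     - differential M N \<phi> p (levi_civita M g X Y p)"

text \<open>The basis of the model space only serves to index a family of \<open>DIM('e)\<close> vector fields.\<close>

definition orthonormal_at ::
  "('a, 'e::euclidean_space) manifold \<Rightarrow> ('a, 'e) metric_tensor \<Rightarrow> 'a
     \<Rightarrow> ('e \<Rightarrow> 'a \<Rightarrow> ('a, 'e) tangent) \<Rightarrow> bool" where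
  "orthonormal_at M g p E \<longleftrightarrow>
     (\<forall>i\<in>Basis. smooth_vector_field M (E i)) \<and>
     (\<forall>i\<in>Basis. \<forall>j\<in>Basis. g p (E i p) (E j p) = (if i = j then 1 else 0))"

text \<open>The trace of the second fundamental form at \<open>p\<close>. The form is tensorial, hence its trace is
  the sum over vector fields that extend an orthonormal basis of the tangent space at \<open>p\<close>,
  whichever basis and extensions are chosen.\<close>

definition tension_field ::
  "('a, 'e::euclidean_space) manifold \<Rightarrow> ('a, 'e) metric_tensor
     \<Rightarrow> ('b, 'f::euclidean_space) manifold \<Rightarrow> ('b, 'f) metric_tensor \<Rightarrow> ('a \<Rightarrow> 'b)
     \<Rightarrow> 'a \<Rightarrow> ('b, 'f) tangent" where
  "tension_field M g N h \<phi> p =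
     (let E = (SOME E. orthonormal_at M g p E) in
      \<Sum>i\<in>Basis. second_fundamental_form M g N h \<phi> (E i) (E i) p)"

definition harmonic_map ::
  "('a, 'e::euclidean_space) manifold \<Rightarrow> ('a, 'e) metric_tensor
     \<Rightarrow> ('b, 'f::euclidean_space) manifold \<Rightarrow> ('b, 'f) metric_tensor \<Rightarrow> ('a \<Rightarrow> 'b) \<Rightarrow> bool" where
  "harmonic_map M g N h \<phi> \<longleftrightarrow>
     smooth_map M N \<phi> \<and> (\<forall>p\<in>topspace (man_top M). tension_field M g N h \<phi> p = 0)"

section \<open>Lie groups\<close>

definition lie_group ::
  "('a, 'b) monoid_scheme \<Rightarrow> ('a, 'e::euclidean_space) manifold \<Rightarrow> bool" where
  "lie_group G M \<longleftrightarrow>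
     group G \<and> smooth_manifold M \<and> topspace (man_top M) = carrier G \<and>
     smooth_map (prod_manifold M M) M (\<lambda>(p, q). p \<otimes>\<^bsub>G\<^esub> q) \<and>
     smooth_map M M (\<lambda>p. inv\<^bsub>G\<^esub> p)"

text \<open>The Lie algebra is the tangent space at the identity; its bracket is the bracket of the
  left-invariant vector fields.\<close>

definition left_invariant_field ::
  "('a, 'b) monoid_scheme \<Rightarrow> ('a, 'e::euclidean_space) manifold
     \<Rightarrow> ('a, 'e) tangent \<Rightarrow> 'a \<Rightarrow> ('a, 'e) tangent" where
  "left_invariant_field G M u p = differential M M (\<lambda>q. p \<otimes>\<^bsub>G\<^esub> q) \<one>\<^bsub>G\<^esub> u"

definition lie_bracket ::
  "('a, 'b) monoid_scheme \<Rightarrow> ('a, 'e::euclidean_space) manifold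
     \<Rightarrow> ('a, 'e) tangent \<Rightarrow> ('a, 'e) tangent \<Rightarrow> ('a, 'e) tangent" where
  "lie_bracket G M u v =
     field_bracket M (left_invariant_field G M u) (left_invariant_field G M v) \<one>\<^bsub>G\<^esub>"

definition trace_on :: "'v::real_vector set \<Rightarrow> ('v \<Rightarrow> 'v) \<Rightarrow> real" where
  "trace_on V f =
     (let B = (SOME B. independent B \<and> span B = V) in \<Sum>b\<in>B. representation B (f b) b)"

definition killing_form ::
  "('a, 'b) monoid_scheme \<Rightarrow> ('a, 'e::euclidean_space) manifold
     \<Rightarrow> ('a, 'e) tangent \<Rightarrow> ('a, 'e) tangent \<Rightarrow> real" where
  "killing_form G M u v =
     trace_on (tangent_space M \<one>\<^bsub>G\<^esub>) (\<lambda>w. lie_bracket G M u (lie_bracket G M v w))"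

definition bi_invariant_metric ::
  "('a, 'b) monoid_scheme \<Rightarrow> ('a, 'e::euclidean_space) manifold \<Rightarrow> ('a, 'e) metric_tensor \<Rightarrow> bool"
where
  "bi_invariant_metric G M g \<longleftrightarrow>
     riemannian_metric M g \<and>
     (\<forall>a\<in>carrier G. \<forall>p\<in>carrier G. \<forall>u\<in>tangent_space M p. \<forall>v\<in>tangent_space M p.
        g (a \<otimes>\<^bsub>G\<^esub> p) (differential M M (\<lambda>q. a \<otimes>\<^bsub>G\<^esub> q) p u)
                     (differential M M (\<lambda>q. a \<otimes>\<^bsub>G\<^esub> q) p v) = g p u v \<and>
        g (p \<otimes>\<^bsub>G\<^esub> a) (differential M M (\<lambda>q. q \<otimes>\<^bsub>G\<^esub> a) p u)
                     (differential M M (\<lambda>q. q \<otimes>\<^bsub>G\<^esub> a) p v) = g p u v)"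

section \<open>Symmetric triples\<close>

definition fixed_points :: "('a, 'b) monoid_scheme \<Rightarrow> ('a \<Rightarrow> 'a) \<Rightarrow> 'a set" where
  "fixed_points G \<sigma> = {p \<in> carrier G. \<sigma> p = p}"

definition symmetric_triple ::
  "('a, 'b) monoid_scheme \<Rightarrow> ('a, 'e::euclidean_space) manifold \<Rightarrow> 'a set \<Rightarrow> ('a \<Rightarrow> 'a) \<Rightarrow> bool"
where
  "symmetric_triple G M K \<sigma> \<longleftrightarrow>
     lie_group G M \<and>
     \<sigma> \<in> iso G G \<and> smooth_map M M \<sigma> \<and> (\<forall>p\<in>carrier G. \<sigma> (\<sigma> p) = p) \<and>
     subgroup K G \<and> compactin (man_top M) K \<and>
     compactin (man_top M) (fixed_points G \<sigma>) \<and>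
     connected_component_of_set (subtopology (man_top M) (fixed_points G \<sigma>)) \<one>\<^bsub>G\<^esub> \<subseteq> K \<and>
     K \<subseteq> fixed_points G \<sigma>"

definition cartan_k ::
  "('a, 'b) monoid_scheme \<Rightarrow> ('a, 'e::euclidean_space) manifold \<Rightarrow> ('a \<Rightarrow> 'a)
     \<Rightarrow> ('a, 'e) tangent set" where
  "cartan_k G M \<sigma> = {u \<in> tangent_space M \<one>\<^bsub>G\<^esub>. differential M M \<sigma> \<one>\<^bsub>G\<^esub> u = u}"

definition cartan_p ::
  "('a, 'b) monoid_scheme \<Rightarrow> ('a, 'e::euclidean_space) manifold \<Rightarrow> ('a \<Rightarrow> 'a)
     \<Rightarrow> ('a, 'e) tangent set" where
  "cartan_p G M \<sigma> = {u \<in> tangent_space M \<one>\<^bsub>G\<^esub>. differential M M \<sigma> \<one>\<^bsub>G\<^esub> u = - u}"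

definition compact_type ::
  "('a, 'b) monoid_scheme \<Rightarrow> ('a, 'e::euclidean_space) manifold \<Rightarrow> ('a \<Rightarrow> 'a) \<Rightarrow> bool" where
  "compact_type G M \<sigma> \<longleftrightarrow> (\<forall>u\<in>cartan_p G M \<sigma>. u \<noteq> 0 \<longrightarrow> killing_form G M u u < 0)"

definition cartan_map :: "('a, 'b) monoid_scheme \<Rightarrow> ('a \<Rightarrow> 'a) \<Rightarrow> 'a \<Rightarrow> 'a" where
  "cartan_map G \<sigma> p = p \<otimes>\<^bsub>G\<^esub> \<sigma> (inv\<^bsub>G\<^esub> p)"

section \<open>The homogeneous space and its dimension\<close>

definition quotient_topology :: "'a topology \<Rightarrow> ('a \<Rightarrow> 'b) \<Rightarrow> 'b topology" where
  "quotient_topology T \<pi> =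
     topology (\<lambda>U. U \<subseteq> \<pi> ` topspace T \<and> openin T {x \<in> topspace T. \<pi> x \<in> U})"

lemma openin_quotient_topology:
  "openin (quotient_topology T \<pi>) U \<longleftrightarrow>
     U \<subseteq> \<pi> ` topspace T \<and> openin T {x \<in> topspace T. \<pi> x \<in> U}"
proof -
  have "istopology (\<lambda>U. U \<subseteq> \<pi> ` topspace T \<and> openin T {x \<in> topspace T. \<pi> x \<in> U})"
    unfolding istopology_def
  proof (intro conjI allI impI)
    fix S U
    assume S: "S \<subseteq> \<pi> ` topspace T \<and> openin T {x \<in> topspace T. \<pi> x \<in> S}"
      and U: "U \<subseteq> \<pi> ` topspace T \<and> openin T {x \<in> topspace T. \<pi> x \<in> U}"
    have "{x \<in> topspace T. \<pi> x \<in> S \<inter> U} =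
            {x \<in> topspace T. \<pi> x \<in> S} \<inter> {x \<in> topspace T. \<pi> x \<in> U}" by auto
    then show "openin T {x \<in> topspace T. \<pi> x \<in> S \<inter> U}" using S U by auto
    show "S \<inter> U \<subseteq> \<pi> ` topspace T" using S by auto
  next
    fix \<U>
    assume \<U>: "\<forall>S\<in>\<U>. S \<subseteq> \<pi> ` topspace T \<and> openin T {x \<in> topspace T. \<pi> x \<in> S}"
    have "{x \<in> topspace T. \<pi> x \<in> \<Union> \<U>} = (\<Union>S\<in>\<U>. {x \<in> topspace T. \<pi> x \<in> S})" by auto
    then show "openin T {x \<in> topspace T. \<pi> x \<in> \<Union> \<U>}" using \<U> by auto
    show "\<Union> \<U> \<subseteq> \<pi> ` topspace T" using \<U> by blast
  qed
  then show ?thesis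
    unfolding quotient_topology_def by (simp add: topology_inverse')
qed

lemma quotient_map_quotient_topology: "quotient_map T (quotient_topology T \<pi>) \<pi>"
proof -
  have "topspace (quotient_topology T \<pi>) = \<pi> ` topspace T"
  proof
    show "topspace (quotient_topology T \<pi>) \<subseteq> \<pi> ` topspace T"
      using openin_quotient_topology [of T \<pi> "topspace (quotient_topology T \<pi>)"] by auto
    have "openin (quotient_topology T \<pi>) (\<pi> ` topspace T)"
      unfolding openin_quotient_topology by (simp add: Collect_mem_eq [symmetric] cong: conj_cong)
    then show "\<pi> ` topspace T \<subseteq> topspace (quotient_topology T \<pi>)"
      by (rule openin_subset)
  qed
  then show ?thesis
    by (auto simp: quotient_map_def openin_quotient_topology)
qed

definition coset_space ::
  "('a, 'b) monoid_scheme \<Rightarrow> ('a, 'e) manifold \<Rightarrow> 'a set \<Rightarrow> 'a set topology" where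
  "coset_space G M K = quotient_topology (man_top M) (\<lambda>p. p <#\<^bsub>G\<^esub> K)"

text \<open>The dimension of a manifold as a property of its topology; for a nonempty space there is at
  most one such \<open>n\<close> by invariance of domain.\<close>

definition has_manifold_dimension :: "'a topology \<Rightarrow> nat \<Rightarrow> bool" where
  "has_manifold_dimension X n \<longleftrightarrow>
     (\<forall>x\<in>topspace X. \<exists>U V.
        openin X U \<and> x \<in> U \<and> openin (Euclidean_space n) V \<and>
        subtopology X U homeomorphic_space subtopology (Euclidean_space n) V)"

end

theory Submission
  imports Defs
begin

text \<open>The Cartan map is harmonic because it is compatible with a pair of point reflections. Fix a point
  \<open>a\<close> and put \<open>b = \<Phi>(a) = a \<sigma>(a)\<^sup>-\<^sup>1\<close>. The map \<open>S(x) = b \<sigma>(x)\<close> fixes \<open>a\<close>, the map \<open>T(y) = b y\<^sup>-\<^sup>1 b\<close> is the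
  geodesic symmetry of the group at \<open>b\<close>: it fixes \<open>b\<close> and its differential there is \<open>-1\<close>. Both are
  isometries: translations are isometries by bi-invariance, the inversion is one since its
  differential at the identity is \<open>-1\<close> (\<open>differential_inv_one\<close>), and \<open>\<sigma>\<close> is one since its differential
  at the identity is \<open>1\<close> on \<open>\<kk>\<close> and \<open>-1\<close> on \<open>\<pp>\<close>, which are orthogonal (\<open>metric_\<sigma>_at_one\<close>). A computation in
  the group gives \<open>\<Phi> \<circ> S = T \<circ> \<Phi>\<close> (\<open>cartan_map_equivariant\<close>). The second fundamental form is natural
  under isometries (\<open>II_push_field\<close>), so the tension field at \<open>a\<close> satisfies \<open>\<tau> = dT(\<tau>) = -\<tau>\<close> and
  vanishes (\<open>tension_field_eq_0_of_symmetry\<close>).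

  Since the tension field is defined by choosing a Levi-Civita connection, a pull-back connection and
  an orthonormal family of vector fields, all three have to be shown to exist, and the result has to
  be shown not to depend on the choice. A Lie group has a global orthonormal frame of left-invariant
  fields (\<open>left_invariant_orthonormal_frame\<close>), so no partitions of unity are needed. In such a frame
  Koszul's formula prescribes the Christoffel symbols, and one explicit formula gives
  both connections (\<open>frame_connection\<close>). Uniqueness and naturality of the Levi-Civita connection
  follow from Koszul's formula (\<open>koszul_formula\<close>, \<open>levi_civita_push_field\<close>); the values of the pull-back
  connection follow from the Leibniz rule by expanding sections in the frame. The independence of
  the trace from the orthonormal basis is \<open>II_trace\<close>.\<close>

section \<open>Smooth maps between normed spaces\<close>

text \<open>The derivative of a map at a point, as used in the definition of smoothness. It is an arbitrary
  function when the map is not differentiable there.\<close>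

abbreviation fderiv :: "('e::real_normed_vector \<Rightarrow> 'f::real_normed_vector) \<Rightarrow> 'e \<Rightarrow> 'e \<Rightarrow> 'f" where
  "fderiv f x \<equiv> frechet_derivative f (at x)"

lemma fderiv_eqI: "(f has_derivative f') (at x) \<Longrightarrow> fderiv f x = f'"
  by (rule frechet_derivative_at [symmetric])

lemma fderiv_cong_open:
  assumes "open S" "x \<in> S" "\<And>y. y \<in> S \<Longrightarrow> f y = g y"
  shows "fderiv f x = fderiv g x"
proof -
  have "(f has_derivative f') (at x) \<longleftrightarrow> (g has_derivative f') (at x)" for f'
    using has_derivative_transform_within_open [OF _ assms(1,2)] assms(3) by metis
  then show ?thesis by (simp add: frechet_derivative_def)
qed

lemma Ck_on_subset: "Ck_on k S f \<Longrightarrow> T \<subseteq> S \<Longrightarrow> Ck_on k T f"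
  by (induction k arbitrary: f) (auto intro: continuous_on_subset)

lemma Ck_on_cong:
  assumes "open S" "\<And>y. y \<in> S \<Longrightarrow> f y = g y" "Ck_on k S f"
  shows "Ck_on k S g"
  using assms(2,3)
proof (induction k arbitrary: f g)
  case 0
  then show ?case using continuous_on_cong [of S S f g] by simp
next
  case (Suc k)
  have "g differentiable (at x)" if "x \<in> S" for x
    using Suc.prems that assms(1) unfolding differentiable_def Ck_on.simps
    by (metis has_derivative_transform_within_open)
  moreover have "Ck_on k S (\<lambda>x. fderiv g x v)" for v
  proof (rule Suc.IH)
    show "Ck_on k S (\<lambda>x. fderiv f x v)" using Suc.prems by simp
    show "fderiv f y v = fderiv g y v" if "y \<in> S" for y
      using fderiv_cong_open [OF assms(1) that] Suc.prems(1) by metis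
  qed
  ultimately show ?case by simp
qed

lemma Ck_on_lower: "Ck_on (Suc k) S f \<Longrightarrow> Ck_on k S f"
proof (induction k arbitrary: f)
  case 0
  then show ?case
    by (auto intro!: continuous_at_imp_continuous_on differentiable_imp_continuous_within)
next
  case (Suc k)
  then have "Ck_on k S (\<lambda>x. fderiv f x v)" for v
    by (intro Suc.IH) (simp del: Ck_on.simps(2) add: Ck_on.simps(2) [of "Suc k"])
  with Suc.prems show ?case by simp
qed

lemma Ck_on_local:
  assumes "\<And>x. x \<in> S \<Longrightarrow> \<exists>U. open U \<and> x \<in> U \<and> Ck_on k U f"
  shows "Ck_on k S f"
  using assms
proof (induction k arbitrary: f)
  case 0
  have "continuous (at x) f" if "x \<in> S" for x
    using 0 [OF that] continuous_on_eq_continuous_at [of _ f] by auto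
  then show ?case by (simp add: continuous_at_imp_continuous_on)
next
  case (Suc k)
  show ?case unfolding Ck_on.simps
  proof (intro conjI ballI allI)
    show "f differentiable (at x)" if "x \<in> S" for x
      using Suc.prems [OF that] by auto
    show "Ck_on k S (\<lambda>x. fderiv f x v)" for v
    proof (rule Suc.IH)
      fix x assume "x \<in> S"
      from Suc.prems [OF this]
      show "\<exists>U. open U \<and> x \<in> U \<and> Ck_on k U (\<lambda>x. fderiv f x v)" by auto
    qed
  qed
qed

lemma Ck_on_const: "Ck_on k S (\<lambda>x. c)"
  by (induction k arbitrary: c) auto

lemma Ck_on_ident: "Ck_on k S (\<lambda>x. x)"
  by (cases k) (auto intro: Ck_on_const)

lemma Ck_on_has_derivative:
  "Ck_on (Suc k) S f \<Longrightarrow> x \<in> S \<Longrightarrow> (f has_derivative fderiv f x) (at x)"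
  by (simp add: frechet_derivative_works [symmetric])

lemma Ck_on_SucI:
  assumes "open S" "\<And>x. x \<in> S \<Longrightarrow> (f has_derivative f' x) (at x)"
    and "\<And>v. Ck_on k S (\<lambda>x. f' x v)"
  shows "Ck_on (Suc k) S f"
  unfolding Ck_on.simps
proof (intro conjI ballI allI)
  show "f differentiable (at x)" if "x \<in> S" for x
    using assms(2) [OF that] by (rule differentiableI)
  show "Ck_on k S (\<lambda>x. fderiv f x v)" for v
    by (rule Ck_on_cong [OF assms(1) _ assms(3) [of v]]) (simp add: fderiv_eqI [OF assms(2)])
qed

lemma Ck_on_add:
  assumes "open S"
  shows "Ck_on k S f \<Longrightarrow> Ck_on k S g \<Longrightarrow> Ck_on k S (\<lambda>x. f x + g x)"
proof (induction k arbitrary: f g)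
  case 0
  then show ?case by (auto intro: continuous_intros)
next
  case (Suc k)
  show ?case
  proof (rule Ck_on_SucI [OF assms])
    show "((\<lambda>x. f x + g x) has_derivative (\<lambda>v. fderiv f x v + fderiv g x v)) (at x)" if "x \<in> S" for x
      using Suc.prems that by (intro has_derivative_add Ck_on_has_derivative)
    show "Ck_on k S (\<lambda>x. fderiv f x v + fderiv g x v)" for v
      using Suc by simp
  qed
qed

lemma Ck_on_sum:
  assumes "open S" "\<And>i. i \<in> I \<Longrightarrow> Ck_on k S (f i)"
  shows "Ck_on k S (\<lambda>x. \<Sum>i\<in>I. f i x)"
  using assms(2)
  by (induction I rule: infinite_finite_induct) (auto intro: Ck_on_const Ck_on_add [OF assms(1)])

lemma Ck_on_bounded_linear:
  assumes "open S" "bounded_linear L"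
  shows "Ck_on k S f \<Longrightarrow> Ck_on k S (\<lambda>x. L (f x))"
proof (induction k arbitrary: f)
  case 0
  then show ?case by (auto intro: bounded_linear.continuous_on [OF assms(2)])
next
  case (Suc k)
  show ?case
  proof (rule Ck_on_SucI [OF assms(1)])
    show "((\<lambda>x. L (f x)) has_derivative (\<lambda>v. L (fderiv f x v))) (at x)" if "x \<in> S" for x
      using Suc.prems that by (intro bounded_linear.has_derivative [OF assms(2)] Ck_on_has_derivative)
    show "Ck_on k S (\<lambda>x. L (fderiv f x v))" for v
      using Suc by simp
  qed
qed

lemma Ck_on_bounded_bilinear:
  assumes "open S" "bounded_bilinear B"
  shows "Ck_on k S f \<Longrightarrow> Ck_on k S g \<Longrightarrow> Ck_on k S (\<lambda>x. B (f x) (g x))"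
proof (induction k arbitrary: f g)
  case 0
  then show ?case by (auto intro: bounded_bilinear.continuous_on [OF assms(2)])
next
  case (Suc k)
  show ?case
  proof (rule Ck_on_SucI [OF assms(1)])
    show "((\<lambda>x. B (f x) (g x)) has_derivative (\<lambda>v. B (f x) (fderiv g x v) + B (fderiv f x v) (g x))) (at x)"
      if "x \<in> S" for x
      using Suc.prems that by (intro bounded_bilinear.FDERIV [OF assms(2)] Ck_on_has_derivative)
    show "Ck_on k S (\<lambda>x. B (f x) (fderiv g x v) + B (fderiv f x v) (g x))" for v
      using Suc.prems Ck_on_lower [OF Suc.prems(1)] Ck_on_lower [OF Suc.prems(2)]
      by (intro Ck_on_add [OF assms(1)] Suc.IH) auto
  qed
qed

lemma linear_basis_expansion:
  fixes L :: "'e::euclidean_space \<Rightarrow> 'f::real_vector"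
  assumes "linear L"
  shows "L x = (\<Sum>b\<in>Basis. (x \<bullet> b) *\<^sub>R L b)"
proof -
  have "L x = L (\<Sum>b\<in>Basis. (x \<bullet> b) *\<^sub>R b)" by (simp add: euclidean_representation)
  also have "\<dots> = (\<Sum>b\<in>Basis. (x \<bullet> b) *\<^sub>R L b)"
    using assms by (simp add: linear_sum linear_cmul)
  finally show ?thesis .
qed

text \<open>The definition of \<open>Ck_on\<close> only speaks about derivatives in constant directions. The derivative of a
  composition is therefore expanded in the basis of the intermediate space, which is the reason why
  that space is Euclidean here.\<close>

lemma Ck_on_compose:
  fixes g :: "'e::real_normed_vector \<Rightarrow> 'f::euclidean_space" and f :: "'f \<Rightarrow> 'h::real_normed_vector"
  assumes "open S" "open T" "g ` S \<subseteq> T"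
  shows "Ck_on k S g \<Longrightarrow> Ck_on k T f \<Longrightarrow> Ck_on k S (\<lambda>x. f (g x))"
proof (induction k arbitrary: f)
  case 0
  then show ?case using assms(3) continuous_on_compose2 by (metis Ck_on.simps(1))
next
  case (Suc k)
  show ?case
  proof (rule Ck_on_SucI [OF assms(1)])
    show "((\<lambda>x. f (g x)) has_derivative
            (\<lambda>v. \<Sum>b\<in>Basis. (fderiv g x v \<bullet> b) *\<^sub>R fderiv f (g x) b)) (at x)" if "x \<in> S" for x
    proof -
      have f: "(f has_derivative fderiv f (g x)) (at (g x))"
        using Suc.prems(2) that assms(3) by (intro Ck_on_has_derivative) auto
      have g: "(g has_derivative fderiv g x) (at x)"
        using Suc.prems(1) that by (intro Ck_on_has_derivative)
      have "(\<lambda>v. fderiv f (g x) (fderiv g x v)) =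
              (\<lambda>v. \<Sum>b\<in>Basis. (fderiv g x v \<bullet> b) *\<^sub>R fderiv f (g x) b)"
        by (rule ext) (rule linear_basis_expansion [OF has_derivative_linear [OF f]])
      then show ?thesis using has_derivative_compose [OF g f] by argo
    qed
    have g: "Ck_on k S g" using Suc.prems(1) by (rule Ck_on_lower)
    have "Ck_on k S (\<lambda>x. (fderiv g x v \<bullet> b) *\<^sub>R fderiv f (g x) b)" for v b
      using Suc.prems
      by (intro Ck_on_bounded_bilinear [OF assms(1) bounded_bilinear_scaleR] Suc.IH [OF g]
          Ck_on_bounded_linear [OF assms(1) bounded_linear_inner_left]) auto
    then show "Ck_on k S (\<lambda>x. \<Sum>b\<in>Basis. (fderiv g x v \<bullet> b) *\<^sub>R fderiv f (g x) b)" for v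
      by (intro Ck_on_sum assms(1))
  qed
qed

lemma smooth_on_open: "smooth_on S f \<Longrightarrow> open S"
  by (simp add: smooth_on_def)

lemma smooth_on_cong:
  "smooth_on S f \<Longrightarrow> (\<And>y. y \<in> S \<Longrightarrow> f y = g y) \<Longrightarrow> smooth_on S g"
  unfolding smooth_on_def by (blast intro: Ck_on_cong)

lemma smooth_on_subset: "smooth_on S f \<Longrightarrow> open T \<Longrightarrow> T \<subseteq> S \<Longrightarrow> smooth_on T f"
  unfolding smooth_on_def using Ck_on_subset by blast

lemma smooth_on_local:
  assumes "open S" "\<And>x. x \<in> S \<Longrightarrow> \<exists>U. x \<in> U \<and> smooth_on U f"
  shows "smooth_on S f"
  unfolding smooth_on_def
proof (intro conjI allI assms(1))
  show "Ck_on k S f" for k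
    using assms(2) by (intro Ck_on_local) (auto simp: smooth_on_def)
qed

lemma smooth_on_const: "open S \<Longrightarrow> smooth_on S (\<lambda>x. c)"
  by (simp add: smooth_on_def Ck_on_const)

lemma smooth_on_ident: "open S \<Longrightarrow> smooth_on S (\<lambda>x. x)"
  by (simp add: smooth_on_def Ck_on_ident)

lemma smooth_on_add: "smooth_on S f \<Longrightarrow> smooth_on S g \<Longrightarrow> smooth_on S (\<lambda>x. f x + g x)"
  by (simp add: smooth_on_def Ck_on_add)

lemma smooth_on_sum:
  "open S \<Longrightarrow> (\<And>i. i \<in> I \<Longrightarrow> smooth_on S (f i)) \<Longrightarrow> smooth_on S (\<lambda>x. \<Sum>i\<in>I. f i x)"
  by (simp add: smooth_on_def Ck_on_sum)

lemma smooth_on_bounded_linear: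
  "bounded_linear L \<Longrightarrow> smooth_on S f \<Longrightarrow> smooth_on S (\<lambda>x. L (f x))"
  by (simp add: smooth_on_def Ck_on_bounded_linear)

lemma smooth_on_bounded_bilinear:
  "bounded_bilinear B \<Longrightarrow> smooth_on S f \<Longrightarrow> smooth_on S g \<Longrightarrow> smooth_on S (\<lambda>x. B (f x) (g x))"
  by (simp add: smooth_on_def Ck_on_bounded_bilinear)

lemmas smooth_on_scaleR = smooth_on_bounded_bilinear [OF bounded_bilinear_scaleR]
lemmas smooth_on_mult = smooth_on_bounded_bilinear [OF bounded_bilinear_mult]
lemmas smooth_on_inner_left = smooth_on_bounded_linear [OF bounded_linear_inner_left]

lemma smooth_on_Pair:
  assumes "smooth_on S f" "smooth_on S g"
  shows "smooth_on S (\<lambda>x. (f x, g x))"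
proof -
  have "bounded_linear (\<lambda>x. (x, 0))" "bounded_linear (\<lambda>y. (0, y))"
    by (intro bounded_linear_Pair bounded_linear_ident bounded_linear_zero)+
  from smooth_on_add [OF smooth_on_bounded_linear [OF this(1) assms(1)]
                         smooth_on_bounded_linear [OF this(2) assms(2)]]
  show ?thesis by simp
qed

lemma smooth_on_compose:
  fixes g :: "'e::real_normed_vector \<Rightarrow> 'f::euclidean_space"
  shows "smooth_on S g \<Longrightarrow> smooth_on T f \<Longrightarrow> g ` S \<subseteq> T \<Longrightarrow> smooth_on S (\<lambda>x. f (g x))"
  unfolding smooth_on_def by (blast intro: Ck_on_compose)

lemma smooth_on_has_derivative:
  "smooth_on S f \<Longrightarrow> x \<in> S \<Longrightarrow> (f has_derivative fderiv f x) (at x)"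
  unfolding smooth_on_def by (blast intro: Ck_on_has_derivative)

lemma smooth_on_linear_fderiv: "smooth_on S f \<Longrightarrow> x \<in> S \<Longrightarrow> linear (fderiv f x)"
  using smooth_on_has_derivative has_derivative_linear by blast

lemma smooth_on_fderiv_const: "smooth_on S f \<Longrightarrow> smooth_on S (\<lambda>x. fderiv f x v)"
  unfolding smooth_on_def
proof safe
  fix k assume "\<forall>k. Ck_on k S f"
  then have "Ck_on (Suc k) S f" by blast
  then show "Ck_on k S (\<lambda>x. fderiv f x v)" by simp
qed

text \<open>A derivative in a direction that varies smoothly.\<close>

lemma smooth_on_fderiv:
  fixes f :: "'e::euclidean_space \<Rightarrow> 'f::real_normed_vector"
  assumes "smooth_on S f" "smooth_on S w"
  shows "smooth_on S (\<lambda>x. fderiv f x (w x))"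
proof (rule smooth_on_cong)
  show "smooth_on S (\<lambda>x. \<Sum>b\<in>Basis. (w x \<bullet> b) *\<^sub>R fderiv f x b)"
    using assms by (intro smooth_on_sum smooth_on_scaleR smooth_on_inner_left smooth_on_fderiv_const)
      (auto simp: smooth_on_open)
  show "(\<Sum>b\<in>Basis. (w y \<bullet> b) *\<^sub>R fderiv f y b) = fderiv f y (w y)" if "y \<in> S" for y
    by (rule linear_basis_expansion [OF smooth_on_linear_fderiv [OF assms(1) that], symmetric])
qed

lemma fderiv_compose:
  assumes "(g has_derivative g') (at x)" "(f has_derivative f') (at (g x))"
  shows "fderiv (\<lambda>x. f (g x)) x v = f' (g' v)"
  using fderiv_eqI [OF has_derivative_compose [OF assms]] by simp

text \<open>Mean value theorem applied twice to the mixed second difference of \<open>f\<close>.\<close>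

lemma second_difference_mvt:
  fixes f :: "'e::real_normed_vector \<Rightarrow> real"
  assumes S: "smooth_on S f" and h: "0 < h"
    and sub: "\<And>s t. 0 \<le> s \<Longrightarrow> s \<le> h \<Longrightarrow> 0 \<le> t \<Longrightarrow> t \<le> h \<Longrightarrow> x + s *\<^sub>R u + t *\<^sub>R v \<in> S"
  shows "\<exists>s t. 0 \<le> s \<and> s \<le> h \<and> 0 \<le> t \<and> t \<le> h \<and>
    f (x + h *\<^sub>R u + h *\<^sub>R v) - f (x + h *\<^sub>R u) - f (x + h *\<^sub>R v) + f x
      = h * (h * fderiv (\<lambda>y. fderiv f y u) (x + s *\<^sub>R u + t *\<^sub>R v) v)"
proof -
  have d: "(f has_derivative fderiv f y) (at y)" if "y \<in> S" for y
    using smooth_on_has_derivative [OF S that] .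
  have S': "smooth_on S (\<lambda>y. fderiv f y u)" by (rule smooth_on_fderiv_const [OF S])
  have d': "((\<lambda>y. fderiv f y u) has_derivative fderiv (\<lambda>y. fderiv f y u) y) (at y)" if "y \<in> S" for y
    using smooth_on_has_derivative [OF S' that] .
  have line: "((\<lambda>s. F (a + s *\<^sub>R w)) has_real_derivative F' w) (at s)"
    if "(F has_derivative F') (at (a + s *\<^sub>R w))" for F :: "'e \<Rightarrow> real" and F' a w s
  proof -
    have "((\<lambda>s. a + s *\<^sub>R w) has_derivative (\<lambda>r. r *\<^sub>R w)) (at s)"
      by (auto intro!: derivative_eq_intros)
    from has_derivative_compose [OF this that]
    have "((\<lambda>s. F (a + s *\<^sub>R w)) has_derivative (\<lambda>r. F' (r *\<^sub>R w))) (at s)" .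
    then show ?thesis
      using linear_cmul [OF has_derivative_linear [OF that]]
      by (simp add: has_field_derivative_def mult_commute_abs)
  qed
  define \<phi> where "\<phi> s = f ((x + h *\<^sub>R v) + s *\<^sub>R u) - f (x + s *\<^sub>R u)" for s
  have "\<exists>s. s > 0 \<and> s < h \<and> \<phi> h - \<phi> 0 = (h - 0) *
     (fderiv f ((x + h *\<^sub>R v) + s *\<^sub>R u) u - fderiv f (x + s *\<^sub>R u) u)"
  proof (rule MVT2 [OF h])
    fix s assume s: "0 \<le> s" "s \<le> h"
    have "(x + h *\<^sub>R v) + s *\<^sub>R u \<in> S" "x + s *\<^sub>R u \<in> S"
      using sub [OF s, of h] sub [OF s, of 0] h by (simp_all add: algebra_simps)
    then show "(\<phi> has_real_derivative
        fderiv f ((x + h *\<^sub>R v) + s *\<^sub>R u) u - fderiv f (x + s *\<^sub>R u) u) (at s)"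
      unfolding \<phi>_def by (intro DERIV_diff line d)
  qed
  then obtain s where s: "0 < s" "s < h" and
    1: "\<phi> h - \<phi> 0 = h * (fderiv f ((x + h *\<^sub>R v) + s *\<^sub>R u) u - fderiv f (x + s *\<^sub>R u) u)" by auto
  define \<psi> where "\<psi> t = fderiv f ((x + s *\<^sub>R u) + t *\<^sub>R v) u" for t
  have "\<exists>t. t > 0 \<and> t < h \<and> \<psi> h - \<psi> 0 = (h - 0) *
     fderiv (\<lambda>y. fderiv f y u) ((x + s *\<^sub>R u) + t *\<^sub>R v) v"
  proof (rule MVT2 [OF h])
    fix t assume t: "0 \<le> t" "t \<le> h"
    have "(x + s *\<^sub>R u) + t *\<^sub>R v \<in> S" using sub [OF _ _ t, of s] s by auto
    then show "(\<psi> has_real_derivative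
        fderiv (\<lambda>y. fderiv f y u) ((x + s *\<^sub>R u) + t *\<^sub>R v) v) (at t)"
      unfolding \<psi>_def by (intro line d')
  qed
  then obtain t where t: "0 < t" "t < h" and
    2: "\<psi> h - \<psi> 0 = h * fderiv (\<lambda>y. fderiv f y u) ((x + s *\<^sub>R u) + t *\<^sub>R v) v" by auto
  have "\<psi> h - \<psi> 0 = fderiv f ((x + h *\<^sub>R v) + s *\<^sub>R u) u - fderiv f (x + s *\<^sub>R u) u"
    by (simp add: \<psi>_def add_ac)
  with 1 2 have "\<phi> h - \<phi> 0 = h * (h * fderiv (\<lambda>y. fderiv f y u) (x + s *\<^sub>R u + t *\<^sub>R v) v)"
    by simp
  moreover have "\<phi> h - \<phi> 0 = f (x + h *\<^sub>R u + h *\<^sub>R v) - f (x + h *\<^sub>R u) - f (x + h *\<^sub>R v) + f x"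
    by (simp add: \<phi>_def add_ac)
  ultimately show ?thesis
    using s t by (intro exI [of _ s] exI [of _ t]) simp
qed

text \<open>Symmetry of second derivatives: on arbitrarily small parallelograms the mixed difference of \<open>f\<close> is a
  value of either mixed derivative, and both mixed derivatives are continuous.\<close>

lemma fderiv_fderiv_commute_real:
  fixes f :: "'e::real_normed_vector \<Rightarrow> real"
  assumes S: "smooth_on S f" and x: "x \<in> S"
  shows "fderiv (\<lambda>y. fderiv f y u) x v = fderiv (\<lambda>y. fderiv f y v) x u"
proof (rule ccontr)
  define F where "F y = fderiv (\<lambda>y. fderiv f y u) y v" for y
  define G where "G y = fderiv (\<lambda>y. fderiv f y v) y u" for y
  assume "\<not> ?thesis"
  then have ne: "F x \<noteq> G x" by (simp add: F_def G_def)
  have "smooth_on S F" "smooth_on S G" unfolding F_def G_def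
    by (intro smooth_on_fderiv_const S)+
  then have cont: "isCont F x" "isCont G x"
    using has_derivative_continuous smooth_on_has_derivative x by blast+
  define e where "e = \<bar>F x - G x\<bar> / 2"
  have e: "0 < e" using ne by (simp add: e_def)
  obtain d1 where d1: "0 < d1" "\<And>y. dist y x < d1 \<Longrightarrow> dist (F y) (F x) < e"
    using cont(1) e unfolding continuous_at_eps_delta by blast
  obtain d2 where d2: "0 < d2" "\<And>y. dist y x < d2 \<Longrightarrow> dist (G y) (G x) < e"
    using cont(2) e unfolding continuous_at_eps_delta by blast
  obtain d3 where d3: "0 < d3" "ball x d3 \<subseteq> S"
    using smooth_on_open [OF S] x open_contains_ball by blast
  define d where "d = min d1 (min d2 d3)"
  have dpos: "0 < d" using d1 d2 d3 by (simp add: d_def)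
  define h where "h = d / (2 * (norm u + norm v + 1))"
  have pos: "0 < norm u + norm v + 1" by (smt (verit) norm_ge_zero)
  then have h: "0 < h" using dpos by (simp add: h_def)
  have near: "dist (x + s *\<^sub>R u + t *\<^sub>R v) x < d" if "0 \<le> s" "s \<le> h" "0 \<le> t" "t \<le> h" for s t
  proof -
    have "dist (x + s *\<^sub>R u + t *\<^sub>R v) x = norm (s *\<^sub>R u + t *\<^sub>R v)" by (simp add: dist_norm)
    also have "\<dots> \<le> s * norm u + t * norm v"
      using that norm_triangle_ineq [of "s *\<^sub>R u" "t *\<^sub>R v"] by simp
    also have "\<dots> \<le> h * norm u + h * norm v"
      using that by (intro add_mono mult_right_mono) auto
    also have "\<dots> < h * (norm u + norm v + 1)" using h by (simp add: algebra_simps)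
    also have "\<dots> = d / 2" using pos by (simp add: h_def field_simps)
    also have "\<dots> < d" using dpos by simp
    finally show ?thesis .
  qed
  then have sub: "x + s *\<^sub>R u + t *\<^sub>R v \<in> S" if "0 \<le> s" "s \<le> h" "0 \<le> t" "t \<le> h" for s t
    using d3 that by (force simp: d_def dist_commute)
  have sub': "x + s *\<^sub>R v + t *\<^sub>R u \<in> S" if "0 \<le> s" "s \<le> h" "0 \<le> t" "t \<le> h" for s t
    using sub [of t s] that by (simp add: add_ac)
  obtain s t where st: "0 \<le> s" "s \<le> h" "0 \<le> t" "t \<le> h" and
    1: "f (x + h *\<^sub>R u + h *\<^sub>R v) - f (x + h *\<^sub>R u) - f (x + h *\<^sub>R v) + f x = h * (h * F (x + s *\<^sub>R u
        + t *\<^sub>R v))"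
    using second_difference_mvt [OF S h sub] unfolding F_def by auto
  obtain s' t' where st': "0 \<le> s'" "s' \<le> h" "0 \<le> t'" "t' \<le> h" and
    2: "f (x + h *\<^sub>R v + h *\<^sub>R u) - f (x + h *\<^sub>R v) - f (x + h *\<^sub>R u) + f x = h * (h * G (x + s' *\<^sub>R v
        + t' *\<^sub>R u))"
    using second_difference_mvt [OF S h sub'] unfolding G_def by auto
  have "x + h *\<^sub>R v + h *\<^sub>R u = x + h *\<^sub>R u + h *\<^sub>R v" by (simp add: add_ac)
  from 1 2 [unfolded this] have "h * (h * F (x + s *\<^sub>R u + t *\<^sub>R v)) = h * (h * G (x + s' *\<^sub>R v
      + t' *\<^sub>R u))"
    by linarith
  then have eq: "F (x + s *\<^sub>R u + t *\<^sub>R v) = G (x + s' *\<^sub>R v + t' *\<^sub>R u)"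
    using h by simp
  have "dist (F (x + s *\<^sub>R u + t *\<^sub>R v)) (F x) < e"
    by (rule d1(2), rule order.strict_trans2 [OF near [OF st]]) (simp add: d_def)
  moreover have "dist (G (x + s' *\<^sub>R v + t' *\<^sub>R u)) (G x) < e"
  proof (rule d2(2), rule order.strict_trans2)
    show "dist (x + s' *\<^sub>R v + t' *\<^sub>R u) x < d"
      using near [OF st'(3,4,1,2)] by (simp only: add.commute add.left_commute add.assoc)
  qed (simp add: d_def)
  ultimately show False using eq unfolding e_def dist_real_def by (smt (verit) field_sum_of_halves)
qed

lemma fderiv_fderiv_commute:
  fixes f :: "'e::real_normed_vector \<Rightarrow> 'f::euclidean_space"
  assumes S: "smooth_on S f" and x: "x \<in> S"
  shows "fderiv (\<lambda>y. fderiv f y u) x v = fderiv (\<lambda>y. fderiv f y v) x u"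
proof (rule euclidean_eqI)
  fix b :: 'f assume "b \<in> Basis"
  have inner: "fderiv (\<lambda>y. F y \<bullet> b) y w = fderiv F y w \<bullet> b"
    if "smooth_on S F" "y \<in> S" for F :: "'e \<Rightarrow> 'f" and y w
    using bounded_linear.has_derivative
        [OF bounded_linear_inner_left smooth_on_has_derivative [OF that], of b]
    by (simp add: fderiv_eqI)
  have *: "fderiv (\<lambda>y. fderiv f y u) x v \<bullet> b = fderiv (\<lambda>y. fderiv (\<lambda>y. f y \<bullet> b) y u) x v" for u v
  proof -
    have "fderiv (\<lambda>y. fderiv f y u) x v \<bullet> b = fderiv (\<lambda>y. fderiv f y u \<bullet> b) x v"
      using inner [OF smooth_on_fderiv_const [OF S] x] by simp
    also have "\<dots> = fderiv (\<lambda>y. fderiv (\<lambda>y. f y \<bullet> b) y u) x v"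
      by (rule fun_cong [OF fderiv_cong_open [OF smooth_on_open [OF S] x]])
        (rule inner [OF S, symmetric])
    finally show ?thesis .
  qed
  show "fderiv (\<lambda>y. fderiv f y u) x v \<bullet> b = fderiv (\<lambda>y. fderiv f y v) x u \<bullet> b"
    unfolding * by (rule fderiv_fderiv_commute_real [OF smooth_on_inner_left [OF S] x])
qed

section \<open>Charts\<close>

abbreviation pts :: "('a, 'e) manifold \<Rightarrow> 'a set" where
  "pts M \<equiv> topspace (man_top M)"

lemma smooth_manifold_chart:
  assumes "smooth_manifold M" "c \<in> man_atlas M"
  shows "openin (man_top M) (fst c)" "fst c \<subseteq> pts M"
    "inj_on (snd c) (fst c)" "open (snd c ` fst c)"
proof -
  have c: "openin (man_top M) (fst c)" "open (snd c ` fst c)"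
    "homeomorphic_map (subtopology (man_top M) (fst c)) (top_of_set (snd c ` fst c)) (snd c)"
    using assms by (auto simp: smooth_manifold_def chart_on_def)
  show "openin (man_top M) (fst c)" "open (snd c ` fst c)" using c by auto
  show s: "fst c \<subseteq> pts M" using c(1) by (rule openin_subset)
  have "inj_on (snd c) (topspace (subtopology (man_top M) (fst c)))"
    using c(3) homeomorphic_imp_injective_map by blast
  then show "inj_on (snd c) (fst c)" using s by (simp add: topspace_subtopology inf.absorb2)
qed

lemma chart_inv_left:
  assumes "smooth_manifold M" "c \<in> man_atlas M" "p \<in> fst c"
  shows "chart_inv c (snd c p) = p"
  unfolding chart_inv_def by (rule inv_into_f_f [OF smooth_manifold_chart(3) [OF assms(1,2)] assms(3)])

lemma chart_image_open:
  assumes M: "smooth_manifold M" and c: "c \<in> man_atlas M" and U: "openin (man_top M) U"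
  shows "open (snd c ` (fst c \<inter> U))"
proof -
  have "homeomorphic_map (subtopology (man_top M) (fst c)) (top_of_set (snd c ` fst c)) (snd c)"
    using M c by (auto simp: smooth_manifold_def chart_on_def)
  then have "open_map (subtopology (man_top M) (fst c)) (top_of_set (snd c ` fst c)) (snd c)"
    by (rule homeomorphic_imp_open_map)
  moreover have "openin (subtopology (man_top M) (fst c)) (fst c \<inter> U)"
    using U by (metis openin_subtopology inf_commute)
  ultimately have "openin (top_of_set (snd c ` fst c)) (snd c ` (fst c \<inter> U))"
    unfolding open_map_def by blast
  then show ?thesis
    using openin_open_trans smooth_manifold_chart(4) [OF M c] by blast
qed

lemma charts_atD:
  assumes "smooth_manifold M" "c \<in> charts_at M p"
  shows "c \<in> man_atlas M" "p \<in> fst c" "p \<in> pts M"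
proof -
  show c: "c \<in> man_atlas M" "p \<in> fst c" using assms(2) by (auto simp: charts_at_def)
  show "p \<in> pts M" using smooth_manifold_chart(2) [OF assms(1) c(1)] c(2) by blast
qed

lemma charts_at_exists:
  assumes "smooth_manifold M" "p \<in> pts M"
  shows "\<exists>c. c \<in> charts_at M p"
  using assms unfolding smooth_manifold_def charts_at_def by blast

lemma some_chart_at:
  assumes "smooth_manifold M" "p \<in> pts M"
  shows "some_chart_at M p \<in> charts_at M p"
  unfolding some_chart_at_def using charts_at_exists [OF assms] by (rule someI_ex)

section \<open>Smooth maps in coordinates\<close>

text \<open>The derivative of the coordinate expression of \<open>\<phi>\<close> with respect to charts around \<open>p\<close> and \<open>\<phi> p\<close>. For
  \<open>\<phi> = id\<close> it is the Jacobian of the change of coordinates, so that the chain rule below covers both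
  compositions of maps and changes of charts.\<close>

abbreviation coord_deriv ::
  "('b \<Rightarrow> 'd) \<Rightarrow> ('b, 'e::euclidean_space) chart \<Rightarrow> ('d, 'f::euclidean_space) chart \<Rightarrow> 'b \<Rightarrow> 'e \<Rightarrow> 'f" where
  "coord_deriv \<phi> c d p \<equiv> fderiv (snd d \<circ> \<phi> \<circ> chart_inv c) (snd c p)"

lemma smooth_mapD:
  assumes "smooth_map M N \<phi>"
  shows "continuous_map (man_top M) (man_top N) \<phi>"
    "c \<in> man_atlas M \<Longrightarrow> d \<in> man_atlas N \<Longrightarrow>
      smooth_on (snd c ` {p \<in> fst c. \<phi> p \<in> fst d}) (snd d \<circ> \<phi> \<circ> chart_inv c)"
    "p \<in> pts M \<Longrightarrow> \<phi> p \<in> pts N"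
proof -
  show c: "continuous_map (man_top M) (man_top N) \<phi>"
    using assms by (simp add: smooth_map_def)
  show "smooth_on (snd c ` {p \<in> fst c. \<phi> p \<in> fst d}) (snd d \<circ> \<phi> \<circ> chart_inv c)"
    if "c \<in> man_atlas M" "d \<in> man_atlas N"
    using assms that unfolding smooth_map_def by blast
  show "\<phi> p \<in> pts N" if "p \<in> pts M"
    using continuous_map_image_subset_topspace [OF c] that by blast
qed

lemma smooth_map_preimage_open:
  assumes "smooth_manifold M" "smooth_map M N \<phi>" "smooth_manifold N" "d \<in> man_atlas N"
  shows "openin (man_top M) {p \<in> pts M. \<phi> p \<in> fst d}"
  using openin_continuous_map_preimage [OF smooth_mapD(1) [OF assms(2)]
      smooth_manifold_chart(1) [OF assms(3,4)]] .

lemma chart_preimage_image_open: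
  assumes "smooth_manifold M" "smooth_map M N \<phi>" "smooth_manifold N" "c \<in> man_atlas M" "d \<in> man_atlas N"
  shows "open (snd c ` {p \<in> fst c. \<phi> p \<in> fst d})"
proof -
  have "{p \<in> fst c. \<phi> p \<in> fst d} = fst c \<inter> {p \<in> pts M. \<phi> p \<in> fst d}"
    using smooth_manifold_chart(2) [OF assms(1,4)] by auto
  then show ?thesis
    using chart_image_open [OF assms(1,4) smooth_map_preimage_open [OF assms(1,2,3,5)]] by simp
qed

lemma coord_has_derivative:
  assumes "smooth_map M N \<phi>" "c \<in> charts_at M p" "d \<in> charts_at N (\<phi> p)"
  shows "((snd d \<circ> \<phi> \<circ> chart_inv c) has_derivative coord_deriv \<phi> c d p) (at (snd c p))"
proof (rule smooth_on_has_derivative [OF smooth_mapD(2) [OF assms(1)]])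
  show "c \<in> man_atlas M" "d \<in> man_atlas N" using assms by (auto simp: charts_at_def)
  show "snd c p \<in> snd c ` {p \<in> fst c. \<phi> p \<in> fst d}" using assms by (auto simp: charts_at_def)
qed

lemma coord_deriv_linear:
  assumes "smooth_map M N \<phi>" "c \<in> charts_at M p" "d \<in> charts_at N (\<phi> p)"
  shows "linear (coord_deriv \<phi> c d p)"
  using coord_has_derivative [OF assms] by (rule has_derivative_linear)

lemma coord_deriv_compose:
  assumes M: "smooth_manifold M" and N: "smooth_manifold N"
    and f: "smooth_map M N \<phi>" and g: "smooth_map N P \<psi>"
    and c: "c \<in> charts_at M p" and d: "d \<in> charts_at N (\<phi> p)" and e: "e \<in> charts_at P (\<psi> (\<phi> p))"
  shows "coord_deriv (\<psi> \<circ> \<phi>) c e p v = coord_deriv \<psi> d e (\<phi> p) (coord_deriv \<phi> c d p v)"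
proof -
  note c' = charts_atD [OF M c] and d' = charts_atD [OF N d]
  have cp: "chart_inv c (snd c p) = p" by (rule chart_inv_left [OF M c'(1,2)])
  have "coord_deriv (\<psi> \<circ> \<phi>) c e p
      = fderiv (\<lambda>x. (snd e \<circ> \<psi> \<circ> chart_inv d) ((snd d \<circ> \<phi> \<circ> chart_inv c) x)) (snd c p)"
  proof (rule fderiv_cong_open [OF chart_preimage_image_open [OF M f N c'(1) d'(1)]])
    show "snd c p \<in> snd c ` {p \<in> fst c. \<phi> p \<in> fst d}" using c'(2) d'(2) by auto
  next
    fix x assume "x \<in> snd c ` {p \<in> fst c. \<phi> p \<in> fst d}"
    then show "(snd e \<circ> (\<psi> \<circ> \<phi>) \<circ> chart_inv c) x = (snd e \<circ> \<psi> \<circ> chart_inv d) ((snd d \<circ> \<phi> \<circ> chart_inv c) x)"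
      using chart_inv_left [OF M c'(1)] chart_inv_left [OF N d'(1)] by auto
  qed
  then have "coord_deriv (\<psi> \<circ> \<phi>) c e p v
      = fderiv (\<lambda>x. (snd e \<circ> \<psi> \<circ> chart_inv d) ((snd d \<circ> \<phi> \<circ> chart_inv c) x)) (snd c p) v"
    by (rule fun_cong)
  also have "\<dots> = coord_deriv \<psi> d e (\<phi> p) (coord_deriv \<phi> c d p v)"
    by (rule fderiv_compose [OF coord_has_derivative [OF f c d]])
      (use coord_has_derivative [OF g d e] in \<open>simp add: o_def cp\<close>)
  finally show ?thesis .
qed

lemma smooth_map_id: "smooth_manifold M \<Longrightarrow> smooth_map M M id"
  by (auto simp: smooth_map_def smooth_manifold_def Int_def)

lemma smooth_map_compose:
  assumes M: "smooth_manifold M" and N: "smooth_manifold N" and P: "smooth_manifold P"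
    and f: "smooth_map M N \<phi>" and g: "smooth_map N P \<psi>"
  shows "smooth_map M P (\<psi> \<circ> \<phi>)"
  unfolding smooth_map_def
proof (intro conjI ballI)
  show gf: "continuous_map (man_top M) (man_top P) (\<psi> \<circ> \<phi>)"
    using f g by (auto intro: continuous_map_compose smooth_mapD)
  fix c e assume c: "c \<in> man_atlas M" and e: "e \<in> man_atlas P"
  have op: "openin (man_top M) {p \<in> pts M. (\<psi> \<circ> \<phi>) p \<in> fst e}"
    by (rule openin_continuous_map_preimage [OF gf smooth_manifold_chart(1) [OF P e]])
  have eq: "{p \<in> fst c. (\<psi> \<circ> \<phi>) p \<in> fst e} = fst c \<inter> {p \<in> pts M. (\<psi> \<circ> \<phi>) p \<in> fst e}"
    using smooth_manifold_chart(2) [OF M c] by auto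
  show "smooth_on (snd c ` {p \<in> fst c. (\<psi> \<circ> \<phi>) p \<in> fst e}) (snd e \<circ> (\<psi> \<circ> \<phi>) \<circ> chart_inv c)"
  proof (rule smooth_on_local)
    show "open (snd c ` {p \<in> fst c. (\<psi> \<circ> \<phi>) p \<in> fst e})"
      unfolding eq by (rule chart_image_open [OF M c op])
    fix x assume "x \<in> snd c ` {p \<in> fst c. (\<psi> \<circ> \<phi>) p \<in> fst e}"
    then obtain p where p: "p \<in> fst c" "\<psi> (\<phi> p) \<in> fst e" "x = snd c p" by auto
    have pM: "p \<in> pts M" using p(1) smooth_manifold_chart(2) [OF M c] by auto
    obtain d where d: "d \<in> charts_at N (\<phi> p)"
      using charts_at_exists [OF N smooth_mapD(3) [OF f pM]] by blast
    note d' = charts_atD [OF N d]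
    let ?U = "snd c ` (fst c \<inter> ({p \<in> pts M. \<phi> p \<in> fst d} \<inter> {p \<in> pts M. (\<psi> \<circ> \<phi>) p \<in> fst e}))"
    have U: "open ?U"
      by (intro chart_image_open [OF M c] openin_Int op smooth_map_preimage_open [OF M f N d'(1)])
    have "smooth_on ?U (\<lambda>x. (snd e \<circ> \<psi> \<circ> chart_inv d) ((snd d \<circ> \<phi> \<circ> chart_inv c) x))"
    proof (rule smooth_on_compose [where T = "snd d ` {p \<in> fst d. \<psi> p \<in> fst e}"])
      show "smooth_on ?U (snd d \<circ> \<phi> \<circ> chart_inv c)"
        by (rule smooth_on_subset [OF smooth_mapD(2) [OF f c d'(1)] U]) auto
      show "smooth_on (snd d ` {p \<in> fst d. \<psi> p \<in> fst e}) (\<lambda>y. (snd e \<circ> \<psi> \<circ> chart_inv d) y)"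
        using smooth_mapD(2) [OF g d'(1) e] by (simp add: o_def)
      show "(snd d \<circ> \<phi> \<circ> chart_inv c) ` ?U \<subseteq> snd d ` {p \<in> fst d. \<psi> p \<in> fst e}"
        using chart_inv_left [OF M c] by auto
    qed
    then have "smooth_on ?U (snd e \<circ> (\<psi> \<circ> \<phi>) \<circ> chart_inv c)"
      by (rule smooth_on_cong) (use chart_inv_left [OF M c] chart_inv_left [OF N d'(1)] in auto)
    moreover have "x \<in> ?U" using p pM d' by auto
    ultimately show "\<exists>U. x \<in> U \<and> smooth_on U (snd e \<circ> (\<psi> \<circ> \<phi>) \<circ> chart_inv c)"
      by (intro exI conjI)
  qed
qed

lemma coord_deriv_id:
  assumes M: "smooth_manifold M" and c: "c \<in> charts_at M p"
  shows "coord_deriv id c c p v = v"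
proof -
  note c' = charts_atD [OF M c]
  have "coord_deriv id c c p = fderiv (\<lambda>x. x) (snd c p)"
    by (rule fderiv_cong_open [OF smooth_manifold_chart(4) [OF M c'(1)]])
      (use c'(2) chart_inv_left [OF M c'(1)] in auto)
  then show ?thesis by simp
qed

section \<open>Tangent spaces\<close>

lemma tangent_component:
  assumes "v \<in> tangent_space M p" "c \<in> charts_at M p" "d \<in> charts_at M p"
  shows "v d = coord_deriv id c d p (v c)"
proof -
  have "\<forall>c\<in>charts_at M p. \<forall>d\<in>charts_at M p.
      v d = frechet_derivative (snd d \<circ> chart_inv c) (at (snd c p)) (v c)"
    using assms(1) unfolding tangent_space_def mem_Collect_eq by (rule conjunct1)
  from bspec [OF bspec [OF this assms(2)] assms(3)] show ?thesis by (simp only: o_id)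
qed

lemma tangent_outside: "v \<in> tangent_space M p \<Longrightarrow> c \<notin> charts_at M p \<Longrightarrow> v c = 0"
  unfolding tangent_space_def by blast

lemma tangent_eqI:
  assumes "v \<in> tangent_space M p" "w \<in> tangent_space M p" "c \<in> charts_at M p" "v c = w c"
  shows "v = w"
proof
  fix d
  show "v d = w d"
  proof (cases "d \<in> charts_at M p")
    case True
    show ?thesis
      unfolding tangent_component [OF assms(1,3) True] tangent_component [OF assms(2,3) True]
      by (simp only: assms(4))
  next
    case False
    then show ?thesis using assms(1,2) by (simp add: tangent_outside)
  qed
qed

lemma tangent_spaceI:
  assumes "\<And>c d. c \<in> charts_at M p \<Longrightarrow> d \<in> charts_at M p \<Longrightarrow> v d = coord_deriv id c d p (v c)"
    and "\<And>c. c \<notin> charts_at M p \<Longrightarrow> v c = 0"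
  shows "v \<in> tangent_space M p"
  unfolding tangent_space_def mem_Collect_eq
proof (intro conjI ballI allI impI)
  fix c d assume cd: "c \<in> charts_at M p" "d \<in> charts_at M p"
  show "v d = frechet_derivative (snd d \<circ> chart_inv c) (at (snd c p)) (v c)"
    using assms(1) [OF cd] by (simp only: o_id)
qed (rule assms(2))

lemma tangent_add:
  assumes M: "smooth_manifold M" and v: "v \<in> tangent_space M p" and w: "w \<in> tangent_space M p"
  shows "v + w \<in> tangent_space M p"
proof (rule tangent_spaceI)
  fix c d assume cd: "c \<in> charts_at M p" "d \<in> charts_at M p"
  have "linear (coord_deriv id c d p)"
    by (rule coord_deriv_linear [OF smooth_map_id [OF M]]) (use cd in auto)
  from linear_add [OF this] show "(v + w) d = coord_deriv id c d p ((v + w) c)"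
    by (simp only: plus_fun_apply tangent_component [OF v cd] tangent_component [OF w cd])
qed (use v w in \<open>simp add: tangent_outside\<close>)

lemma tangent_scaleR:
  assumes M: "smooth_manifold M" and v: "v \<in> tangent_space M p"
  shows "r *\<^sub>R v \<in> tangent_space M p"
proof (rule tangent_spaceI)
  fix c d assume cd: "c \<in> charts_at M p" "d \<in> charts_at M p"
  have "linear (coord_deriv id c d p)"
    by (rule coord_deriv_linear [OF smooth_map_id [OF M]]) (use cd in auto)
  from linear_cmul [OF this] show "(r *\<^sub>R v) d = coord_deriv id c d p ((r *\<^sub>R v) c)"
    by (simp only: scaleR_fun_apply tangent_component [OF v cd])
qed (use v in \<open>simp add: tangent_outside\<close>)

lemma tangent_zero: "smooth_manifold M \<Longrightarrow> 0 \<in> tangent_space M p"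
proof (rule tangent_spaceI)
  fix c d assume M: "smooth_manifold M" and cd: "c \<in> charts_at M p" "d \<in> charts_at M p"
  have "linear (coord_deriv id c d p)"
    by (rule coord_deriv_linear [OF smooth_map_id [OF M]]) (use cd in auto)
  from linear_0 [OF this] show "(0 :: ('a, 'b) tangent) d
      = coord_deriv id c d p ((0 :: ('a, 'b) tangent) c)"
    by (simp only: zero_fun_apply)
qed simp

lemma tangent_minus: "smooth_manifold M \<Longrightarrow> v \<in> tangent_space M p \<Longrightarrow> - v \<in> tangent_space M p"
  using tangent_scaleR [of M v p "-1"] by (simp only: scaleR_minus1_left)

lemma tangent_diff:
  "smooth_manifold M \<Longrightarrow> v \<in> tangent_space M p \<Longrightarrow> w \<in> tangent_space M p \<Longrightarrow> v - w \<in> tangent_space M p"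
  unfolding diff_conv_add_uminus by (intro tangent_add tangent_minus)

lemma tangent_sum:
  assumes "smooth_manifold M" "\<And>i. i \<in> I \<Longrightarrow> v i \<in> tangent_space M p"
  shows "(\<Sum>i\<in>I. v i) \<in> tangent_space M p"
  using assms(2)
  by (induction I rule: infinite_finite_induct) (simp_all add: tangent_zero tangent_add assms(1))

lemma sum_component: "(\<Sum>i\<in>I. v i) c = (\<Sum>i\<in>I. v i c)" for v :: "'i \<Rightarrow> 'c \<Rightarrow> 'd::comm_monoid_add"
  by (induction I rule: infinite_finite_induct) auto

lemma coord_vector_tangent:
  assumes M: "smooth_manifold M" and c: "c \<in> charts_at M p"
  shows "coord_vector M c p u \<in> tangent_space M p" "coord_vector M c p u c = u"
proof -
  have comp: "coord_vector M c p u d = coord_deriv id c d p u" if "d \<in> charts_at M p" for d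
    using that by (simp add: coord_vector_def)
  show "coord_vector M c p u \<in> tangent_space M p"
  proof (rule tangent_spaceI)
    fix d e assume d: "d \<in> charts_at M p" and e: "e \<in> charts_at M p"
    show "coord_vector M c p u e = coord_deriv id d e p (coord_vector M c p u d)"
      using coord_deriv_compose [OF M M smooth_map_id [OF M] smooth_map_id [OF M] c, of d e] d e
      by (simp only: comp id_apply o_id)
  qed (simp add: coord_vector_def)
  show "coord_vector M c p u c = u"
    using comp [OF c] coord_deriv_id [OF M c] by simp
qed

lemma tangent_coord_expansion:
  assumes M: "smooth_manifold M" and c: "c \<in> charts_at M p" and v: "v \<in> tangent_space M p"
  shows "v = (\<Sum>b\<in>Basis. (v c \<bullet> b) *\<^sub>R coord_vector M c p b)"
proof (rule tangent_eqI [OF v _ c])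
  show "(\<Sum>b\<in>Basis. (v c \<bullet> b) *\<^sub>R coord_vector M c p b) \<in> tangent_space M p"
    by (intro tangent_sum tangent_scaleR coord_vector_tangent M c)
  show "v c = (\<Sum>b\<in>Basis. (v c \<bullet> b) *\<^sub>R coord_vector M c p b) c"
    by (simp add: sum_component coord_vector_tangent(2) [OF M c] euclidean_representation)
qed

section \<open>Differentials\<close>

text \<open>The components of a differential may be computed in any chart around the point, although the
  definition uses a fixed one.\<close>

lemma differential_component:
  assumes M: "smooth_manifold M" and N: "smooth_manifold N" and f: "smooth_map M N \<phi>"
    and c: "c \<in> charts_at M p" and d: "d \<in> charts_at N (\<phi> p)" and v: "v \<in> tangent_space M p"
  shows "differential M N \<phi> p v d = coord_deriv \<phi> c d p (v c)"
proof -
  let ?s = "some_chart_at M p"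
  have s: "?s \<in> charts_at M p" by (rule some_chart_at [OF M charts_atD(3) [OF M c]])
  have "coord_deriv \<phi> c d p (v c) = coord_deriv \<phi> c d (id p) (coord_deriv id ?s c p (v ?s))"
    using tangent_component [OF v s c] by simp
  also have "\<dots> = coord_deriv (\<phi> \<circ> id) ?s d p (v ?s)"
    by (rule coord_deriv_compose [symmetric, OF M M smooth_map_id [OF M] f s]) (use c d in auto)
  finally show ?thesis using d by (simp add: differential_def Let_def)
qed

lemma differential_tangent:
  assumes M: "smooth_manifold M" and N: "smooth_manifold N" and f: "smooth_map M N \<phi>"
    and p: "p \<in> pts M"
  shows "differential M N \<phi> p v \<in> tangent_space N (\<phi> p)"
proof (rule tangent_spaceI)
  let ?s = "some_chart_at M p"
  have s: "?s \<in> charts_at M p" by (rule some_chart_at [OF M p])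
  fix d e assume d: "d \<in> charts_at N (\<phi> p)" and e: "e \<in> charts_at N (\<phi> p)"
  have "coord_deriv (id \<circ> \<phi>) ?s e p (v ?s) = coord_deriv id d e (\<phi> p) (coord_deriv \<phi> ?s d p (v ?s))"
    by (rule coord_deriv_compose [OF M N f smooth_map_id [OF N] s d]) (use e in auto)
  then show "differential M N \<phi> p v e = coord_deriv id d e (\<phi> p) (differential M N \<phi> p v d)"
    using d e by (simp add: differential_def Let_def)
qed (simp add: differential_def Let_def)

lemma differential_compose:
  assumes M: "smooth_manifold M" and N: "smooth_manifold N" and P: "smooth_manifold P"
    and f: "smooth_map M N \<phi>" and g: "smooth_map N P \<psi>"
    and p: "p \<in> pts M" and v: "v \<in> tangent_space M p"
  shows "differential M P (\<psi> \<circ> \<phi>) p v = differential N P \<psi> (\<phi> p) (differential M N \<phi> p v)"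
proof -
  have gf: "smooth_map M P (\<psi> \<circ> \<phi>)" by (rule smooth_map_compose [OF M N P f g])
  have fp: "\<phi> p \<in> pts N" by (rule smooth_mapD(3) [OF f p])
  obtain c where c: "c \<in> charts_at M p" using charts_at_exists [OF M p] by blast
  obtain d where d: "d \<in> charts_at N (\<phi> p)" using charts_at_exists [OF N fp] by blast
  obtain e where e: "e \<in> charts_at P (\<psi> (\<phi> p))"
    using charts_at_exists [OF P smooth_mapD(3) [OF g fp]] by blast
  have t: "differential M N \<phi> p v \<in> tangent_space N (\<phi> p)" by (rule differential_tangent [OF M N f p])
  show ?thesis
  proof (rule tangent_eqI [OF _ _ e])
    show "differential M P (\<psi> \<circ> \<phi>) p v \<in> tangent_space P (\<psi> (\<phi> p))"
      using differential_tangent [OF M P gf p] by simp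
    show "differential N P \<psi> (\<phi> p) (differential M N \<phi> p v) \<in> tangent_space P (\<psi> (\<phi> p))"
      by (rule differential_tangent [OF N P g fp])
    show "differential M P (\<psi> \<circ> \<phi>) p v e = differential N P \<psi> (\<phi> p) (differential M N \<phi> p v) e"
      using differential_component [OF M P gf c _ v, of e] e
        differential_component [OF N P g d e t] differential_component [OF M N f c d v]
        coord_deriv_compose [OF M N f g c d e] by simp
  qed
qed

lemma differential_id:
  assumes M: "smooth_manifold M" and p: "p \<in> pts M" and v: "v \<in> tangent_space M p"
  shows "differential M M id p v = v"
proof -
  obtain c where c: "c \<in> charts_at M p" using charts_at_exists [OF M p] by blast
  show ?thesis
    by (rule tangent_eqI [OF _ v c])
      (use differential_tangent [OF M M smooth_map_id [OF M] p]
         differential_component [OF M M smooth_map_id [OF M] c _ v] c coord_deriv_id [OF M c]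
       in auto)
qed

lemma differential_cong:
  assumes M: "smooth_manifold M" and p: "p \<in> pts M"
    and eq: "\<And>q. q \<in> pts M \<Longrightarrow> \<phi> q = \<psi> q"
  shows "differential M N \<phi> p v = differential M N \<psi> p v"
proof -
  let ?s = "some_chart_at M p"
  have s: "?s \<in> charts_at M p" by (rule some_chart_at [OF M p])
  note s' = charts_atD [OF M s]
  have eqd: "coord_deriv \<phi> ?s d p = coord_deriv \<psi> ?s d p" for d
    by (rule fderiv_cong_open [OF smooth_manifold_chart(4) [OF M s'(1)]])
      (use s' chart_inv_left [OF M s'(1)] eq smooth_manifold_chart(2) [OF M s'(1)] in auto)
  show ?thesis unfolding differential_def Let_def eq [OF p] by (simp only: eqd)
qed

lemma differential_add:
  assumes "smooth_manifold M" "smooth_map M N \<phi>" "p \<in> pts M"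
  shows "differential M N \<phi> p (v + w) = differential M N \<phi> p v + differential M N \<phi> p w"
  unfolding differential_def Let_def fun_eq_iff
  using linear_add [OF coord_deriv_linear [OF assms(2) some_chart_at [OF assms(1,3)]]]
  by (simp del: split_paired_All)

lemma differential_scaleR:
  assumes "smooth_manifold M" "smooth_map M N \<phi>" "p \<in> pts M"
  shows "differential M N \<phi> p (r *\<^sub>R v) = r *\<^sub>R differential M N \<phi> p v"
  unfolding differential_def Let_def fun_eq_iff
  using linear_cmul [OF coord_deriv_linear [OF assms(2) some_chart_at [OF assms(1,3)]]]
  by (simp del: split_paired_All)

lemma differential_sum:
  assumes "smooth_manifold M" "smooth_map M N \<phi>" "p \<in> pts M"
  shows "differential M N \<phi> p (\<Sum>i\<in>I. v i) = (\<Sum>i\<in>I. differential M N \<phi> p (v i))"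
proof -
  have "differential M N \<phi> p 0 = 0"
    using differential_scaleR [OF assms, of 0 0] by simp
  then show ?thesis
    by (induction I rule: infinite_finite_induct) (auto simp: differential_add [OF assms])
qed

section \<open>Smooth functions and directional derivatives\<close>

lemma smooth_functionD:
  "smooth_function M f \<Longrightarrow> c \<in> man_atlas M \<Longrightarrow> smooth_on (snd c ` fst c) (\<lambda>x. f (chart_inv c x))"
  by (simp add: smooth_function_def o_def)

lemma smooth_functionI:
  "(\<And>c. c \<in> man_atlas M \<Longrightarrow> smooth_on (snd c ` fst c) (\<lambda>x. f (chart_inv c x))) \<Longrightarrow> smooth_function M f"
  by (simp add: smooth_function_def o_def)

lemma smooth_function_const: "smooth_manifold M \<Longrightarrow> smooth_function M (\<lambda>q. r)"
  by (intro smooth_functionI smooth_on_const smooth_manifold_chart)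

lemma smooth_function_add:
  "smooth_function M f \<Longrightarrow> smooth_function M h \<Longrightarrow> smooth_function M (\<lambda>q. f q + h q)"
  by (rule smooth_functionI, rule smooth_on_add) (erule (1) smooth_functionD)+

lemma smooth_function_mult:
  "smooth_function M f \<Longrightarrow> smooth_function M h \<Longrightarrow> smooth_function M (\<lambda>q. f q * h q)"
  by (rule smooth_functionI, rule smooth_on_mult) (erule (1) smooth_functionD)+

lemma smooth_function_diff:
  assumes "smooth_manifold M" "smooth_function M f" "smooth_function M h"
  shows "smooth_function M (\<lambda>q. f q - h q)"
  using smooth_function_add [OF assms(2) smooth_function_mult [OF
      smooth_function_const [OF assms(1), of "-1"] assms(3)]]
  by simp

lemma smooth_function_sum:
  "smooth_manifold M \<Longrightarrow> (\<And>i. i \<in> I \<Longrightarrow> smooth_function M (f i)) \<Longrightarrow> smooth_function M (\<lambda>q. \<Sum>i\<in>I. f i q)"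
  by (rule smooth_functionI, rule smooth_on_sum)
    (auto intro: smooth_functionD smooth_manifold_chart(4))

lemma smooth_function_compose:
  assumes M: "smooth_manifold M" and N: "smooth_manifold N"
    and s: "smooth_map M N \<phi>" and f: "smooth_function N f"
  shows "smooth_function M (\<lambda>q. f (\<phi> q))"
proof (rule smooth_functionI, rule smooth_on_local)
  fix c assume c: "c \<in> man_atlas M"
  show "open (snd c ` fst c)" by (rule smooth_manifold_chart(4) [OF M c])
  fix x assume "x \<in> snd c ` fst c"
  then obtain p where p: "p \<in> fst c" "x = snd c p" by auto
  then have "p \<in> pts M" using smooth_manifold_chart(2) [OF M c] by auto
  then obtain d where d: "d \<in> charts_at N (\<phi> p)"
    using charts_at_exists [OF N smooth_mapD(3) [OF s]] by blast
  note d' = charts_atD [OF N d]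
  let ?U = "snd c ` {p \<in> fst c. \<phi> p \<in> fst d}"
  have "smooth_on ?U (\<lambda>x. (\<lambda>y. f (chart_inv d y)) ((snd d \<circ> \<phi> \<circ> chart_inv c) x))"
    by (rule smooth_on_compose [OF smooth_mapD(2) [OF s c d'(1)] smooth_functionD [OF f d'(1)]])
      (use chart_inv_left [OF M c] in auto)
  then have "smooth_on ?U (\<lambda>x. f (\<phi> (chart_inv c x)))"
    by (rule smooth_on_cong) (use chart_inv_left [OF M c] chart_inv_left [OF N d'(1)] in auto)
  moreover have "x \<in> ?U" using p d' by auto
  ultimately show "\<exists>U. x \<in> U \<and> smooth_on U (\<lambda>x. f (\<phi> (chart_inv c x)))" by (intro exI conjI)
qed

lemma function_has_derivative:
  assumes "smooth_function M f" "c \<in> charts_at M p"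
  shows "((\<lambda>x. f (chart_inv c x)) has_derivative fderiv (\<lambda>x. f (chart_inv c x)) (snd c p)) (at (snd c p))"
  by (rule smooth_on_has_derivative [OF smooth_functionD [OF assms(1)]])
    (use assms(2) in \<open>auto simp: charts_at_def\<close>)

lemma fderiv_function_compose:
  assumes M: "smooth_manifold M" and N: "smooth_manifold N"
    and s: "smooth_map M N \<phi>" and f: "smooth_function N f"
    and c: "c \<in> charts_at M p" and d: "d \<in> charts_at N (\<phi> p)"
  shows "fderiv (\<lambda>x. f (\<phi> (chart_inv c x))) (snd c p) v
    = fderiv (\<lambda>y. f (chart_inv d y)) (snd d (\<phi> p)) (coord_deriv \<phi> c d p v)"
proof -
  note c' = charts_atD [OF M c] and d' = charts_atD [OF N d]
  have cp: "chart_inv c (snd c p) = p" by (rule chart_inv_left [OF M c'(1,2)])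
  have "fderiv (\<lambda>x. f (\<phi> (chart_inv c x))) (snd c p)
      = fderiv (\<lambda>x. (\<lambda>y. f (chart_inv d y)) ((snd d \<circ> \<phi> \<circ> chart_inv c) x)) (snd c p)"
  proof (rule fderiv_cong_open [OF chart_preimage_image_open [OF M s N c'(1) d'(1)]])
    show "snd c p \<in> snd c ` {p \<in> fst c. \<phi> p \<in> fst d}" using c'(2) d'(2) by auto
  next
    fix x assume "x \<in> snd c ` {p \<in> fst c. \<phi> p \<in> fst d}"
    then show "f (\<phi> (chart_inv c x)) = (\<lambda>y. f (chart_inv d y)) ((snd d \<circ> \<phi> \<circ> chart_inv c) x)"
      using chart_inv_left [OF M c'(1)] chart_inv_left [OF N d'(1)] by auto
  qed
  then have "fderiv (\<lambda>x. f (\<phi> (chart_inv c x))) (snd c p) v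
      = fderiv (\<lambda>x. (\<lambda>y. f (chart_inv d y)) ((snd d \<circ> \<phi> \<circ> chart_inv c) x)) (snd c p) v"
    by (rule fun_cong)
  also have "\<dots> = fderiv (\<lambda>y. f (chart_inv d y)) (snd d (\<phi> p)) (coord_deriv \<phi> c d p v)"
    by (rule fderiv_compose [OF coord_has_derivative [OF s c d]])
      (use function_has_derivative [OF f d] in \<open>simp add: cp\<close>)
  finally show ?thesis .
qed

lemma dir_deriv_component:
  assumes M: "smooth_manifold M" and f: "smooth_function M f"
    and c: "c \<in> charts_at M p" and v: "v \<in> tangent_space M p"
  shows "dir_deriv M p v f = fderiv (\<lambda>x. f (chart_inv c x)) (snd c p) (v c)"
proof -
  let ?s = "some_chart_at M p"
  have s: "?s \<in> charts_at M p" by (rule some_chart_at [OF M charts_atD(3) [OF M c]])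
  have "dir_deriv M p v f = fderiv (\<lambda>x. f (id (chart_inv ?s x))) (snd ?s p) (v ?s)"
    by (simp add: dir_deriv_def Let_def o_def)
  also have "\<dots> = fderiv (\<lambda>x. f (chart_inv c x)) (snd c (id p)) (coord_deriv id ?s c p (v ?s))"
    by (rule fderiv_function_compose [OF M M smooth_map_id [OF M] f s]) (use c in simp)
  also have "\<dots> = fderiv (\<lambda>x. f (chart_inv c x)) (snd c p) (v c)"
    using tangent_component [OF v s c] by simp
  finally show ?thesis .
qed

lemma dir_deriv_compose:
  assumes M: "smooth_manifold M" and N: "smooth_manifold N"
    and s: "smooth_map M N \<phi>" and f: "smooth_function N f"
    and p: "p \<in> pts M" and v: "v \<in> tangent_space M p"
  shows "dir_deriv M p v (\<lambda>q. f (\<phi> q)) = dir_deriv N (\<phi> p) (differential M N \<phi> p v) f"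
proof -
  obtain c where c: "c \<in> charts_at M p" using charts_at_exists [OF M p] by blast
  obtain d where d: "d \<in> charts_at N (\<phi> p)"
    using charts_at_exists [OF N smooth_mapD(3) [OF s p]] by blast
  show ?thesis
    unfolding dir_deriv_component [OF M smooth_function_compose [OF M N s f] c v]
      dir_deriv_component [OF N f d differential_tangent [OF M N s p]]
      differential_component [OF M N s c d v]
    by (rule fderiv_function_compose [OF M N s f c d])
qed

lemma dir_deriv_cong:
  assumes M: "smooth_manifold M" and p: "p \<in> pts M"
    and eq: "\<And>q. q \<in> pts M \<Longrightarrow> f q = h q"
  shows "dir_deriv M p v f = dir_deriv M p v h"
proof -
  let ?s = "some_chart_at M p"
  have s: "?s \<in> charts_at M p" by (rule some_chart_at [OF M p])
  note s' = charts_atD [OF M s]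
  have "fderiv (f \<circ> chart_inv ?s) (snd ?s p) = fderiv (h \<circ> chart_inv ?s) (snd ?s p)"
    by (rule fderiv_cong_open [OF smooth_manifold_chart(4) [OF M s'(1)]])
      (use s' chart_inv_left [OF M s'(1)] eq smooth_manifold_chart(2) [OF M s'(1)] in auto)
  then show ?thesis by (simp add: dir_deriv_def)
qed

lemma dir_deriv_const: "smooth_manifold M \<Longrightarrow> dir_deriv M p v (\<lambda>q. r) = 0"
  by (simp add: dir_deriv_def o_def Let_def)

lemma dir_deriv_add:
  assumes M: "smooth_manifold M" and p: "p \<in> pts M"
    and f: "smooth_function M f" and h: "smooth_function M h"
  shows "dir_deriv M p v (\<lambda>q. f q + h q) = dir_deriv M p v f + dir_deriv M p v h"
  using fderiv_eqI [OF has_derivative_add [OF function_has_derivative [OF f some_chart_at [OF M p]]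
        function_has_derivative [OF h some_chart_at [OF M p]]]]
  by (simp add: dir_deriv_def Let_def o_def)

lemma dir_deriv_mult:
  assumes M: "smooth_manifold M" and p: "p \<in> pts M"
    and f: "smooth_function M f" and h: "smooth_function M h"
  shows "dir_deriv M p v (\<lambda>q. f q * h q) = dir_deriv M p v f * h p + f p * dir_deriv M p v h"
proof -
  have "chart_inv (some_chart_at M p) (snd (some_chart_at M p) p) = p"
    using charts_atD [OF M some_chart_at [OF M p]] chart_inv_left [OF M] by auto
  then show ?thesis
    using fderiv_eqI [OF has_derivative_mult [OF function_has_derivative [OF f some_chart_at [OF M p]]
          function_has_derivative [OF h some_chart_at [OF M p]]]]
    by (simp add: dir_deriv_def Let_def o_def)
qed

lemma dir_deriv_sum:
  assumes M: "smooth_manifold M" and p: "p \<in> pts M"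
    and f: "\<And>i. i \<in> I \<Longrightarrow> smooth_function M (f i)"
  shows "dir_deriv M p v (\<lambda>q. \<Sum>i\<in>I. f i q) = (\<Sum>i\<in>I. dir_deriv M p v (f i))"
  using f
proof (induction I rule: infinite_finite_induct)
  case (insert i I)
  then show ?case
    by (simp add: dir_deriv_add [OF M p] smooth_function_sum [OF M])
qed (simp_all add: dir_deriv_const [OF M])

lemma dir_deriv_linear:
  assumes M: "smooth_manifold M" and p: "p \<in> pts M" and f: "smooth_function M f"
  shows "dir_deriv M p (v + w) f = dir_deriv M p v f + dir_deriv M p w f"
    "dir_deriv M p (r *\<^sub>R v) f = r * dir_deriv M p v f"
proof -
  have l: "linear (fderiv (\<lambda>x. f (chart_inv (some_chart_at M p) x)) (snd (some_chart_at M p) p))"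
    using function_has_derivative [OF f some_chart_at [OF M p]] by (rule has_derivative_linear)
  show "dir_deriv M p (v + w) f = dir_deriv M p v f + dir_deriv M p w f"
    "dir_deriv M p (r *\<^sub>R v) f = r * dir_deriv M p v f"
    using linear_add [OF l] linear_cmul [OF l] by (simp_all add: dir_deriv_def Let_def o_def)
qed

lemma dir_deriv_vsum:
  assumes M: "smooth_manifold M" and p: "p \<in> pts M" and f: "smooth_function M f"
  shows "dir_deriv M p (\<Sum>i\<in>I. r i *\<^sub>R v i) f = (\<Sum>i\<in>I. r i * dir_deriv M p (v i) f)"
  using dir_deriv_linear(2) [OF M p f, of 0 0]
  by (induction I rule: infinite_finite_induct) (simp_all add: dir_deriv_linear [OF M p f])

section \<open>Smooth sections along maps\<close>

lemma smooth_section_tangent: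
  "smooth_section M N \<phi> W \<Longrightarrow> p \<in> pts M \<Longrightarrow> W p \<in> tangent_space N (\<phi> p)"
  by (simp add: smooth_section_def)

lemma smooth_field_tangent:
  "smooth_vector_field M X \<Longrightarrow> p \<in> pts M \<Longrightarrow> X p \<in> tangent_space M p"
  by (simp add: smooth_section_def)

lemma smooth_section_component:
  "smooth_section M N \<phi> W \<Longrightarrow> c \<in> man_atlas M \<Longrightarrow> d \<in> man_atlas N \<Longrightarrow>
    smooth_on (snd c ` {p \<in> fst c. \<phi> p \<in> fst d}) (\<lambda>x. W (chart_inv c x) d)"
  by (simp add: smooth_section_def)

lemma smooth_field_component:
  assumes "smooth_vector_field M X" "c \<in> man_atlas M"
  shows "smooth_on (snd c ` fst c) (\<lambda>x. X (chart_inv c x) c)"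
  using smooth_section_component [OF assms assms(2)] by simp

lemma smooth_sectionI:
  assumes "\<And>p. p \<in> pts M \<Longrightarrow> W p \<in> tangent_space N (\<phi> p)"
    and "\<And>c d. c \<in> man_atlas M \<Longrightarrow> d \<in> man_atlas N \<Longrightarrow>
      smooth_on (snd c ` {p \<in> fst c. \<phi> p \<in> fst d}) (\<lambda>x. W (chart_inv c x) d)"
  shows "smooth_section M N \<phi> W"
  using assms by (simp add: smooth_section_def)

lemma smooth_section_cong:
  assumes M: "smooth_manifold M" and W: "smooth_section M N \<phi> W"
    and eq: "\<And>p. p \<in> pts M \<Longrightarrow> \<phi> p = \<psi> p" "\<And>p. p \<in> pts M \<Longrightarrow> W p = V p"
  shows "smooth_section M N \<psi> V"
proof (rule smooth_sectionI)
  show "V p \<in> tangent_space N (\<psi> p)" if "p \<in> pts M" for p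
    using smooth_section_tangent [OF W that] eq [OF that] by simp
  fix c d assume c: "c \<in> man_atlas M" and d: "d \<in> man_atlas N"
  have "{p \<in> fst c. \<phi> p \<in> fst d} = {p \<in> fst c. \<psi> p \<in> fst d}"
    using eq(1) smooth_manifold_chart(2) [OF M c] by auto
  then have "smooth_on (snd c ` {p \<in> fst c. \<psi> p \<in> fst d}) (\<lambda>x. W (chart_inv c x) d)"
    using smooth_section_component [OF W c d] by simp
  then show "smooth_on (snd c ` {p \<in> fst c. \<psi> p \<in> fst d}) (\<lambda>x. V (chart_inv c x) d)"
  proof (rule smooth_on_cong)
    fix y assume "y \<in> snd c ` {p \<in> fst c. \<psi> p \<in> fst d}"
    then have "chart_inv c y \<in> pts M"
      using smooth_manifold_chart(2) [OF M c] chart_inv_left [OF M c] by auto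
    from eq(2) [OF this] show "W (chart_inv c y) d = V (chart_inv c y) d" by simp
  qed
qed

lemma smooth_section_add:
  assumes N: "smooth_manifold N" and V: "smooth_section M N \<phi> V" and W: "smooth_section M N \<phi> W"
  shows "smooth_section M N \<phi> (\<lambda>q. V q + W q)"
proof (rule smooth_sectionI)
  show "V p + W p \<in> tangent_space N (\<phi> p)" if "p \<in> pts M" for p
    by (intro tangent_add N smooth_section_tangent [OF V] smooth_section_tangent [OF W] that)
  show "smooth_on (snd c ` {p \<in> fst c. \<phi> p \<in> fst d}) (\<lambda>x. (V (chart_inv c x) + W (chart_inv c x)) d)"
    if "c \<in> man_atlas M" "d \<in> man_atlas N" for c d
    using smooth_on_add [OF smooth_section_component [OF V that] smooth_section_component [OF W that]]
    by simp
qed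

lemma smooth_section_scaleR:
  assumes M: "smooth_manifold M" and N: "smooth_manifold N"
    and f: "smooth_function M f" and W: "smooth_section M N \<phi> W"
  shows "smooth_section M N \<phi> (\<lambda>q. f q *\<^sub>R W q)"
proof (rule smooth_sectionI)
  show "f p *\<^sub>R W p \<in> tangent_space N (\<phi> p)" if "p \<in> pts M" for p
    by (intro tangent_scaleR N smooth_section_tangent [OF W] that)
  fix c d assume cd: "c \<in> man_atlas M" "d \<in> man_atlas N"
  have "smooth_on (snd c ` {p \<in> fst c. \<phi> p \<in> fst d}) (\<lambda>x. f (chart_inv c x))"
    by (rule smooth_on_subset [OF smooth_functionD [OF f cd(1)]
        smooth_on_open [OF smooth_section_component [OF W cd]]])
      auto
  from smooth_on_scaleR [OF this smooth_section_component [OF W cd]]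
  show "smooth_on (snd c ` {p \<in> fst c. \<phi> p \<in> fst d}) (\<lambda>x. (f (chart_inv c x) *\<^sub>R W (chart_inv c x)) d)"
    by simp
qed

lemma smooth_section_zero:
  assumes M: "smooth_manifold M" and N: "smooth_manifold N" and s: "smooth_map M N \<phi>"
  shows "smooth_section M N \<phi> (\<lambda>q. 0)"
  by (rule smooth_sectionI)
    (auto intro!: tangent_zero [OF N] smooth_on_const chart_preimage_image_open [OF M s N])

lemma smooth_section_sum:
  assumes M: "smooth_manifold M" and N: "smooth_manifold N" and s: "smooth_map M N \<phi>"
    and W: "\<And>i. i \<in> I \<Longrightarrow> smooth_section M N \<phi> (W i)"
  shows "smooth_section M N \<phi> (\<lambda>q. \<Sum>i\<in>I. W i q)"
  using W
proof (induction I rule: infinite_finite_induct)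
  case (insert i I)
  then have "smooth_section M N \<phi> (\<lambda>q. W i q + (\<Sum>j\<in>I. W j q))"
    by (intro smooth_section_add [OF N]) simp_all
  then show ?case unfolding sum.insert [OF insert(1,2)] .
qed (simp_all add: smooth_section_zero [OF M N s])

lemma smooth_section_compose:
  assumes L: "smooth_manifold L" and M: "smooth_manifold M" and N: "smooth_manifold N"
    and s: "smooth_map L M \<theta>" and f: "smooth_map M N \<phi>" and W: "smooth_section M N \<phi> W"
  shows "smooth_section L N (\<lambda>q. \<phi> (\<theta> q)) (\<lambda>q. W (\<theta> q))"
proof (rule smooth_sectionI)
  show "W (\<theta> p) \<in> tangent_space N (\<phi> (\<theta> p))" if "p \<in> pts L" for p
    by (rule smooth_section_tangent [OF W smooth_mapD(3) [OF s that]])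
  fix c e assume c: "c \<in> man_atlas L" and e: "e \<in> man_atlas N"
  have gf: "smooth_map L N (\<phi> \<circ> \<theta>)" by (rule smooth_map_compose [OF L M N s f])
  show "smooth_on (snd c ` {p \<in> fst c. \<phi> (\<theta> p) \<in> fst e}) (\<lambda>x. W (\<theta> (chart_inv c x)) e)"
  proof (rule smooth_on_local)
    show "open (snd c ` {p \<in> fst c. \<phi> (\<theta> p) \<in> fst e})"
      using chart_preimage_image_open [OF L gf N c e] by simp
    fix x assume "x \<in> snd c ` {p \<in> fst c. \<phi> (\<theta> p) \<in> fst e}"
    then obtain p where p: "p \<in> fst c" "\<phi> (\<theta> p) \<in> fst e" "x = snd c p" by auto
    have pL: "p \<in> pts L" using p(1) smooth_manifold_chart(2) [OF L c] by auto
    obtain d where d: "d \<in> charts_at M (\<theta> p)"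
      using charts_at_exists [OF M smooth_mapD(3) [OF s pL]] by blast
    note d' = charts_atD [OF M d]
    let ?U = "snd c ` (fst c \<inter> ({p \<in> pts L. \<theta> p \<in> fst d}
                \<inter> {p \<in> pts L. (\<phi> \<circ> \<theta>) p \<in> fst e}))"
    have U: "open ?U"
      by (intro chart_image_open [OF L c] openin_Int smooth_map_preimage_open [OF L s M d'(1)]
          smooth_map_preimage_open [OF L gf N e])
    have "smooth_on ?U (\<lambda>x. (\<lambda>y. W (chart_inv d y) e) ((snd d \<circ> \<theta> \<circ> chart_inv c) x))"
    proof (rule smooth_on_compose [OF _ smooth_section_component [OF W d'(1) e]])
      show "smooth_on ?U (snd d \<circ> \<theta> \<circ> chart_inv c)"
        by (rule smooth_on_subset [OF smooth_mapD(2) [OF s c d'(1)] U]) auto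
      show "(snd d \<circ> \<theta> \<circ> chart_inv c) ` ?U \<subseteq> snd d ` {p \<in> fst d. \<phi> p \<in> fst e}"
        using chart_inv_left [OF L c] by auto
    qed
    then have "smooth_on ?U (\<lambda>x. W (\<theta> (chart_inv c x)) e)"
      by (rule smooth_on_cong) (use chart_inv_left [OF L c] chart_inv_left [OF M d'(1)] in auto)
    moreover have "x \<in> ?U" using p pL d' by auto
    ultimately show "\<exists>U. x \<in> U \<and> smooth_on U (\<lambda>x. W (\<theta> (chart_inv c x)) e)" by (intro exI conjI)
  qed
qed

lemma smooth_section_differential:
  assumes M: "smooth_manifold M" and N: "smooth_manifold N"
    and s: "smooth_map M N \<phi>" and X: "smooth_vector_field M X"
  shows "smooth_section M N \<phi> (\<lambda>q. differential M N \<phi> q (X q))"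
proof (rule smooth_sectionI)
  show "differential M N \<phi> p (X p) \<in> tangent_space N (\<phi> p)" if "p \<in> pts M" for p
    by (rule differential_tangent [OF M N s that])
  fix c d assume c: "c \<in> man_atlas M" and d: "d \<in> man_atlas N"
  let ?U = "snd c ` {p \<in> fst c. \<phi> p \<in> fst d}"
  note F = smooth_mapD(2) [OF s c d]
  have "smooth_on ?U (\<lambda>x. fderiv (snd d \<circ> \<phi> \<circ> chart_inv c) x (X (chart_inv c x) c))"
    by (rule smooth_on_fderiv [OF F], rule smooth_on_subset [OF smooth_field_component [OF X c]
        smooth_on_open [OF F]])
      auto
  then show "smooth_on ?U (\<lambda>x. differential M N \<phi> (chart_inv c x) (X (chart_inv c x)) d)"
  proof (rule smooth_on_cong)
    fix x assume "x \<in> ?U"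
    then obtain p where p: "p \<in> fst c" "\<phi> p \<in> fst d" "x = snd c p" by auto
    then have cp: "c \<in> charts_at M p" "d \<in> charts_at N (\<phi> p)" using c d by (auto simp: charts_at_def)
    show "fderiv (snd d \<circ> \<phi> \<circ> chart_inv c) x (X (chart_inv c x) c)
        = differential M N \<phi> (chart_inv c x) (X (chart_inv c x)) d"
      using differential_component [OF M N s cp smooth_field_tangent [OF X charts_atD(3) [OF M cp(1)]]]
        chart_inv_left [OF M c p(1)] p(3) by simp
  qed
qed

lemma smooth_function_dir_deriv:
  assumes M: "smooth_manifold M" and X: "smooth_vector_field M X" and f: "smooth_function M f"
  shows "smooth_function M (\<lambda>q. dir_deriv M q (X q) f)"
proof (rule smooth_functionI)
  fix c assume c: "c \<in> man_atlas M"
  have "smooth_on (snd c ` fst c) (\<lambda>x. fderiv (\<lambda>x. f (chart_inv c x)) x (X (chart_inv c x) c))"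
    by (rule smooth_on_fderiv [OF smooth_functionD [OF f c] smooth_field_component [OF X c]])
  then show "smooth_on (snd c ` fst c) (\<lambda>x. dir_deriv M (chart_inv c x) (X (chart_inv c x)) f)"
  proof (rule smooth_on_cong)
    fix x assume "x \<in> snd c ` fst c"
    then obtain p where p: "p \<in> fst c" "x = snd c p" by auto
    then have cp: "c \<in> charts_at M p" using c by (auto simp: charts_at_def)
    show "fderiv (\<lambda>x. f (chart_inv c x)) x (X (chart_inv c x) c)
        = dir_deriv M (chart_inv c x) (X (chart_inv c x)) f"
      using dir_deriv_component [OF M f cp smooth_field_tangent [OF X charts_atD(3) [OF M cp]]]
        chart_inv_left [OF M c p(1)] p(2) by simp
  qed
qed

section \<open>The bracket of vector fields\<close>

text \<open>Product rule for the derivative of \<open>F\<close> in the direction of a vector field \<open>X\<close>.\<close>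

lemma fderiv_fderiv_field:
  fixes F :: "'e::euclidean_space \<Rightarrow> 'f::euclidean_space"
  assumes F: "smooth_on U F" and X: "smooth_on U X" and x: "x \<in> U"
  shows "fderiv (\<lambda>y. fderiv F y (X y)) x v = fderiv (\<lambda>y. fderiv F y (X x)) x v + fderiv F x (fderiv X x v)"
proof -
  have op: "open U" by (rule smooth_on_open [OF F])
  have expand: "fderiv F y w = (\<Sum>b\<in>Basis. (w \<bullet> b) *\<^sub>R fderiv F y b)" if "y \<in> U" for y w
    by (rule linear_basis_expansion [OF smooth_on_linear_fderiv [OF F that]])
  have D: "((\<lambda>y. fderiv F y b) has_derivative fderiv (\<lambda>y. fderiv F y b) x) (at x)" for b
    by (rule smooth_on_has_derivative [OF smooth_on_fderiv_const [OF F] x])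
  have DX: "((\<lambda>y. X y \<bullet> b) has_derivative (\<lambda>v. fderiv X x v \<bullet> b)) (at x)" for b
    by (rule bounded_linear.has_derivative [OF bounded_linear_inner_left smooth_on_has_derivative [OF X x]])
  have "((\<lambda>y. \<Sum>b\<in>Basis. (X y \<bullet> b) *\<^sub>R fderiv F y b) has_derivative
      (\<lambda>v. \<Sum>b\<in>Basis. (X x \<bullet> b) *\<^sub>R fderiv (\<lambda>y. fderiv F y b) x v
          + (fderiv X x v \<bullet> b) *\<^sub>R fderiv F x b)) (at x)"
    by (intro has_derivative_sum has_derivative_scaleR D DX)
  then have 1: "fderiv (\<lambda>y. \<Sum>b\<in>Basis. (X y \<bullet> b) *\<^sub>R fderiv F y b) x v
      = (\<Sum>b\<in>Basis. (X x \<bullet> b) *\<^sub>R fderiv (\<lambda>y. fderiv F y b) x v + (fderiv X x v \<bullet> b) *\<^sub>R fderiv F x b)"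
    by (simp only: fderiv_eqI)
  have "((\<lambda>y. \<Sum>b\<in>Basis. (X x \<bullet> b) *\<^sub>R fderiv F y b) has_derivative
      (\<lambda>v. \<Sum>b\<in>Basis. (X x \<bullet> b) *\<^sub>R fderiv (\<lambda>y. fderiv F y b) x v)) (at x)"
    by (intro has_derivative_sum has_derivative_scaleR_right D)
  then have 2: "fderiv (\<lambda>y. \<Sum>b\<in>Basis. (X x \<bullet> b) *\<^sub>R fderiv F y b) x v
      = (\<Sum>b\<in>Basis. (X x \<bullet> b) *\<^sub>R fderiv (\<lambda>y. fderiv F y b) x v)"
    by (simp only: fderiv_eqI)
  have "fderiv (\<lambda>y. fderiv F y (X y)) x = fderiv (\<lambda>y. \<Sum>b\<in>Basis. (X y \<bullet> b) *\<^sub>R fderiv F y b) x"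
    by (rule fderiv_cong_open [OF op x]) (rule expand)
  moreover have "fderiv (\<lambda>y. fderiv F y (X x)) x = fderiv (\<lambda>y. \<Sum>b\<in>Basis. (X x \<bullet> b) *\<^sub>R fderiv F y b) x"
    by (rule fderiv_cong_open [OF op x]) (rule expand)
  moreover have "fderiv F x (fderiv X x v) = (\<Sum>b\<in>Basis. (fderiv X x v \<bullet> b) *\<^sub>R fderiv F x b)"
    by (rule expand [OF x])
  ultimately show ?thesis using 1 2 by (simp add: sum.distrib)
qed

text \<open>If \<open>X\<close>, \<open>Y\<close> are \<open>F\<close>-related to \<open>X'\<close>, \<open>Y'\<close>, then so are their brackets: the second derivatives of \<open>F\<close>
    cancel
  by symmetry.\<close>

lemma bracket_of_related:
  fixes F :: "'e::euclidean_space \<Rightarrow> 'f::euclidean_space"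
  assumes F: "smooth_on U F" and X: "smooth_on U X" and Y: "smooth_on U Y"
    and X': "smooth_on V X'" and Y': "smooth_on V Y'" and FU: "F ` U \<subseteq> V"
    and rX: "\<And>y. y \<in> U \<Longrightarrow> X' (F y) = fderiv F y (X y)"
    and rY: "\<And>y. y \<in> U \<Longrightarrow> Y' (F y) = fderiv F y (Y y)" and x: "x \<in> U"
  shows "fderiv Y' (F x) (X' (F x)) - fderiv X' (F x) (Y' (F x))
    = fderiv F x (fderiv Y x (X x) - fderiv X x (Y x))"
proof -
  have op: "open U" by (rule smooth_on_open [OF F])
  have half: "fderiv Z' (F x) (fderiv F x v) = fderiv (\<lambda>y. fderiv F y (Z x)) x v
      + fderiv F x (fderiv Z x v)"
    if Z: "smooth_on U Z" and Z': "smooth_on V Z'" and rZ: "\<And>y. y \<in> U \<Longrightarrow> Z' (F y) = fderiv F y (Z y)"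
    for Z Z' v
  proof -
    have "fderiv Z' (F x) (fderiv F x v) = fderiv (\<lambda>y. Z' (F y)) x v"
      by (rule fderiv_compose [symmetric, OF smooth_on_has_derivative [OF F x]
          smooth_on_has_derivative [OF Z']])
        (use FU x in auto)
    also have "\<dots> = fderiv (\<lambda>y. fderiv F y (Z y)) x v"
      by (rule fun_cong [OF fderiv_cong_open [OF op x]]) (rule rZ)
    also have "\<dots> = fderiv (\<lambda>y. fderiv F y (Z x)) x v + fderiv F x (fderiv Z x v)"
      by (rule fderiv_fderiv_field [OF F Z x])
    finally show ?thesis .
  qed
  have "fderiv (\<lambda>y. fderiv F y (Y x)) x (X x) = fderiv (\<lambda>y. fderiv F y (X x)) x (Y x)"
    by (rule fderiv_fderiv_commute [OF F x])
  then show ?thesis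
    using half [OF Y Y' rY, of "X x"] half [OF X X' rX, of "Y x"]
    by (simp add: rX [OF x] rY [OF x] linear_diff [OF smooth_on_linear_fderiv [OF F x]])
qed

lemma field_bracket_component:
  assumes "c \<in> charts_at M p"
  shows "field_bracket M X Y p c = fderiv (\<lambda>x. Y (chart_inv c x) c) (snd c p) (X p c)
             - fderiv (\<lambda>x. X (chart_inv c x) c) (snd c p) (Y p c)"
  using assms by (simp add: field_bracket_def)

lemma field_bracket_related_component:
  assumes M: "smooth_manifold M" and N: "smooth_manifold N" and s: "smooth_map M N \<phi>"
    and X: "smooth_vector_field M X" and Y: "smooth_vector_field M Y"
    and X': "smooth_vector_field N X'" and Y': "smooth_vector_field N Y'"
    and rX: "\<And>q. q \<in> pts M \<Longrightarrow> X' (\<phi> q) = differential M N \<phi> q (X q)"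
    and rY: "\<And>q. q \<in> pts M \<Longrightarrow> Y' (\<phi> q) = differential M N \<phi> q (Y q)"
    and c: "c \<in> charts_at M p" and d: "d \<in> charts_at N (\<phi> p)"
  shows "field_bracket N X' Y' (\<phi> p) d = coord_deriv \<phi> c d p (field_bracket M X Y p c)"
proof -
  note c' = charts_atD [OF M c] and d' = charts_atD [OF N d]
  let ?F = "snd d \<circ> \<phi> \<circ> chart_inv c"
  let ?U = "snd c ` {p \<in> fst c. \<phi> p \<in> fst d}"
  have F: "smooth_on ?U ?F" by (rule smooth_mapD(2) [OF s c'(1) d'(1)])
  have sub: "smooth_on ?U (\<lambda>x. Z (chart_inv c x) c)" if Z: "smooth_vector_field M Z" for Z
    by (rule smooth_on_subset [OF smooth_field_component [OF Z c'(1)] smooth_on_open [OF F]]) auto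
  have FU: "?F ` ?U \<subseteq> snd d ` fst d" using chart_inv_left [OF M c'(1)] by auto
  have rel: "Z' (chart_inv d (?F y)) d = fderiv ?F y (Z (chart_inv c y) c)"
    if Z: "smooth_vector_field M Z"
      and rZ: "\<And>q. q \<in> pts M \<Longrightarrow> Z' (\<phi> q) = differential M N \<phi> q (Z q)"
      and y: "y \<in> ?U" for Z Z' y
  proof -
    obtain q where q: "q \<in> fst c" "\<phi> q \<in> fst d" "y = snd c q" using y by auto
    have cq: "c \<in> charts_at M q" "d \<in> charts_at N (\<phi> q)" using q c' d' by (auto simp: charts_at_def)
    note qM = charts_atD(3) [OF M cq(1)]
    have "chart_inv c y = q" "chart_inv d (?F y) = \<phi> q"
      using q chart_inv_left [OF M c'(1)] chart_inv_left [OF N d'(1)] by auto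
    then show ?thesis
      using rZ [OF qM] differential_component [OF M N s cq smooth_field_tangent [OF Z qM]] q(3) by simp
  qed
  have x: "snd c p \<in> ?U" using c' d' by auto
  have Fp: "?F (snd c p) = snd d (\<phi> p)" "chart_inv c (snd c p) = p" "chart_inv d (snd d (\<phi> p)) = \<phi> p"
    using chart_inv_left [OF M c'(1,2)] chart_inv_left [OF N d'(1,2)] by auto
  have "fderiv (\<lambda>y. Y' (chart_inv d y) d) (?F (snd c p)) (X' (chart_inv d (?F (snd c p))) d)
      - fderiv (\<lambda>y. X' (chart_inv d y) d) (?F (snd c p)) (Y' (chart_inv d (?F (snd c p))) d)
    = fderiv ?F (snd c p) (fderiv (\<lambda>y. Y (chart_inv c y) c) (snd c p) (X (chart_inv c (snd c p)) c)
      - fderiv (\<lambda>y. X (chart_inv c y) c) (snd c p) (Y (chart_inv c (snd c p)) c))"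
    by (rule bracket_of_related [OF F sub [OF X] sub [OF Y] smooth_field_component [OF X' d'(1)]
          smooth_field_component [OF Y' d'(1)] FU rel [OF X rX] rel [OF Y rY] x])
  then show ?thesis
    unfolding field_bracket_component [OF c] field_bracket_component [OF d] by (simp only: Fp)
qed

text \<open>The identity relates every field to itself; hence the bracket, which is defined chart by chart,
  obeys the transformation rule of tangent vectors.\<close>

lemma field_bracket_tangent:
  assumes M: "smooth_manifold M" and X: "smooth_vector_field M X" and Y: "smooth_vector_field M Y"
  shows "field_bracket M X Y p \<in> tangent_space M p"
proof (rule tangent_spaceI)
  fix c d assume cd: "c \<in> charts_at M p" "d \<in> charts_at M p"
  have r: "Z (id q) = differential M M id q (Z q)"
    if "smooth_vector_field M Z" "q \<in> pts M" for Z q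
    using differential_id [OF M that(2) smooth_field_tangent [OF that]] by simp
  show "field_bracket M X Y p d = coord_deriv id c d p (field_bracket M X Y p c)"
    by (rule field_bracket_related_component [OF M M smooth_map_id [OF M] X Y X Y r [OF X] r [OF Y]
        cd(1), of d,
          unfolded id_apply [of p]]) (use cd(2) in simp_all)
qed (simp add: field_bracket_def)

lemma smooth_field_bracket:
  assumes M: "smooth_manifold M" and X: "smooth_vector_field M X" and Y: "smooth_vector_field M Y"
  shows "smooth_vector_field M (field_bracket M X Y)"
proof (rule smooth_sectionI)
  show "field_bracket M X Y p \<in> tangent_space M (id p)" if "p \<in> pts M" for p
    using field_bracket_tangent [OF M X Y] by simp
  fix c d assume c: "c \<in> man_atlas M" and d: "d \<in> man_atlas M"
  let ?U = "snd d ` fst d"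
  let ?V = "snd c ` {p \<in> fst c. id p \<in> fst d}"
  have "smooth_on ?U (\<lambda>x. fderiv (\<lambda>x. Y (chart_inv d x) d) x (X (chart_inv d x) d)
      + (-1) *\<^sub>R fderiv (\<lambda>x. X (chart_inv d x) d) x (Y (chart_inv d x) d))"
    by (intro smooth_on_add smooth_on_bounded_linear [OF bounded_linear_scaleR_right] smooth_on_fderiv
        smooth_field_component [OF X d] smooth_field_component [OF Y d])
  note Z = this
  have F: "smooth_on ?V (snd d \<circ> id \<circ> chart_inv c)" by (rule smooth_mapD(2) [OF smooth_map_id [OF M] c d])
  have "smooth_on ?V (\<lambda>x. (\<lambda>x. fderiv (\<lambda>x. Y (chart_inv d x) d) x (X (chart_inv d x) d)
      + (-1) *\<^sub>R fderiv (\<lambda>x. X (chart_inv d x) d) x (Y (chart_inv d x) d)) ((snd d \<circ> id \<circ> chart_inv c) x))"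
    by (rule smooth_on_compose [OF F Z]) (use chart_inv_left [OF M c] in auto)
  then show "smooth_on ?V (\<lambda>x. field_bracket M X Y (chart_inv c x) d)"
  proof (rule smooth_on_cong)
    fix x assume "x \<in> ?V"
    then obtain p where p: "p \<in> fst c" "p \<in> fst d" "x = snd c p" by auto
    have dp: "d \<in> charts_at M p" using p d by (simp add: charts_at_def)
    have e: "chart_inv c x = p" "chart_inv d (snd d p) = p"
      using p chart_inv_left [OF M c p(1)] chart_inv_left [OF M d p(2)] by auto
    show "(\<lambda>x. fderiv (\<lambda>x. Y (chart_inv d x) d) x (X (chart_inv d x) d)
        + (-1) *\<^sub>R fderiv (\<lambda>x. X (chart_inv d x) d) x (Y (chart_inv d x) d)) ((snd d \<circ> id \<circ> chart_inv c) x)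
      = field_bracket M X Y (chart_inv c x) d"
      by (simp add: field_bracket_component [OF dp] e)
  qed
qed

lemma field_bracket_related:
  assumes M: "smooth_manifold M" and N: "smooth_manifold N" and s: "smooth_map M N \<phi>"
    and X: "smooth_vector_field M X" and Y: "smooth_vector_field M Y"
    and X': "smooth_vector_field N X'" and Y': "smooth_vector_field N Y'"
    and rX: "\<And>q. q \<in> pts M \<Longrightarrow> X' (\<phi> q) = differential M N \<phi> q (X q)"
    and rY: "\<And>q. q \<in> pts M \<Longrightarrow> Y' (\<phi> q) = differential M N \<phi> q (Y q)"
    and p: "p \<in> pts M"
  shows "field_bracket N X' Y' (\<phi> p) = differential M N \<phi> p (field_bracket M X Y p)"
proof -
  obtain c where c: "c \<in> charts_at M p" using charts_at_exists [OF M p] by blast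
  obtain d where d: "d \<in> charts_at N (\<phi> p)"
    using charts_at_exists [OF N smooth_mapD(3) [OF s p]] by blast
  show ?thesis
  proof (rule tangent_eqI [OF field_bracket_tangent [OF N X' Y'] differential_tangent [OF M N s p] d])
    show "field_bracket N X' Y' (\<phi> p) d = differential M N \<phi> p (field_bracket M X Y p) d"
      unfolding differential_component [OF M N s c d field_bracket_tangent [OF M X Y]]
      by (rule field_bracket_related_component [OF M N s X Y X' Y' rX rY c d])
  qed
qed

lemma field_bracket_skew: "field_bracket M Y X p = - field_bracket M X Y p"
  by (auto simp: field_bracket_def fun_eq_iff)

lemma field_has_derivative:
  assumes "smooth_vector_field M X" "c \<in> charts_at M p"
  shows "((\<lambda>x. X (chart_inv c x) c) has_derivative fderiv (\<lambda>x. X (chart_inv c x) c) (snd c p)) (at (snd c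
      p))"
  by (rule smooth_on_has_derivative [OF smooth_field_component [OF assms(1)]])
    (use assms(2) in \<open>auto simp: charts_at_def\<close>)

lemma field_bracket_add_right:
  assumes M: "smooth_manifold M" and X: "smooth_vector_field M X"
    and Y: "smooth_vector_field M Y" and Z: "smooth_vector_field M Z" and p: "p \<in> pts M"
  shows "field_bracket M X (\<lambda>q. Y q + Z q) p = field_bracket M X Y p + field_bracket M X Z p"
proof
  fix c
  show "field_bracket M X (\<lambda>q. Y q + Z q) p c = (field_bracket M X Y p + field_bracket M X Z p) c"
  proof (cases "c \<in> charts_at M p")
    case c: True
    have l: "linear (fderiv (\<lambda>x. X (chart_inv c x) c) (snd c p))"
      using field_has_derivative [OF X c] by (rule has_derivative_linear)
    show ?thesis
      using fderiv_eqI [OF has_derivative_add [OF field_has_derivative [OF Y c]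
          field_has_derivative [OF Z c]]]
      by (simp add: field_bracket_component [OF c] linear_add [OF l])
  qed (simp add: field_bracket_def)
qed

lemma field_bracket_scaleR_right:
  assumes M: "smooth_manifold M" and X: "smooth_vector_field M X"
    and Y: "smooth_vector_field M Y" and f: "smooth_function M f" and p: "p \<in> pts M"
  shows "field_bracket M X (\<lambda>q. f q *\<^sub>R Y q) p = dir_deriv M p (X p) f *\<^sub>R Y p
      + f p *\<^sub>R field_bracket M X Y p"
proof
  fix c
  show "field_bracket M X (\<lambda>q. f q *\<^sub>R Y q) p c
    = (dir_deriv M p (X p) f *\<^sub>R Y p + f p *\<^sub>R field_bracket M X Y p) c"
  proof (cases "c \<in> charts_at M p")
    case c: True
    have l: "linear (fderiv (\<lambda>x. X (chart_inv c x) c) (snd c p))"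
      using field_has_derivative [OF X c] by (rule has_derivative_linear)
    have cp: "chart_inv c (snd c p) = p" using charts_atD [OF M c] chart_inv_left [OF M] by auto
    show ?thesis
      using fderiv_eqI [OF has_derivative_scaleR [OF function_has_derivative [OF f c]
          field_has_derivative [OF Y c]]]
      by (simp add: field_bracket_component [OF c] linear_cmul [OF l] cp
          dir_deriv_component [OF M f c smooth_field_tangent [OF X p]] scaleR_diff_right)
  next
    case False
    then show ?thesis
      using tangent_outside [OF smooth_field_tangent [OF Y p]] by (simp add: field_bracket_def)
  qed
qed

lemma field_bracket_cong:
  assumes M: "smooth_manifold M" and p: "p \<in> pts M"
    and X: "\<And>q. q \<in> pts M \<Longrightarrow> X q = X' q"
    and Y: "\<And>q. q \<in> pts M \<Longrightarrow> Y q = Y' q"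
  shows "field_bracket M X Y p = field_bracket M X' Y' p"
proof
  fix c
  show "field_bracket M X Y p c = field_bracket M X' Y' p c"
  proof (cases "c \<in> charts_at M p")
    case c: True
    note c' = charts_atD [OF M c]
    have "fderiv (\<lambda>x. Z (chart_inv c x) c) (snd c p) = fderiv (\<lambda>x. Z' (chart_inv c x) c) (snd c p)"
      if "\<And>q. q \<in> pts M \<Longrightarrow> Z q = Z' q" for Z Z'
      by (rule fderiv_cong_open [OF smooth_manifold_chart(4) [OF M c'(1)]])
        (use c' chart_inv_left [OF M c'(1)] that smooth_manifold_chart(2) [OF M c'(1)] in auto)
    from this [of X X', OF X] this [of Y Y', OF Y] show ?thesis
      by (simp add: field_bracket_component [OF c] X [OF p] Y [OF p])
  qed (simp add: field_bracket_def)
qed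

section \<open>Riemannian metrics\<close>

lemma riemannian_metricD:
  assumes "riemannian_metric M g" "p \<in> pts M"
  shows "u \<in> tangent_space M p \<Longrightarrow> v \<in> tangent_space M p \<Longrightarrow> g p u v = g p v u"
    "u \<in> tangent_space M p \<Longrightarrow> v \<in> tangent_space M p \<Longrightarrow> w \<in> tangent_space M p \<Longrightarrow>
      g p (u + v) w = g p u w + g p v w"
    "u \<in> tangent_space M p \<Longrightarrow> v \<in> tangent_space M p \<Longrightarrow> g p (r *\<^sub>R u) v = r * g p u v"
    "u \<in> tangent_space M p \<Longrightarrow> u \<noteq> 0 \<Longrightarrow> 0 < g p u u"
  using assms unfolding riemannian_metric_def by blast+

lemma riemannian_metric_smooth:
  assumes "riemannian_metric M g" "c \<in> man_atlas M"
  shows "smooth_on (snd c ` fst c) (\<lambda>x. g (chart_inv c x) (coord_vector M c (chart_inv c x) u)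
                                 (coord_vector M c (chart_inv c x) v))"
proof -
  have "\<forall>c\<in>man_atlas M. \<forall>u v. smooth_on (snd c ` fst c) (\<lambda>x. g (chart_inv c x)
      (coord_vector M c (chart_inv c x) u) (coord_vector M c (chart_inv c x) v))"
    using assms(1) unfolding riemannian_metric_def by (rule conjunct2)
  from bspec [OF this assms(2)] show ?thesis by (elim allE)
qed

lemma metric_sum_left:
  assumes M: "smooth_manifold M" and g: "riemannian_metric M g" and p: "p \<in> pts M"
    and w: "w \<in> tangent_space M p" and u: "\<And>i. i \<in> I \<Longrightarrow> u i \<in> tangent_space M p"
  shows "g p (\<Sum>i\<in>I. r i *\<^sub>R u i) w = (\<Sum>i\<in>I. r i * g p (u i) w)"
proof -
  note rm = riemannian_metricD [OF g p]
  have 0: "g p 0 w = 0" using rm(3) [OF tangent_zero [OF M] w, of 0] by simp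
  show ?thesis using u
  proof (induction I rule: infinite_finite_induct)
    case (insert i I)
    have u: "u i \<in> tangent_space M p" "(\<Sum>i\<in>I. r i *\<^sub>R u i) \<in> tangent_space M p"
      using insert(4) by (auto intro!: tangent_sum tangent_scaleR M)
    have "g p (r i *\<^sub>R u i + (\<Sum>i\<in>I. r i *\<^sub>R u i)) w = r i * g p (u i) w + (\<Sum>i\<in>I. r i * g p (u i) w)"
      unfolding rm(2) [OF tangent_scaleR [OF M u(1)] u(2) w] rm(3) [OF u(1) w]
      by (rule arg_cong [OF insert.IH]) (use insert.prems in blast)
    then show ?case unfolding sum.insert [OF insert(1,2)] .
  qed (simp_all add: 0)
qed

lemma metric_sum_right:
  assumes M: "smooth_manifold M" and g: "riemannian_metric M g" and p: "p \<in> pts M"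
    and w: "w \<in> tangent_space M p" and u: "\<And>i. i \<in> I \<Longrightarrow> u i \<in> tangent_space M p"
  shows "g p w (\<Sum>i\<in>I. r i *\<^sub>R u i) = (\<Sum>i\<in>I. r i * g p w (u i))"
proof -
  have "g p w (\<Sum>i\<in>I. r i *\<^sub>R u i) = g p (\<Sum>i\<in>I. r i *\<^sub>R u i) w"
    by (intro riemannian_metricD(1) [OF g p] w tangent_sum [OF M] tangent_scaleR [OF M] u)
  also have "\<dots> = (\<Sum>i\<in>I. r i * g p (u i) w)"
    by (rule metric_sum_left [OF M g p w]) (rule u)
  also have "\<dots> = (\<Sum>i\<in>I. r i * g p w (u i))"
    by (intro sum.cong refl arg_cong [of _ _ "(*) _"] riemannian_metricD(1) [OF g p] w u)
  finally show ?thesis .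
qed

lemma smooth_function_metric:
  assumes M: "smooth_manifold M" and N: "smooth_manifold N" and h: "riemannian_metric N h"
    and s: "smooth_map M N \<phi>" and V: "smooth_section M N \<phi> V" and W: "smooth_section M N \<phi> W"
  shows "smooth_function M (\<lambda>q. h (\<phi> q) (V q) (W q))"
proof (rule smooth_functionI, rule smooth_on_local)
  fix c assume c: "c \<in> man_atlas M"
  show "open (snd c ` fst c)" by (rule smooth_manifold_chart(4) [OF M c])
  fix x assume "x \<in> snd c ` fst c"
  then obtain p where p: "p \<in> fst c" "x = snd c p" by auto
  then have "p \<in> pts M" using smooth_manifold_chart(2) [OF M c] by auto
  then obtain d where d: "d \<in> charts_at N (\<phi> p)"
    using charts_at_exists [OF N smooth_mapD(3) [OF s]] by blast
  note d' = charts_atD [OF N d]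
  let ?U = "snd c ` {p \<in> fst c. \<phi> p \<in> fst d}"
  define H where "H b b' y = h (chart_inv d y) (coord_vector N d (chart_inv d y) b)
      (coord_vector N d (chart_inv d y) b')" for b b' y
  have "smooth_on ?U (\<lambda>x. H b b' ((snd d \<circ> \<phi> \<circ> chart_inv c) x))" for b b'
    unfolding H_def
    by (rule smooth_on_compose [OF smooth_mapD(2) [OF s c d'(1)]
        riemannian_metric_smooth [OF h d'(1), of b b']])
      (use chart_inv_left [OF M c] in auto)
  then have "smooth_on ?U (\<lambda>x. \<Sum>b\<in>Basis. (V (chart_inv c x) d \<bullet> b) *
      (\<Sum>b'\<in>Basis. (W (chart_inv c x) d \<bullet> b') * H b b' ((snd d \<circ> \<phi> \<circ> chart_inv c) x)))"
    by (intro smooth_on_sum smooth_on_mult smooth_on_inner_left smooth_section_component [OF V c d'(1)]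
        smooth_section_component [OF W c d'(1)] chart_preimage_image_open [OF M s N c d'(1)])
  then have "smooth_on ?U (\<lambda>x. h (\<phi> (chart_inv c x)) (V (chart_inv c x)) (W (chart_inv c x)))"
  proof (rule smooth_on_cong)
    fix x assume "x \<in> ?U"
    then obtain q where q: "q \<in> fst c" "\<phi> q \<in> fst d" "x = snd c q" by auto
    have cq: "chart_inv c x = q" and dq: "chart_inv d (snd d (\<phi> q)) = \<phi> q"
      using q chart_inv_left [OF M c] chart_inv_left [OF N d'(1)] by auto
    have qM: "q \<in> pts M" using q smooth_manifold_chart(2) [OF M c] by auto
    have dc: "d \<in> charts_at N (\<phi> q)" using q d' by (simp add: charts_at_def)
    note fq = smooth_mapD(3) [OF s qM] and T = coord_vector_tangent(1) [OF N dc]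
    note Vq = smooth_section_tangent [OF V qM] and Wq = smooth_section_tangent [OF W qM]
    have "h (\<phi> q) (V q) (W q) = h (\<phi> q) (\<Sum>b\<in>Basis. (V q d \<bullet> b) *\<^sub>R coord_vector N d (\<phi> q) b) (W q)"
      using tangent_coord_expansion [OF N dc Vq] by simp
    also have "\<dots> = (\<Sum>b\<in>Basis. (V q d \<bullet> b) * h (\<phi> q) (coord_vector N d (\<phi> q) b) (W q))"
      by (rule metric_sum_left [OF N h fq Wq T])
    also have "\<dots> = (\<Sum>b\<in>Basis. (V q d \<bullet> b) * (\<Sum>b'\<in>Basis. (W q d \<bullet> b') * H b b' (snd d (\<phi> q))))"
    proof (rule sum.cong [OF refl])
      fix b :: 'd
      have "h (\<phi> q) (coord_vector N d (\<phi> q) b) (W q)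
          = h (\<phi> q) (coord_vector N d (\<phi> q) b) (\<Sum>b'\<in>Basis. (W q d \<bullet> b') *\<^sub>R coord_vector N d (\<phi> q) b')"
        using tangent_coord_expansion [OF N dc Wq] by simp
      also have "\<dots> = (\<Sum>b'\<in>Basis. (W q d \<bullet> b') * H b b' (snd d (\<phi> q)))"
        unfolding H_def dq by (rule metric_sum_right [OF N h fq T T])
      finally show "(V q d \<bullet> b) * h (\<phi> q) (coord_vector N d (\<phi> q) b) (W q)
          = (V q d \<bullet> b) * (\<Sum>b'\<in>Basis. (W q d \<bullet> b') * H b b' (snd d (\<phi> q)))" by simp
    qed
    finally show "(\<Sum>b\<in>Basis. (V (chart_inv c x) d \<bullet> b) *
      (\<Sum>b'\<in>Basis. (W (chart_inv c x) d \<bullet> b') * H b b' ((snd d \<circ> \<phi> \<circ> chart_inv c) x)))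
      = h (\<phi> (chart_inv c x)) (V (chart_inv c x)) (W (chart_inv c x))"
      by (simp add: cq)
  qed
  moreover have "x \<in> ?U" using p d' by auto
  ultimately show "\<exists>U. x \<in> U \<and> smooth_on U (\<lambda>x. h (\<phi> (chart_inv c x)) (V (chart_inv c x)) (W (chart_inv c
      x)))"
    by (intro exI conjI)
qed

section \<open>Orthonormal frames\<close>

text \<open>The family \<open>u\<close> is indexed by the basis of the model space and thus has as many members as the
  tangent space has dimensions. Linear independence alone makes it a basis.\<close>

lemma orthonormal_expansion:
  fixes M :: "('a, 'e::euclidean_space) manifold" and u :: "'e \<Rightarrow> ('a, 'e) tangent"
  assumes M: "smooth_manifold M" and g: "riemannian_metric M g" and p: "p \<in> pts M"
    and u: "\<And>i. i \<in> Basis \<Longrightarrow> u i \<in> tangent_space M p"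
    and on: "\<And>i j. i \<in> Basis \<Longrightarrow> j \<in> Basis \<Longrightarrow> g p (u i) (u j) = (if i = j then 1 else 0)"
    and v: "v \<in> tangent_space M p"
  shows "v = (\<Sum>i\<in>Basis. g p v (u i) *\<^sub>R u i)"
proof -
  obtain c where c: "c \<in> charts_at M p" using charts_at_exists [OF M p] by blast
  define L where "L x = (\<Sum>i\<in>Basis. (x \<bullet> i) *\<^sub>R u i)" for x
  have LT: "L x \<in> tangent_space M p" for x
    unfolding L_def by (intro tangent_sum tangent_scaleR M u)
  have coef: "g p (L x) (u j) = x \<bullet> j" if "j \<in> Basis" for x j
  proof -
    have "g p (L x) (u j) = (\<Sum>i\<in>Basis. (x \<bullet> i) * g p (u i) (u j))"
      unfolding L_def by (rule metric_sum_left [OF M g p u [OF that]]) (rule u)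
    also have "\<dots> = (\<Sum>i\<in>Basis. if i = j then x \<bullet> i else 0)"
      by (intro sum.cong refl) (simp add: on that)
    finally show ?thesis using that by simp
  qed
  have lin: "linear (\<lambda>x. L x c)"
    by (rule linearI) (simp_all add: L_def sum_component inner_add_left scaleR_add_left sum.distrib
        scaleR_sum_right)
  \<comment> \<open>an injective linear endomorphism of the model space is surjective\<close>
  have "x = 0" if "L x c = 0" for x
  proof -
    have "L x = 0" by (rule tangent_eqI [OF LT tangent_zero [OF M] c]) (simp add: that)
    moreover have "g p 0 (u j) = 0" if "j \<in> Basis" for j
      using riemannian_metricD(3) [OF g p tangent_zero [OF M] u [OF that], of 0] by simp
    ultimately show ?thesis using coef [of _ x] by (intro euclidean_eqI [of x]) simp
  qed
  then have "surj (\<lambda>x. L x c)"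
    using lin by (intro linear_injective_imp_surjective) (auto simp: linear_injective_0)
  then obtain x where x: "v c = L x c" by (metis surjD)
  have vx: "v = L x" by (rule tangent_eqI [OF v LT c x])
  show ?thesis
    unfolding vx by (subst L_def) (intro sum.cong refl, simp add: coef)
qed

lemma orthonormal_eqI:
  fixes M :: "('a, 'e::euclidean_space) manifold" and u :: "'e \<Rightarrow> ('a, 'e) tangent"
  assumes M: "smooth_manifold M" and g: "riemannian_metric M g" and p: "p \<in> pts M"
    and u: "\<And>i. i \<in> Basis \<Longrightarrow> u i \<in> tangent_space M p"
    and on: "\<And>i j. i \<in> Basis \<Longrightarrow> j \<in> Basis \<Longrightarrow> g p (u i) (u j) = (if i = j then 1 else 0)"
    and v: "v \<in> tangent_space M p" and w: "w \<in> tangent_space M p"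
    and eq: "\<And>i. i \<in> Basis \<Longrightarrow> g p v (u i) = g p w (u i)"
  shows "v = w"
proof -
  have "v = (\<Sum>i\<in>Basis. g p v (u i) *\<^sub>R u i)" by (rule orthonormal_expansion [OF M g p u on v])
  also have "\<dots> = (\<Sum>i\<in>Basis. g p w (u i) *\<^sub>R u i)" by (intro sum.cong refl) (simp add: eq)
  also have "\<dots> = w" by (rule orthonormal_expansion [OF M g p u on w, symmetric])
  finally show ?thesis .
qed

lemma orthonormal_atD:
  assumes "orthonormal_at M g p E"
  shows "i \<in> Basis \<Longrightarrow> smooth_vector_field M (E i)"
    "i \<in> Basis \<Longrightarrow> j \<in> Basis \<Longrightarrow> g p (E i p) (E j p) = (if i = j then 1 else 0)"
  using assms by (auto simp: orthonormal_at_def)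

text \<open>A Riemannian manifold with a global orthonormal frame \<open>E\<close>.\<close>

locale framed_manifold =
  fixes M :: "('a, 'e::euclidean_space) manifold" and g :: "('a, 'e) metric_tensor"
    and E :: "'e \<Rightarrow> 'a \<Rightarrow> ('a, 'e) tangent"
  assumes M: "smooth_manifold M" and g: "riemannian_metric M g"
    and E: "\<And>i. i \<in> Basis \<Longrightarrow> smooth_vector_field M (E i)"
    and E_orthonormal: "\<And>p i j. p \<in> pts M \<Longrightarrow> i \<in> Basis \<Longrightarrow> j \<in> Basis \<Longrightarrow>
      g p (E i p) (E j p) = (if i = j then 1 else 0)"
begin

lemma E_tangent: "i \<in> Basis \<Longrightarrow> p \<in> pts M \<Longrightarrow> E i p \<in> tangent_space M p"
  by (rule smooth_field_tangent [OF E])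

lemma frame_expansion: "p \<in> pts M \<Longrightarrow> v \<in> tangent_space M p \<Longrightarrow> (\<Sum>i\<in>Basis. g p v (E i p) *\<^sub>R E i p) = v"
  using orthonormal_expansion [OF M g, of p "\<lambda>i. E i p" v] E_tangent E_orthonormal by simp

lemma frame_eqI:
  assumes "p \<in> pts M" "v \<in> tangent_space M p" "w \<in> tangent_space M p"
    and "\<And>k. k \<in> Basis \<Longrightarrow> g p v (E k p) = g p w (E k p)"
  shows "v = w"
  by (rule orthonormal_eqI [OF M g assms(1) E_tangent [OF _ assms(1)] E_orthonormal [OF assms(1)]
      assms(2-)])

lemma frame_coefficient:
  assumes "p \<in> pts M" "k \<in> Basis"
  shows "g p (\<Sum>i\<in>Basis. r i *\<^sub>R E i p) (E k p) = r k"
proof -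
  have "g p (\<Sum>i\<in>Basis. r i *\<^sub>R E i p) (E k p) = (\<Sum>i\<in>Basis. r i * g p (E i p) (E k p))"
    by (rule metric_sum_left [OF M g assms(1) E_tangent [OF assms(2,1)]]) (rule E_tangent [OF _ assms(1)])
  also have "\<dots> = (\<Sum>i\<in>Basis. if i = k then r i else 0)"
    by (intro sum.cong refl) (simp add: E_orthonormal assms)
  finally show ?thesis using assms(2) by simp
qed

lemma frame_inner:
  assumes p: "p \<in> pts M" and v: "v \<in> tangent_space M p" and w: "w \<in> tangent_space M p"
  shows "g p v w = (\<Sum>k\<in>Basis. g p v (E k p) * g p w (E k p))"
proof -
  have "g p v w = g p v (\<Sum>k\<in>Basis. g p w (E k p) *\<^sub>R E k p)"
    by (simp only: frame_expansion [OF p w])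
  also have "\<dots> = (\<Sum>k\<in>Basis. g p w (E k p) * g p v (E k p))"
    by (rule metric_sum_right [OF M g p v E_tangent [OF _ p]])
  finally show ?thesis by (simp add: mult.commute)
qed

lemma section_along_frame:
  assumes L: "smooth_manifold L" and s: "smooth_map L M \<phi>" and i: "i \<in> Basis"
  shows "smooth_section L M \<phi> (\<lambda>q. E i (\<phi> q))"
  using smooth_section_compose [OF L M M s smooth_map_id [OF M] E [OF i]] by simp

lemma smooth_coefficient:
  assumes L: "smooth_manifold L" and s: "smooth_map L M \<phi>" and W: "smooth_section L M \<phi> W"
      and i: "i \<in> Basis"
  shows "smooth_function L (\<lambda>q. g (\<phi> q) (W q) (E i (\<phi> q)))"
  by (rule smooth_function_metric [OF L M g s W section_along_frame [OF L s i]])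

lemma smooth_field_coefficient:
  assumes X: "smooth_vector_field M X" and i: "i \<in> Basis"
  shows "smooth_function M (\<lambda>q. g q (X q) (E i q))"
  using smooth_coefficient [OF M smooth_map_id [OF M] X i] by simp

text \<open>The coefficient of \<open>E k\<close> in the bracket of \<open>E i\<close> and \<open>E j\<close>.\<close>

definition structure_coeff :: "'e \<Rightarrow> 'e \<Rightarrow> 'e \<Rightarrow> 'a \<Rightarrow> real" where
  "structure_coeff i j k q = g q (field_bracket M (E i) (E j) q) (E k q)"

text \<open>The coefficient of \<open>E k\<close> in the covariant derivative of \<open>E j\<close> in the direction \<open>E i\<close>. The formula is
  Koszul's; the derivatives of the metric do not occur because the frame is orthonormal. It is
  antisymmetric in \<open>j\<close> and \<open>k\<close>, which makes the connection metric, and its antisymmetrisation in \<open>i\<close> and \<open>j\<close>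
      is
  the structure coefficient, which makes the connection torsion-free.\<close>

definition christoffel :: "'e \<Rightarrow> 'e \<Rightarrow> 'e \<Rightarrow> 'a \<Rightarrow> real" where
  "christoffel i j k q = (structure_coeff i j k q - structure_coeff j k i q + structure_coeff k i j q) / 2"

lemma structure_coeff_skew:
  assumes q: "q \<in> pts M" and k: "k \<in> Basis" and ij: "i \<in> Basis" "j \<in> Basis"
  shows "structure_coeff j i k q = - structure_coeff i j k q"
proof -
  have "g q ((-1) *\<^sub>R field_bracket M (E i) (E j) q) (E k q)
      = (-1) * g q (field_bracket M (E i) (E j) q) (E k q)"
    by (rule riemannian_metricD(3) [OF g q field_bracket_tangent [OF M E [OF ij(1)] E [OF ij(2)]]
        E_tangent [OF k q]])
  then show ?thesis unfolding structure_coeff_def field_bracket_skew [of M "E j"] by simp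
qed

lemma christoffel_torsion:
  assumes "q \<in> pts M" "k \<in> Basis" "i \<in> Basis" "j \<in> Basis"
  shows "christoffel i j k q - christoffel j i k q = structure_coeff i j k q"
  using structure_coeff_skew [of q k i j] structure_coeff_skew [of q i j k]
      structure_coeff_skew [of q j i k] assms
  by (simp add: christoffel_def field_simps)

lemma christoffel_metric:
  assumes "q \<in> pts M" "k \<in> Basis" "i \<in> Basis" "j \<in> Basis"
  shows "christoffel i k j q = - christoffel i j k q"
  using structure_coeff_skew [of q k i j] structure_coeff_skew [of q i j k]
      structure_coeff_skew [of q j i k] assms
  by (simp add: christoffel_def field_simps)

lemma smooth_christoffel:
  assumes "i \<in> Basis" "j \<in> Basis" "k \<in> Basis"
  shows "smooth_function M (christoffel i j k)"
proof -
  have s: "smooth_function M (structure_coeff i j k)" if "i \<in> Basis" "j \<in> Basis" "k \<in> Basis" for i j k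
    unfolding structure_coeff_def
    by (rule smooth_field_coefficient [OF smooth_field_bracket [OF M E [OF that(1)] E [OF that(2)]]
        that(3)])
  have "smooth_function M (\<lambda>q. (1/2) * ((structure_coeff i j k q - structure_coeff j k i q)
      + structure_coeff k i j q))"
    by (intro smooth_function_mult smooth_function_add smooth_function_diff smooth_function_const s assms M)
  then show ?thesis by (simp add: christoffel_def [abs_def])
qed

text \<open>The pull-back along \<open>\<phi>\<close> of the connection with these Christoffel symbols, written with the
  coefficients of \<open>W\<close> in the frame \<open>E \<circ> \<phi>\<close>. For \<open>\<phi> = id\<close> it is the connection itself.\<close>

definition frame_connection ::
  "('c, 'd::euclidean_space) manifold \<Rightarrow> ('c \<Rightarrow> 'a) \<Rightarrow> ('c \<Rightarrow> ('c, 'd) tangent) \<Rightarrow> ('c \<Rightarrow> ('a, 'e) tangent)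
    \<Rightarrow> 'c \<Rightarrow> ('a, 'e) tangent" where
  "frame_connection L \<phi> X W q = (\<Sum>k\<in>Basis.
     (dir_deriv L q (X q) (\<lambda>r. g (\<phi> r) (W r) (E k (\<phi> r)))
      + (\<Sum>i\<in>Basis. \<Sum>j\<in>Basis. g (\<phi> q) (differential L M \<phi> q (X q)) (E i (\<phi> q))
           * g (\<phi> q) (W q) (E j (\<phi> q)) * christoffel i j k (\<phi> q))) *\<^sub>R E k (\<phi> q))"

lemma frame_connection_smooth:
  assumes L: "smooth_manifold L" and s: "smooth_map L M \<phi>"
    and X: "smooth_vector_field L X" and W: "smooth_section L M \<phi> W"
  shows "smooth_section L M \<phi> (frame_connection L \<phi> X W)"
  unfolding frame_connection_def [abs_def]
  by (intro smooth_section_sum [OF L M s] smooth_section_scaleR [OF L M] smooth_function_add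
      smooth_function_sum [OF L] smooth_function_mult smooth_function_dir_deriv [OF L X]
      smooth_coefficient [OF L s W] smooth_coefficient [OF L s smooth_section_differential [OF L M s X]]
      smooth_function_compose [OF L M s smooth_christoffel] section_along_frame [OF L s])

lemma frame_connection_coefficient:
  assumes "\<phi> q \<in> pts M" "k \<in> Basis"
  shows "g (\<phi> q) (frame_connection L \<phi> X W q) (E k (\<phi> q)) =
     dir_deriv L q (X q) (\<lambda>r. g (\<phi> r) (W r) (E k (\<phi> r)))
      + (\<Sum>i\<in>Basis. \<Sum>j\<in>Basis. g (\<phi> q) (differential L M \<phi> q (X q)) (E i (\<phi> q))
           * g (\<phi> q) (W q) (E j (\<phi> q)) * christoffel i j k (\<phi> q))"
  unfolding frame_connection_def by (rule frame_coefficient [OF assms])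

lemma connection_along_frame_connection:
  assumes L: "smooth_manifold L" and s: "smooth_map L M \<phi>"
  shows "connection_along L M \<phi> (frame_connection L \<phi>)"
proof -
  have fp: "\<phi> p \<in> pts M" if "p \<in> pts L" for p by (rule smooth_mapD(3) [OF s that])
  have co: "g (\<phi> q) (frame_connection L \<phi> X W q) (E k (\<phi> q)) =
     dir_deriv L q (X q) (\<lambda>r. g (\<phi> r) (W r) (E k (\<phi> r)))
      + (\<Sum>i\<in>Basis. \<Sum>j\<in>Basis. g (\<phi> q) (differential L M \<phi> q (X q)) (E i (\<phi> q))
           * g (\<phi> q) (W q) (E j (\<phi> q)) * christoffel i j k (\<phi> q))"
    if "q \<in> pts L" "k \<in> Basis" for q k X W
    by (rule frame_connection_coefficient [of \<phi>, OF fp [OF that(1)] that(2)])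
  note rm = riemannian_metricD [OF g fp]
  have tan: "frame_connection L \<phi> X W p \<in> tangent_space M (\<phi> p)"
    if "p \<in> pts L" for X W p
    unfolding frame_connection_def by (intro tangent_sum tangent_scaleR M E_tangent fp that)
  have dT: "differential L M \<phi> p v \<in> tangent_space M (\<phi> p)" if "p \<in> pts L" for p v
    by (rule differential_tangent [OF L M s that])
  show ?thesis
    unfolding connection_along_def
  proof (intro conjI allI impI ballI; (elim conjE)?)
    fix X W assume "smooth_vector_field L X" "smooth_section L M \<phi> W"
    then show "smooth_section L M \<phi> (frame_connection L \<phi> X W)" by (rule frame_connection_smooth [OF L s])
  next
    fix X Y W p
    assume X: "smooth_vector_field L X" and Y: "smooth_vector_field L Y" and W: "smooth_section L M \<phi> W"
      and p: "p \<in> pts L"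
    show "frame_connection L \<phi> (\<lambda>q. X q + Y q) W p = frame_connection L \<phi> X W p
        + frame_connection L \<phi> Y W p"
    proof (rule frame_eqI [OF fp [OF p] tan [OF p] tangent_add [OF M tan [OF p] tan [OF p]]])
      fix k :: 'e assume k: "k \<in> Basis"
      have d: "g (\<phi> p) (differential L M \<phi> p (X p + Y p)) (E i (\<phi> p))
          = g (\<phi> p) (differential L M \<phi> p (X p)) (E i (\<phi> p))
              + g (\<phi> p) (differential L M \<phi> p (Y p)) (E i (\<phi> p))"
        if "i \<in> Basis" for i
        unfolding differential_add [OF L s p]
            by (rule rm(2) [OF p dT [OF p] dT [OF p] E_tangent [OF that fp [OF p]]])
      show "g (\<phi> p) (frame_connection L \<phi> (\<lambda>q. X q + Y q) W p) (E k (\<phi> p))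
          = g (\<phi> p) (frame_connection L \<phi> X W p + frame_connection L \<phi> Y W p) (E k (\<phi> p))"
        unfolding rm(2) [OF p tan [OF p] tan [OF p] E_tangent [OF k fp [OF p]]] co [OF p k]
          dir_deriv_linear(1) [OF L p smooth_coefficient [OF L s W k]]
        by (simp add: d distrib_right sum.distrib)
    qed
  next
    fix f X W p
    assume f: "smooth_function L f" and X: "smooth_vector_field L X" and W: "smooth_section L M \<phi> W"
      and p: "p \<in> pts L"
    show "frame_connection L \<phi> (\<lambda>q. f q *\<^sub>R X q) W p = f p *\<^sub>R frame_connection L \<phi> X W p"
    proof (rule frame_eqI [OF fp [OF p] tan [OF p] tangent_scaleR [OF M tan [OF p]]])
      fix k :: 'e assume k: "k \<in> Basis"
      have d: "g (\<phi> p) (differential L M \<phi> p (f p *\<^sub>R X p)) (E i (\<phi> p))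
          = f p * g (\<phi> p) (differential L M \<phi> p (X p)) (E i (\<phi> p))"
        if "i \<in> Basis" for i
        unfolding differential_scaleR [OF L s p]
            by (rule rm(3) [OF p dT [OF p] E_tangent [OF that fp [OF p]]])
      show "g (\<phi> p) (frame_connection L \<phi> (\<lambda>q. f q *\<^sub>R X q) W p) (E k (\<phi> p))
          = g (\<phi> p) (f p *\<^sub>R frame_connection L \<phi> X W p) (E k (\<phi> p))"
        unfolding rm(3) [OF p tan [OF p] E_tangent [OF k fp [OF p]]] co [OF p k]
          dir_deriv_linear(2) [OF L p smooth_coefficient [OF L s W k]]
        by (simp add: d distrib_left sum_distrib_left mult.assoc)
    qed
  next
    fix X V W p
    assume X: "smooth_vector_field L X" and V: "smooth_section L M \<phi> V" and W: "smooth_section L M \<phi> W"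
      and p: "p \<in> pts L"
    show "frame_connection L \<phi> X (\<lambda>q. V q + W q) p = frame_connection L \<phi> X V p
        + frame_connection L \<phi> X W p"
    proof (rule frame_eqI [OF fp [OF p] tan [OF p] tangent_add [OF M tan [OF p] tan [OF p]]])
      fix k :: 'e assume k: "k \<in> Basis"
      have d: "g (\<phi> r) (V r + W r) (E i (\<phi> r)) = g (\<phi> r) (V r) (E i (\<phi> r)) + g (\<phi> r) (W r) (E i (\<phi> r))"
        if "r \<in> pts L" "i \<in> Basis" for r i
        by (rule rm(2) [OF that(1) smooth_section_tangent [OF V that(1)]
            smooth_section_tangent [OF W that(1)]
              E_tangent [OF that(2) fp [OF that(1)]]])
      have "dir_deriv L p (X p) (\<lambda>r. g (\<phi> r) (V r + W r) (E k (\<phi> r)))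
          = dir_deriv L p (X p) (\<lambda>r. g (\<phi> r) (V r) (E k (\<phi> r)) + g (\<phi> r) (W r) (E k (\<phi> r)))"
        by (rule dir_deriv_cong [OF L p]) (rule d [OF _ k])
      also have "\<dots> = dir_deriv L p (X p) (\<lambda>r. g (\<phi> r) (V r) (E k (\<phi> r)))
          + dir_deriv L p (X p) (\<lambda>r. g (\<phi> r) (W r) (E k (\<phi> r)))"
        by (rule dir_deriv_add [OF L p smooth_coefficient [OF L s V k] smooth_coefficient [OF L s W k]])
      finally show "g (\<phi> p) (frame_connection L \<phi> X (\<lambda>q. V q + W q) p) (E k (\<phi> p))
          = g (\<phi> p) (frame_connection L \<phi> X V p + frame_connection L \<phi> X W p) (E k (\<phi> p))"
        unfolding rm(2) [OF p tan [OF p] tan [OF p] E_tangent [OF k fp [OF p]]] co [OF p k]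
        by (simp add: d [OF p] distrib_left distrib_right sum.distrib)
    qed
  next
    fix f X W p
    assume f: "smooth_function L f" and X: "smooth_vector_field L X" and W: "smooth_section L M \<phi> W"
      and p: "p \<in> pts L"
    note Wp = smooth_section_tangent [OF W p]
    show "frame_connection L \<phi> X (\<lambda>q. f q *\<^sub>R W q) p
        = dir_deriv L p (X p) f *\<^sub>R W p + f p *\<^sub>R frame_connection L \<phi> X W p"
    proof (rule frame_eqI [OF fp [OF p] tan [OF p]])
      show "dir_deriv L p (X p) f *\<^sub>R W p + f p *\<^sub>R frame_connection L \<phi> X W p \<in> tangent_space M (\<phi> p)"
        by (intro tangent_add tangent_scaleR M Wp tan p)
      fix k :: 'e assume k: "k \<in> Basis"
      note Ek = E_tangent [OF k fp [OF p]]
      have d: "g (\<phi> r) (f r *\<^sub>R W r) (E i (\<phi> r)) = f r * g (\<phi> r) (W r) (E i (\<phi> r))"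
        if "r \<in> pts L" "i \<in> Basis" for r i
        by (rule rm(3) [OF that(1) smooth_section_tangent [OF W that(1)]
            E_tangent [OF that(2) fp [OF that(1)]]])
      have "dir_deriv L p (X p) (\<lambda>r. g (\<phi> r) (f r *\<^sub>R W r) (E k (\<phi> r)))
          = dir_deriv L p (X p) (\<lambda>r. f r * g (\<phi> r) (W r) (E k (\<phi> r)))"
        by (rule dir_deriv_cong [OF L p]) (rule d [OF _ k])
      also have "\<dots> = dir_deriv L p (X p) f * g (\<phi> p) (W p) (E k (\<phi> p))
          + f p * dir_deriv L p (X p) (\<lambda>r. g (\<phi> r) (W r) (E k (\<phi> r)))"
        by (rule dir_deriv_mult [OF L p f smooth_coefficient [OF L s W k]])
      finally show "g (\<phi> p) (frame_connection L \<phi> X (\<lambda>q. f q *\<^sub>R W q) p) (E k (\<phi> p))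
          = g (\<phi> p) (dir_deriv L p (X p) f *\<^sub>R W p + f p *\<^sub>R frame_connection L \<phi> X W p) (E k (\<phi> p))"
        unfolding rm(2) [OF p tangent_scaleR [OF M Wp] tangent_scaleR [OF M tan [OF p]] Ek]
          rm(3) [OF p Wp Ek] rm(3) [OF p tan [OF p] Ek] co [OF p k]
        by (simp add: d [OF p] distrib_left sum_distrib_left mult_ac)
    qed
  qed
qed

end

section \<open>The Levi-Civita connection\<close>

lemma connection_alongD:
  assumes "connection_along M N \<phi> D" "smooth_vector_field M X"
  shows "smooth_section M N \<phi> W \<Longrightarrow> smooth_section M N \<phi> (D X W)"
    "smooth_vector_field M Y \<Longrightarrow> smooth_section M N \<phi> W \<Longrightarrow> p \<in> pts M \<Longrightarrow>
      D (\<lambda>q. X q + Y q) W p = D X W p + D Y W p"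
    "smooth_function M f \<Longrightarrow> smooth_section M N \<phi> W \<Longrightarrow> p \<in> pts M \<Longrightarrow>
      D (\<lambda>q. f q *\<^sub>R X q) W p = f p *\<^sub>R D X W p"
    "smooth_section M N \<phi> V \<Longrightarrow> smooth_section M N \<phi> W \<Longrightarrow> p \<in> pts M \<Longrightarrow>
      D X (\<lambda>q. V q + W q) p = D X V p + D X W p"
    "smooth_function M f \<Longrightarrow> smooth_section M N \<phi> W \<Longrightarrow> p \<in> pts M \<Longrightarrow>
      D X (\<lambda>q. f q *\<^sub>R W q) p = dir_deriv M p (X p) f *\<^sub>R W p + f p *\<^sub>R D X W p"
proof -
  note c1 = assms(1) [unfolded connection_along_def]
  note c2 = conjunct2 [OF c1]
  note c3 = conjunct2 [OF c2]
  note c4 = conjunct2 [OF c3]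
  note c5 = conjunct2 [OF c4]
  show "smooth_section M N \<phi> W \<Longrightarrow> smooth_section M N \<phi> (D X W)"
    using conjunct1 [OF c1] assms(2) by blast
  show "smooth_vector_field M Y \<Longrightarrow> smooth_section M N \<phi> W \<Longrightarrow> p \<in> pts M \<Longrightarrow>
      D (\<lambda>q. X q + Y q) W p = D X W p + D Y W p"
    using conjunct1 [OF c2] assms(2) by blast
  show "smooth_function M f \<Longrightarrow> smooth_section M N \<phi> W \<Longrightarrow> p \<in> pts M \<Longrightarrow>
      D (\<lambda>q. f q *\<^sub>R X q) W p = f p *\<^sub>R D X W p"
    using conjunct1 [OF c3] assms(2) by blast
  show "smooth_section M N \<phi> V \<Longrightarrow> smooth_section M N \<phi> W \<Longrightarrow> p \<in> pts M \<Longrightarrow>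
      D X (\<lambda>q. V q + W q) p = D X V p + D X W p"
    using conjunct1 [OF c4] assms(2) by blast
  show "smooth_function M f \<Longrightarrow> smooth_section M N \<phi> W \<Longrightarrow> p \<in> pts M \<Longrightarrow>
      D X (\<lambda>q. f q *\<^sub>R W q) p = dir_deriv M p (X p) f *\<^sub>R W p + f p *\<^sub>R D X W p"
    using c5 assms(2) by blast
qed

lemma connection_along_tangent:
  assumes "connection_along M N \<phi> D" "smooth_vector_field M X" "smooth_section M N \<phi> W"
    "p \<in> pts M"
  shows "D X W p \<in> tangent_space N (\<phi> p)"
  by (rule smooth_section_tangent [OF connection_alongD(1) [OF assms(1-3)] assms(4)])

lemma connection_along_zero:
  assumes M: "smooth_manifold M" and N: "smooth_manifold N" and s: "smooth_map M N \<phi>"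
    and D: "connection_along M N \<phi> D" and p: "p \<in> pts M"
  shows "smooth_vector_field M X \<Longrightarrow> D X (\<lambda>q. 0) p = 0"
    "smooth_section M N \<phi> W \<Longrightarrow> D (\<lambda>q. 0) W p = 0"
  using connection_alongD(5) [OF D _ smooth_function_const [OF M] smooth_section_zero [OF M N s] p, of X 0]
    connection_alongD(3) [OF D smooth_section_zero [OF M M smooth_map_id [OF M]]
        smooth_function_const [OF M] _ p, of W 0]
  by (simp_all add: dir_deriv_const [OF M])

lemma connection_along_sum:
  assumes M: "smooth_manifold M" and N: "smooth_manifold N" and s: "smooth_map M N \<phi>"
    and D: "connection_along M N \<phi> D" and p: "p \<in> pts M"
    and X: "smooth_vector_field M X"
    and f: "\<And>i. i \<in> I \<Longrightarrow> smooth_function M (f i)" and W: "\<And>i. i \<in> I \<Longrightarrow> smooth_section M N \<phi> (W i)"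
  shows "D X (\<lambda>q. \<Sum>i\<in>I. f i q *\<^sub>R W i q) p
    = (\<Sum>i\<in>I. dir_deriv M p (X p) (f i) *\<^sub>R W i p + f i p *\<^sub>R D X (W i) p)"
  using f W
proof (induction I rule: infinite_finite_induct)
  case (insert i I)
  have i: "smooth_function M (f i)" "smooth_section M N \<phi> (W i)" by (intro insert.prems insertI1)+
  have I: "smooth_section M N \<phi> (\<lambda>q. \<Sum>i\<in>I. f i q *\<^sub>R W i q)"
    by (intro smooth_section_sum [OF M N s] smooth_section_scaleR [OF M N] insert.prems insertI2)
  show ?case
    unfolding sum.insert [OF insert(1,2)] connection_alongD(4) [OF D X smooth_section_scaleR [OF M N i] I p]
      connection_alongD(5) [OF D X i p]
    by (rule arg_cong [OF insert.IH]) (use insert.prems in blast)+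
qed (simp_all add: connection_along_zero [OF M N s D p] X)

lemma connection_along_sum_direction:
  assumes M: "smooth_manifold M" and N: "smooth_manifold N" and s: "smooth_map M N \<phi>"
    and D: "connection_along M N \<phi> D" and p: "p \<in> pts M"
    and W: "smooth_section M N \<phi> W"
    and f: "\<And>i. i \<in> I \<Longrightarrow> smooth_function M (f i)" and X: "\<And>i. i \<in> I \<Longrightarrow> smooth_vector_field M (X i)"
  shows "D (\<lambda>q. \<Sum>i\<in>I. f i q *\<^sub>R X i q) W p = (\<Sum>i\<in>I. f i p *\<^sub>R D (X i) W p)"
  using f X
proof (induction I rule: infinite_finite_induct)
  case (insert i I)
  have i: "smooth_function M (f i)" "smooth_vector_field M (X i)" by (intro insert.prems insertI1)+
  have I: "smooth_vector_field M (\<lambda>q. \<Sum>i\<in>I. f i q *\<^sub>R X i q)"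
    by (intro smooth_section_sum [OF M M smooth_map_id [OF M]] smooth_section_scaleR [OF M M]
        insert.prems insertI2)
  show ?case
    unfolding sum.insert [OF insert(1,2)] connection_alongD(2) [OF D smooth_section_scaleR [OF M M i] I W p]
      connection_alongD(3) [OF D i(2) i(1) W p]
    by (rule arg_cong [OF insert.IH]) (use insert.prems in blast)+
qed (simp_all add: connection_along_zero [OF M N s D p] W)

text \<open>A connection is applied to functions on the whole type, and two sections with the same values on the
  manifold may differ elsewhere. Their covariant derivatives agree: multiplication by the indicator
  function of the set of points, which is a smooth function, makes the two sections equal.\<close>

lemma smooth_function_indicator:
  assumes M: "smooth_manifold M"
  shows "smooth_function M (\<lambda>q. if q \<in> pts M then 1 else 0)"
proof (rule smooth_functionI, rule smooth_on_cong)
  fix c assume c: "c \<in> man_atlas M"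
  show "smooth_on (snd c ` fst c) (\<lambda>x. 1)" by (intro smooth_on_const smooth_manifold_chart(4) [OF M c])
  show "1 = (if chart_inv c y \<in> pts M then 1 else 0 :: real)" if "y \<in> snd c ` fst c" for y
    using that chart_inv_left [OF M c] smooth_manifold_chart(2) [OF M c] by auto
qed

lemma connection_along_cong:
  assumes M: "smooth_manifold M" and D: "connection_along M N \<phi> D" and p: "p \<in> pts M"
    and X: "smooth_vector_field M X" and V: "smooth_section M N \<phi> V"
    and eq: "\<And>q. q \<in> pts M \<Longrightarrow> V q = W q"
  shows "D X V p = D X W p"
proof -
  let ?f = "\<lambda>q. if q \<in> pts M then 1 else 0 :: real"
  have W: "smooth_section M N \<phi> W" by (rule smooth_section_cong [OF M V _ eq]) simp
  have f: "smooth_function M ?f" by (rule smooth_function_indicator [OF M])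
  have f0: "dir_deriv M p v ?f = 0" for v
    using dir_deriv_cong [OF M p, of ?f "\<lambda>q. 1"] dir_deriv_const [OF M] by simp
  have fU: "D X U p = D X (\<lambda>q. ?f q *\<^sub>R U q) p" if "smooth_section M N \<phi> U" for U
    using connection_alongD(5) [OF D X f that p] p by (simp add: f0)
  have eqf: "(\<lambda>q. ?f q *\<^sub>R V q) = (\<lambda>q. ?f q *\<^sub>R W q)" by (rule ext) (simp add: eq)
  show ?thesis unfolding fU [OF V] fU [OF W] eqf ..
qed

lemma connection_along_cong_direction:
  assumes M: "smooth_manifold M" and D: "connection_along M N \<phi> D" and p: "p \<in> pts M"
    and X: "smooth_vector_field M X" and W: "smooth_section M N \<phi> W"
    and eq: "\<And>q. q \<in> pts M \<Longrightarrow> X q = Y q"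
  shows "D X W p = D Y W p"
proof -
  let ?f = "\<lambda>q. if q \<in> pts M then 1 else 0 :: real"
  have Y: "smooth_vector_field M Y" by (rule smooth_section_cong [OF M X _ eq]) simp
  have f: "smooth_function M ?f" by (rule smooth_function_indicator [OF M])
  have fZ: "D Z W p = D (\<lambda>q. ?f q *\<^sub>R Z q) W p" if "smooth_vector_field M Z" for Z
    using connection_alongD(3) [OF D that f W p] p by simp
  have eqf: "(\<lambda>q. ?f q *\<^sub>R X q) = (\<lambda>q. ?f q *\<^sub>R Y q)" by (rule ext) (simp add: eq)
  show ?thesis unfolding fZ [OF X] fZ [OF Y] eqf ..
qed

lemma is_levi_civitaD:
  assumes "is_levi_civita M g D" "smooth_vector_field M X" "smooth_vector_field M Y" "p \<in> pts M"
  shows "D X Y p - D Y X p = field_bracket M X Y p"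
    "smooth_vector_field M Z \<Longrightarrow> dir_deriv M p (X p) (\<lambda>q. g q (Y q) (Z q)) = g p (D X Y p) (Z p)
        + g p (Y p) (D X Z p)"
proof -
  note c = conjunct2 [OF assms(1) [unfolded is_levi_civita_def]]
  show "D X Y p - D Y X p = field_bracket M X Y p"
    using conjunct1 [OF c] assms(2-) by blast
  show "smooth_vector_field M Z \<Longrightarrow>
      dir_deriv M p (X p) (\<lambda>q. g q (Y q) (Z q)) = g p (D X Y p) (Z p) + g p (Y p) (D X Z p)"
    using conjunct2 [OF c] assms(2-) by blast
qed

lemma is_levi_civita_connection: "is_levi_civita M g D \<Longrightarrow> connection_along M M id D"
  by (simp add: is_levi_civita_def)

text \<open>The right-hand side of Koszul's formula, which determines the Levi-Civita connection by the metric
  and the brackets.\<close>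

definition koszul ::
  "('a, 'e::euclidean_space) manifold \<Rightarrow> ('a, 'e) metric_tensor \<Rightarrow> ('a \<Rightarrow> ('a, 'e) tangent)
    \<Rightarrow> ('a \<Rightarrow> ('a, 'e) tangent) \<Rightarrow> ('a \<Rightarrow> ('a, 'e) tangent) \<Rightarrow> 'a \<Rightarrow> real" where
  "koszul M g X Y Z p =
     dir_deriv M p (X p) (\<lambda>q. g q (Y q) (Z q)) + dir_deriv M p (Y p) (\<lambda>q. g q (Z q) (X q))
     - dir_deriv M p (Z p) (\<lambda>q. g q (X q) (Y q)) + g p (field_bracket M X Y p) (Z p)
     - g p (field_bracket M X Z p) (Y p) - g p (field_bracket M Y Z p) (X p)"

lemma metric_diff_left:
  assumes M: "smooth_manifold M" and g: "riemannian_metric M g" and p: "p \<in> pts M"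
    and u: "u \<in> tangent_space M p" and v: "v \<in> tangent_space M p" and w: "w \<in> tangent_space M p"
  shows "g p (u - v) w = g p u w - g p v w"
  using riemannian_metricD(2) [OF g p tangent_diff [OF M u v] v w] by simp

lemma koszul_formula:
  assumes M: "smooth_manifold M" and g: "riemannian_metric M g" and D: "is_levi_civita M g D"
    and X: "smooth_vector_field M X" and Y: "smooth_vector_field M Y" and Z: "smooth_vector_field M Z"
    and p: "p \<in> pts M"
  shows "2 * g p (D X Y p) (Z p) = koszul M g X Y Z p"
proof -
  have T: "D U V p \<in> tangent_space M p" if "smooth_vector_field M U" "smooth_vector_field M V" for U V
    using connection_along_tangent [OF is_levi_civita_connection [OF D] that p] by simp
  note t = smooth_field_tangent [OF _ p]
  note d = metric_diff_left [OF M g p] and sym = riemannian_metricD(1) [OF g p]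
  have "g p (field_bracket M X Y p) (Z p) = g p (D X Y p) (Z p) - g p (D Y X p) (Z p)"
    "g p (field_bracket M X Z p) (Y p) = g p (D X Z p) (Y p) - g p (D Z X p) (Y p)"
    "g p (field_bracket M Y Z p) (X p) = g p (D Y Z p) (X p) - g p (D Z Y p) (X p)"
    unfolding is_levi_civitaD(1) [OF D X Y p, symmetric] is_levi_civitaD(1) [OF D X Z p, symmetric]
      is_levi_civitaD(1) [OF D Y Z p, symmetric]
    by (intro d T t X Y Z)+
  moreover have "g p (Y p) (D X Z p) = g p (D X Z p) (Y p)" "g p (Z p) (D Y X p) = g p (D Y X p) (Z p)"
    "g p (X p) (D Z Y p) = g p (D Z Y p) (X p)"
    by (intro sym T t X Y Z)+
  ultimately show ?thesis
    unfolding koszul_def is_levi_civitaD(2) [OF D X Y p Z] is_levi_civitaD(2) [OF D Y Z p X]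
      is_levi_civitaD(2) [OF D Z X p Y] by simp
qed

lemma field_bracket_sum_right:
  assumes M: "smooth_manifold M" and p: "p \<in> pts M" and X: "smooth_vector_field M X"
    and f: "\<And>i. i \<in> I \<Longrightarrow> smooth_function M (f i)" and Y: "\<And>i. i \<in> I \<Longrightarrow> smooth_vector_field M (Y i)"
  shows "field_bracket M X (\<lambda>q. \<Sum>i\<in>I. f i q *\<^sub>R Y i q) p
    = (\<Sum>i\<in>I. dir_deriv M p (X p) (f i) *\<^sub>R Y i p + f i p *\<^sub>R field_bracket M X (Y i) p)"
proof -
  have "field_bracket M X (\<lambda>q. 0 *\<^sub>R X q) p = dir_deriv M p (X p) (\<lambda>q. 0) *\<^sub>R X p
      + 0 *\<^sub>R field_bracket M X X p"
    by (rule field_bracket_scaleR_right [OF M X X smooth_function_const [OF M] p])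
  then have zero: "field_bracket M X (\<lambda>q. 0) p = 0"
    by (simp only: scaleR_zero_left dir_deriv_const [OF M] add_0_left)
  show ?thesis using f Y
  proof (induction I rule: infinite_finite_induct)
    case (insert i I)
    have i: "smooth_function M (f i)" "smooth_vector_field M (Y i)" by (intro insert.prems insertI1)+
    have I: "smooth_vector_field M (\<lambda>q. \<Sum>i\<in>I. f i q *\<^sub>R Y i q)"
      by (intro smooth_section_sum [OF M M smooth_map_id [OF M]] smooth_section_scaleR [OF M M]
          insert.prems insertI2)
    show ?case
      unfolding sum.insert [OF insert(1,2)] field_bracket_add_right [OF M X smooth_section_scaleR [OF M M i]
          I p]
        field_bracket_scaleR_right [OF M X i(2) i(1) p]
      by (rule arg_cong [OF insert.IH]) (use insert.prems in blast)+
  next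
    case empty
    show ?case unfolding sum.empty by (rule zero)
  next
    case (infinite I)
    show ?case unfolding sum.infinite [OF infinite(1)] by (rule zero)
  qed
qed

context framed_manifold
begin

lemma metric_sum_two:
  assumes p: "p \<in> pts M" and w: "w \<in> tangent_space M p" and v: "\<And>j. j \<in> Basis \<Longrightarrow> v j \<in> tangent_space M p"
  shows "g p (\<Sum>j\<in>Basis. a j *\<^sub>R E j p + b j *\<^sub>R v j) w = (\<Sum>j\<in>Basis. a j * g p (E j p) w
      + b j * g p (v j) w)"
proof -
  have "g p (\<Sum>j\<in>Basis. a j *\<^sub>R E j p + b j *\<^sub>R v j) w
      = g p ((\<Sum>j\<in>Basis. a j *\<^sub>R E j p) + (\<Sum>j\<in>Basis. b j *\<^sub>R v j)) w"
    by (simp only: sum.distrib)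
  also have "\<dots> = g p (\<Sum>j\<in>Basis. a j *\<^sub>R E j p) w + g p (\<Sum>j\<in>Basis. b j *\<^sub>R v j) w"
    by (intro riemannian_metricD(2) [OF g p] tangent_sum tangent_scaleR M v w E_tangent p)
  also have "g p (\<Sum>j\<in>Basis. a j *\<^sub>R E j p) w = (\<Sum>j\<in>Basis. a j * g p (E j p) w)"
    by (rule metric_sum_left [OF M g p w]) (rule E_tangent [OF _ p])
  also have "g p (\<Sum>j\<in>Basis. b j *\<^sub>R v j) w = (\<Sum>j\<in>Basis. b j * g p (v j) w)"
    by (rule metric_sum_left [OF M g p w]) (rule v)
  finally show ?thesis by (simp only: sum.distrib)
qed

lemma sum_delta_frame:
  assumes p: "p \<in> pts M" and k: "k \<in> Basis"
  shows "(\<Sum>j\<in>Basis. a j * g p (E j p) (E k p)) = a k"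
proof -
  have "(\<Sum>j\<in>Basis. a j * g p (E j p) (E k p)) = (\<Sum>j\<in>Basis. if j = k then a j else 0)"
    by (intro sum.cong refl) (simp add: E_orthonormal p k)
  then show ?thesis using k by simp
qed

text \<open>The coefficients of a bracket with respect to the frame.\<close>

lemma bracket_coefficient:
  assumes X: "smooth_vector_field M X" and Y: "smooth_vector_field M Y" and p: "p \<in> pts M"
      and k: "k \<in> Basis"
  shows "g p (field_bracket M X Y p) (E k p) =
    dir_deriv M p (X p) (\<lambda>q. g q (Y q) (E k q)) - dir_deriv M p (Y p) (\<lambda>q. g q (X q) (E k q))
    + (\<Sum>i\<in>Basis. \<Sum>j\<in>Basis. g p (X p) (E i p) * g p (Y p) (E j p) * structure_coeff i j k p)"
proof -
  have exp: "g p (field_bracket M X Y p) (E k p) = dir_deriv M p (X p) (\<lambda>q. g q (Y q) (E k q))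
      + (\<Sum>j\<in>Basis. g p (Y p) (E j p) * g p (field_bracket M X (E j) p) (E k p))"
    if X: "smooth_vector_field M X" and Y: "smooth_vector_field M Y" for X Y
  proof -
    have "field_bracket M X Y p = field_bracket M X (\<lambda>q. \<Sum>j\<in>Basis. g q (Y q) (E j q) *\<^sub>R E j q) p"
      by (rule field_bracket_cong [OF M p refl]) (rule frame_expansion [OF _
          smooth_field_tangent [OF Y], symmetric])
    also have "\<dots> = (\<Sum>j\<in>Basis. dir_deriv M p (X p) (\<lambda>q. g q (Y q) (E j q)) *\<^sub>R E j p
        + g p (Y p) (E j p) *\<^sub>R field_bracket M X (E j) p)"
      by (rule field_bracket_sum_right [OF M p X smooth_field_coefficient [OF Y] E])
    finally have "g p (field_bracket M X Y p) (E k p)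
        = g p (\<Sum>j\<in>Basis. dir_deriv M p (X p) (\<lambda>q. g q (Y q) (E j q)) *\<^sub>R E j p
        + g p (Y p) (E j p) *\<^sub>R field_bracket M X (E j) p) (E k p)"
      by (rule arg_cong [of _ _ "\<lambda>v. g p v (E k p)"])
    also have "\<dots> = (\<Sum>j\<in>Basis. dir_deriv M p (X p) (\<lambda>q. g q (Y q) (E j q)) * g p (E j p) (E k p)
        + g p (Y p) (E j p) * g p (field_bracket M X (E j) p) (E k p))"
      by (rule metric_sum_two [OF p E_tangent [OF k p] field_bracket_tangent [OF M X E]])
    finally show ?thesis by (simp only: sum.distrib sum_delta_frame [OF p k])
  qed
  have skew: "g p (field_bracket M X (E j) p) (E k p) =
      - g p (field_bracket M (E j) X p) (E k p)" if j: "j \<in> Basis" for j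
  proof -
    have "g p ((-1) *\<^sub>R field_bracket M (E j) X p) (E k p) = (-1) * g p (field_bracket M (E j) X p) (E k p)"
      by (rule riemannian_metricD(3) [OF g p field_bracket_tangent [OF M E [OF j] X] E_tangent [OF k p]])
    then show ?thesis unfolding field_bracket_skew [of M "X"] by simp
  qed
  have Yx: "dir_deriv M p (Y p) (\<lambda>q. g q (X q) (E k q))
      = (\<Sum>j\<in>Basis. g p (Y p) (E j p) * dir_deriv M p (E j p) (\<lambda>q. g q (X q) (E k q)))"
    using dir_deriv_vsum [OF M p smooth_field_coefficient [OF X k], of "\<lambda>j. g p (Y p) (E j p)" "\<lambda>j. E j p"
        Basis]
    unfolding frame_expansion [OF p smooth_field_tangent [OF Y p]] .
  have "(\<Sum>j\<in>Basis. g p (Y p) (E j p) * g p (field_bracket M X (E j) p) (E k p))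
      = (\<Sum>j\<in>Basis. g p (Y p) (E j p) * - (dir_deriv M p (E j p) (\<lambda>q. g q (X q) (E k q))
          + (\<Sum>i\<in>Basis. g p (X p) (E i p) * structure_coeff j i k p)))"
  proof (rule sum.cong [OF refl])
    fix j :: 'e assume j: "j \<in> Basis"
    show "g p (Y p) (E j p) * g p (field_bracket M X (E j) p) (E k p) = g p (Y p) (E j p) *
        - (dir_deriv M p (E j p) (\<lambda>q. g q (X q) (E k q))
            + (\<Sum>i\<in>Basis. g p (X p) (E i p) * structure_coeff j i k p))"
      unfolding skew [OF j] exp [OF E [OF j] X] structure_coeff_def by (rule refl)
  qed
  also have "\<dots> = - dir_deriv M p (Y p) (\<lambda>q. g q (X q) (E k q))
      + (\<Sum>j\<in>Basis. \<Sum>i\<in>Basis. g p (X p) (E i p) * g p (Y p) (E j p) * - structure_coeff j i k p)"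
    unfolding Yx
    by (simp add: distrib_left right_diff_distrib sum.distrib sum_subtractf sum_negf sum_distrib_left
        mult_ac)
  also have "(\<Sum>j\<in>Basis. \<Sum>i\<in>Basis. g p (X p) (E i p) * g p (Y p) (E j p) * - structure_coeff j i k p)
      = (\<Sum>j\<in>Basis. \<Sum>i\<in>Basis. g p (X p) (E i p) * g p (Y p) (E j p) * structure_coeff i j k p)"
  proof (intro sum.cong refl)
    fix i j :: 'e assume ij: "i \<in> Basis" "j \<in> Basis"
    show "g p (X p) (E i p) * g p (Y p) (E j p) * - structure_coeff j i k p
        = g p (X p) (E i p) * g p (Y p) (E j p) * structure_coeff i j k p"
      unfolding structure_coeff_skew [OF p k ij] by simp
  qed
  also have "\<dots> = (\<Sum>i\<in>Basis. \<Sum>j\<in>Basis. g p (X p) (E i p) * g p (Y p) (E j p) * structure_coeff i j k p)"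
    by (rule sum.swap)
  finally show ?thesis unfolding exp [OF X Y] by simp
qed

lemma is_levi_civita_frame_connection: "is_levi_civita M g (frame_connection M id)"
proof -
  note idM = smooth_map_id [OF M]
  have conn: "connection_along M M id (frame_connection M id)"
    by (rule connection_along_frame_connection [OF M idM])
  have tan: "frame_connection M id X Y p \<in> tangent_space M p"
    if "smooth_vector_field M X" "smooth_vector_field M Y" "p \<in> pts M" for X Y p
    using connection_along_tangent [OF conn that] by simp
  have co: "g p (frame_connection M id X Y p) (E k p) = dir_deriv M p (X p) (\<lambda>q. g q (Y q) (E k q))
      + (\<Sum>i\<in>Basis. \<Sum>j\<in>Basis. g p (X p) (E i p) * g p (Y p) (E j p) * christoffel i j k p)"
    if X: "smooth_vector_field M X" and p: "p \<in> pts M" and k: "k \<in> Basis" for X Y p k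
    using frame_connection_coefficient [of id p k M X Y] p k
      differential_id [OF M p smooth_field_tangent [OF X p]] by simp
  show ?thesis
    unfolding is_levi_civita_def
  proof (intro conjI allI impI ballI conn; (elim conjE)?)
    fix X Y p assume X: "smooth_vector_field M X" and Y: "smooth_vector_field M Y" and p: "p \<in> pts M"
    show "frame_connection M id X Y p - frame_connection M id Y X p = field_bracket M X Y p"
    proof (rule frame_eqI [OF p tangent_diff [OF M tan [OF X Y p] tan [OF Y X p]]
        field_bracket_tangent [OF M X Y]])
      fix k :: 'e assume k: "k \<in> Basis"
      have "(\<Sum>i\<in>Basis. \<Sum>j\<in>Basis. g p (Y p) (E i p) * g p (X p) (E j p) * christoffel i j k p)
          = (\<Sum>i\<in>Basis. \<Sum>j\<in>Basis. g p (Y p) (E j p) * g p (X p) (E i p) * christoffel j i k p)"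
        by (rule sum.swap)
      moreover have "(\<Sum>i\<in>Basis. \<Sum>j\<in>Basis. g p (X p) (E i p) * g p (Y p) (E j p) * christoffel i j k p)
          - (\<Sum>i\<in>Basis. \<Sum>j\<in>Basis. g p (Y p) (E j p) * g p (X p) (E i p) * christoffel j i k p)
          = (\<Sum>i\<in>Basis. \<Sum>j\<in>Basis. g p (X p) (E i p) * g p (Y p) (E j p) * structure_coeff i j k p)"
        unfolding sum_subtractf [symmetric]
      proof (intro sum.cong refl)
        fix i j :: 'e assume ij: "i \<in> Basis" "j \<in> Basis"
        show "g p (X p) (E i p) * g p (Y p) (E j p) * christoffel i j k p
            - g p (Y p) (E j p) * g p (X p) (E i p) * christoffel j i k p
          = g p (X p) (E i p) * g p (Y p) (E j p) * structure_coeff i j k p"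
          unfolding christoffel_torsion [OF p k ij, symmetric] by (simp add: algebra_simps)
      qed
      ultimately show "g p (frame_connection M id X Y p - frame_connection M id Y X p) (E k p)
          = g p (field_bracket M X Y p) (E k p)"
        unfolding metric_diff_left [OF M g p tan [OF X Y p] tan [OF Y X p] E_tangent [OF k p]]
          co [OF X p k] co [OF Y p k] bracket_coefficient [OF X Y p k] by linarith
    qed
  next
    fix X Y Z p assume X: "smooth_vector_field M X" and Y: "smooth_vector_field M Y"
      and Z: "smooth_vector_field M Z" and p: "p \<in> pts M"
    note c = smooth_field_coefficient
    have "dir_deriv M p (X p) (\<lambda>q. g q (Y q) (Z q))
        = dir_deriv M p (X p) (\<lambda>q. \<Sum>k\<in>Basis. g q (Y q) (E k q) * g q (Z q) (E k q))"
      by (rule dir_deriv_cong [OF M p])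
        (rule frame_inner [OF _ smooth_field_tangent [OF Y] smooth_field_tangent [OF Z]])
    also have "\<dots> = (\<Sum>k\<in>Basis. dir_deriv M p (X p) (\<lambda>q. g q (Y q) (E k q) * g q (Z q) (E k q)))"
      by (rule dir_deriv_sum [OF M p]) (intro smooth_function_mult c Y Z)
    also have "\<dots> = (\<Sum>k\<in>Basis. dir_deriv M p (X p) (\<lambda>q. g q (Y q) (E k q)) * g p (Z p) (E k p)
        + g p (Y p) (E k p) * dir_deriv M p (X p) (\<lambda>q. g q (Z q) (E k q)))"
      by (intro sum.cong refl dir_deriv_mult [OF M p] c Y Z)
    finally have lhs: "dir_deriv M p (X p) (\<lambda>q. g q (Y q) (Z q)) = \<dots>" .
    define A where "A i j k = g p (X p) (E i p) * g p (Y p) (E j p) * christoffel i j k p * g p (Z p) (E k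
        p)" for i j k
    have 1: "g p (frame_connection M id X Y p) (Z p)
        = (\<Sum>k\<in>Basis. dir_deriv M p (X p) (\<lambda>q. g q (Y q) (E k q)) * g p (Z p) (E k p))
          + (\<Sum>k\<in>Basis. \<Sum>i\<in>Basis. \<Sum>j\<in>Basis. A i j k)"
      unfolding frame_inner [OF p tan [OF X Y p] smooth_field_tangent [OF Z p]] sum.distrib [symmetric]
          A_def
      by (intro sum.cong refl) (simp add: co [OF X p] distrib_right sum_distrib_right)
    have 2: "g p (Y p) (frame_connection M id X Z p)
        = (\<Sum>k\<in>Basis. g p (Y p) (E k p) * dir_deriv M p (X p) (\<lambda>q. g q (Z q) (E k q)))
          + (\<Sum>k\<in>Basis. \<Sum>i\<in>Basis. \<Sum>j\<in>Basis. - A i k j)"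
      unfolding frame_inner [OF p smooth_field_tangent [OF Y p] tan [OF X Z p]] sum.distrib [symmetric]
          A_def
    proof (rule sum.cong [OF refl])
      fix k :: 'e assume k: "k \<in> Basis"
      have "(\<Sum>i\<in>Basis. \<Sum>j\<in>Basis. g p (Y p) (E k p) * (g p (X p) (E i p) * g p (Z p) (E j p) * christoffel i
          j k p))
          = (\<Sum>i\<in>Basis. \<Sum>j\<in>Basis. - (g p (X p) (E i p) * g p (Y p) (E k p) * christoffel i k j p * g p (Z p)
              (E j p)))"
      proof (intro sum.cong refl)
        fix i j :: 'e assume ij: "i \<in> Basis" "j \<in> Basis"
        show "g p (Y p) (E k p) * (g p (X p) (E i p) * g p (Z p) (E j p) * christoffel i j k p)
          = - (g p (X p) (E i p) * g p (Y p) (E k p) * christoffel i k j p * g p (Z p) (E j p))"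
          unfolding christoffel_metric [OF p k ij] by simp
      qed
      then show "g p (Y p) (E k p) * g p (frame_connection M id X Z p) (E k p)
        = g p (Y p) (E k p) * dir_deriv M p (X p) (\<lambda>q. g q (Z q) (E k q))
          + (\<Sum>i\<in>Basis. \<Sum>j\<in>Basis. - (g p (X p) (E i p) * g p (Y p) (E k p) * christoffel i k j p * g p (Z p)
              (E j p)))"
        unfolding co [OF X p k] distrib_left sum_distrib_left by simp
    qed
    have "(\<Sum>k\<in>Basis. \<Sum>i\<in>Basis. \<Sum>j\<in>Basis. A i k j) = (\<Sum>i\<in>Basis. \<Sum>k\<in>Basis. \<Sum>j\<in>Basis. A i k j)"
      by (rule sum.swap)
    also have "\<dots> = (\<Sum>i\<in>Basis. \<Sum>k\<in>Basis. \<Sum>j\<in>Basis. A i j k)"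
      by (rule sum.cong [OF refl]) (rule sum.swap)
    also have "\<dots> = (\<Sum>k\<in>Basis. \<Sum>i\<in>Basis. \<Sum>j\<in>Basis. A i j k)"
      by (rule sum.swap)
    finally have 3: "(\<Sum>k\<in>Basis. \<Sum>i\<in>Basis. \<Sum>j\<in>Basis. A i k j) = (\<Sum>k\<in>Basis. \<Sum>i\<in>Basis. \<Sum>j\<in>Basis. A i j k)" .
    show "dir_deriv M p (X p) (\<lambda>q. g q (Y q) (Z q))
        = g p (frame_connection M id X Y p) (Z p) + g p (Y p) (frame_connection M id X Z p)"
      unfolding lhs 1 2 sum_negf 3 sum.distrib by simp
  qed
qed

lemma levi_civita_unique:
  assumes D: "is_levi_civita M g D" and D': "is_levi_civita M g D'"
    and X: "smooth_vector_field M X" and Y: "smooth_vector_field M Y" and p: "p \<in> pts M"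
  shows "D X Y p = D' X Y p"
proof (rule frame_eqI [OF p])
  show "D X Y p \<in> tangent_space M p" "D' X Y p \<in> tangent_space M p"
    using connection_along_tangent [OF is_levi_civita_connection X Y p] D D' by auto
  show "g p (D X Y p) (E k p) = g p (D' X Y p) (E k p)" if "k \<in> Basis" for k
    using koszul_formula [OF M g D X Y E [OF that] p] koszul_formula [OF M g D' X Y E [OF that] p] by simp
qed

lemma is_levi_civita_levi_civita: "is_levi_civita M g (levi_civita M g)"
  unfolding levi_civita_def by (rule someI [of "is_levi_civita M g", OF is_levi_civita_frame_connection])

lemma is_pullback_frame_connection:
  assumes L: "smooth_manifold L" and s: "smooth_map L M \<phi>"
  shows "is_pullback_connection L M \<phi> (levi_civita M g) (frame_connection L \<phi>)"
  unfolding is_pullback_connection_def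
proof (intro conjI allI impI ballI connection_along_frame_connection [OF L s]; elim conjE)
  fix X V Z p
  assume X: "smooth_vector_field L X" and V: "smooth_vector_field M V" and Z: "smooth_vector_field M Z"
    and p: "p \<in> pts L" and eq: "Z (\<phi> p) = differential L M \<phi> p (X p)"
  note fp = smooth_mapD(3) [OF s p]
  have "levi_civita M g Z V (\<phi> p) = frame_connection M id Z V (\<phi> p)"
    by (rule levi_civita_unique [OF is_levi_civita_levi_civita is_levi_civita_frame_connection Z V fp])
  also have "\<dots> = frame_connection L \<phi> X (\<lambda>q. V (\<phi> q)) p"
    unfolding frame_connection_def
  proof (rule sum.cong [OF refl])
    fix k :: 'e assume k: "k \<in> Basis"
    have "dir_deriv L p (X p) (\<lambda>r. g (\<phi> r) (V (\<phi> r)) (E k (\<phi> r)))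
        = dir_deriv M (\<phi> p) (Z (\<phi> p)) (\<lambda>q. g q (V q) (E k q))"
      unfolding eq by (rule dir_deriv_compose [OF L M s smooth_field_coefficient [OF V k]
          p smooth_field_tangent [OF X p]])
    moreover have "differential M M id (\<phi> p) (Z (\<phi> p)) = differential L M \<phi> p (X p)"
      using differential_id [OF M fp smooth_field_tangent [OF Z fp]] eq by simp
    ultimately show "(dir_deriv M (\<phi> p) (Z (\<phi> p)) (\<lambda>r. g (id r) (V r) (E k (id r))) +
          (\<Sum>i\<in>Basis. \<Sum>j\<in>Basis. g (id (\<phi> p)) (differential M M id (\<phi> p) (Z (\<phi> p))) (E i (id (\<phi> p))) *
             g (id (\<phi> p)) (V (\<phi> p)) (E j (id (\<phi> p))) * christoffel i j k (id (\<phi> p)))) *\<^sub>R E k (id (\<phi> p))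
       = (dir_deriv L p (X p) (\<lambda>r. g (\<phi> r) (V (\<phi> r)) (E k (\<phi> r))) +
          (\<Sum>i\<in>Basis. \<Sum>j\<in>Basis. g (\<phi> p) (differential L M \<phi> p (X p)) (E i (\<phi> p)) *
             g (\<phi> p) (V (\<phi> p)) (E j (\<phi> p)) * christoffel i j k (\<phi> p))) *\<^sub>R E k (\<phi> p)"
      by (simp only: id_apply)
  qed
  finally show "frame_connection L \<phi> X (\<lambda>q. V (\<phi> q)) p = levi_civita M g Z V (\<phi> p)" by simp
qed

lemma is_pullback_connection_levi_civita:
  assumes "smooth_manifold L" "smooth_map L M \<phi>"
  shows "is_pullback_connection L M \<phi> (levi_civita M g) (pullback_connection L M \<phi> (levi_civita M g))"
  unfolding pullback_connection_def
  by (rule someI [of "is_pullback_connection L M \<phi> (levi_civita M g)", OF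
      is_pullback_frame_connection [OF assms]])

end

section \<open>Isometries\<close>

text \<open>An isometry \<open>S\<close> of \<open>M\<close> onto itself with inverse \<open>S'\<close>. Only the values on the points of \<open>M\<close> matter, so
    the
  inverse is part of the data.\<close>

definition riemannian_isometry ::
  "('a, 'e::euclidean_space) manifold \<Rightarrow> ('a, 'e) metric_tensor \<Rightarrow> ('a \<Rightarrow> 'a) \<Rightarrow> ('a \<Rightarrow> 'a) \<Rightarrow> bool" where
  "riemannian_isometry M g S S' \<longleftrightarrow>
     smooth_map M M S \<and> smooth_map M M S' \<and>
     (\<forall>q\<in>pts M. S' (S q) = q \<and> S (S' q) = q) \<and>
     (\<forall>q\<in>pts M. \<forall>u\<in>tangent_space M q. \<forall>v\<in>tangent_space M q.
        g (S q) (differential M M S q u) (differential M M S q v) = g q u v)"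

text \<open>The push-forward of a vector field by a diffeomorphism \<open>S\<close> with inverse \<open>S'\<close>.\<close>

definition push_field ::
  "('a, 'e::euclidean_space) manifold \<Rightarrow> ('a \<Rightarrow> 'a) \<Rightarrow> ('a \<Rightarrow> 'a) \<Rightarrow> ('a \<Rightarrow> ('a, 'e) tangent)
     \<Rightarrow> 'a \<Rightarrow> ('a, 'e) tangent" where
  "push_field M S S' X q = differential M M S (S' q) (X (S' q))"

lemma riemannian_isometryD:
  assumes "riemannian_isometry M g S S'"
  shows "smooth_map M M S" "smooth_map M M S'"
    "q \<in> pts M \<Longrightarrow> S' (S q) = q" "q \<in> pts M \<Longrightarrow> S (S' q) = q"
    "q \<in> pts M \<Longrightarrow> u \<in> tangent_space M q \<Longrightarrow> v \<in> tangent_space M q \<Longrightarrow>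
        g (S q) (differential M M S q u) (differential M M S q v) = g q u v"
  using assms unfolding riemannian_isometry_def by blast+

lemma smooth_push_field:
  assumes M: "smooth_manifold M" and S: "riemannian_isometry M g S S'" and X: "smooth_vector_field M X"
  shows "smooth_vector_field M (push_field M S S' X)"
proof -
  note s = riemannian_isometryD [OF S]
  have "smooth_section M M (\<lambda>q. S (S' q)) (\<lambda>q. differential M M S (S' q) (X (S' q)))"
    by (rule smooth_section_compose [OF M M M s(2) s(1) smooth_section_differential [OF M M s(1) X]])
  then show ?thesis
    by (rule smooth_section_cong [OF M]) (simp_all add: s(4) push_field_def)
qed

lemma push_field_at:
  assumes "riemannian_isometry M g S S'" "q \<in> pts M"
  shows "push_field M S S' X (S q) = differential M M S q (X q)"
  by (simp add: push_field_def riemannian_isometryD(3) [OF assms])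

lemma orthonormal_at_push_field:
  assumes M: "smooth_manifold M" and S: "riemannian_isometry M g S S'" and p: "p \<in> pts M"
    and A: "orthonormal_at M g p A"
  shows "orthonormal_at M g (S p) (\<lambda>i. push_field M S S' (A i))"
  unfolding orthonormal_at_def
proof (intro conjI ballI)
  show "smooth_vector_field M (push_field M S S' (A i))" if "i \<in> Basis" for i
    by (rule smooth_push_field [OF M S orthonormal_atD(1) [OF A that]])
  show "g (S p) (push_field M S S' (A i) (S p)) (push_field M S S' (A j) (S p)) = (if i = j then 1 else 0)"
    if "i \<in> Basis" "j \<in> Basis" for i j
    unfolding push_field_at [OF S p]
      riemannian_isometryD(5) [OF S p smooth_field_tangent [OF orthonormal_atD(1) [OF A that(1)] p]
        smooth_field_tangent [OF orthonormal_atD(1) [OF A that(2)] p]]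
    by (rule orthonormal_atD(2) [OF A that])
qed

lemma koszul_push_field:
  assumes M: "smooth_manifold M" and g: "riemannian_metric M g" and S: "riemannian_isometry M g S S'"
    and X: "smooth_vector_field M X" and Y: "smooth_vector_field M Y" and Z: "smooth_vector_field M Z"
    and p: "p \<in> pts M"
  shows "koszul M g (push_field M S S' X) (push_field M S S' Y) (push_field M S S' Z) (S p)
      = koszul M g X Y Z p"
proof -
  note s = riemannian_isometryD [OF S] and sm = smooth_push_field [OF M S] and t = smooth_field_tangent
  have d: "dir_deriv M (S p) (push_field M S S' U (S p)) (\<lambda>q. g q (push_field M S S' V q) (push_field M S S'
      W q))
      = dir_deriv M p (U p) (\<lambda>q. g q (V q) (W q))"
    if U: "smooth_vector_field M U" and V: "smooth_vector_field M V"
        and W: "smooth_vector_field M W" for U V W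
  proof -
    have f: "smooth_function M (\<lambda>q. g q (push_field M S S' V q) (push_field M S S' W q))"
      using smooth_function_metric [OF M M g smooth_map_id [OF M] sm [OF V] sm [OF W]] by simp
    have "dir_deriv M (S p) (push_field M S S' U (S p)) (\<lambda>q. g q (push_field M S S' V q) (push_field M S S'
        W q))
        = dir_deriv M p (U p) (\<lambda>q. g (S q) (push_field M S S' V (S q)) (push_field M S S' W (S q)))"
      unfolding push_field_at [OF S p] by (rule dir_deriv_compose [OF M M s(1) f p t [OF U p], symmetric])
    also have "\<dots> = dir_deriv M p (U p) (\<lambda>q. g q (V q) (W q))"
      by (rule dir_deriv_cong [OF M p]) (simp only: push_field_at [OF S] s(5) t [OF V] t [OF W])
    finally show ?thesis .
  qed
  have b: "g (S p) (field_bracket M (push_field M S S' U) (push_field M S S' V) (S p)) (push_field M S S' W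
      (S p))
      = g p (field_bracket M U V p) (W p)"
    if U: "smooth_vector_field M U" and V: "smooth_vector_field M V"
        and W: "smooth_vector_field M W" for U V W
  proof -
    have "field_bracket M (push_field M S S' U) (push_field M S S' V) (S p)
        = differential M M S p (field_bracket M U V p)"
      by (rule field_bracket_related [OF M M s(1) U V sm [OF U] sm [OF V] _ _ p])
        (rule push_field_at [OF S], assumption)+
    then show ?thesis
      unfolding push_field_at [OF S p] using s(5) [OF p field_bracket_tangent [OF M U V] t [OF W p]] by simp
  qed
  show ?thesis
    unfolding koszul_def by (simp only: d b X Y Z)
qed

context framed_manifold
begin

lemma orthonormal_at_frame: "p \<in> pts M \<Longrightarrow> orthonormal_at M g p E"
  using E E_orthonormal by (simp add: orthonormal_at_def)

lemma connection_along_levi_civita: "connection_along M M id (levi_civita M g)"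
  by (rule is_levi_civita_connection [OF is_levi_civita_levi_civita])

lemma levi_civita_tangent:
  assumes "smooth_vector_field M X" "smooth_vector_field M Y" "p \<in> pts M"
  shows "levi_civita M g X Y p \<in> tangent_space M p"
  using connection_along_tangent [OF connection_along_levi_civita assms] by simp

text \<open>Isometries preserve the Levi-Civita connection, since they preserve all terms of Koszul's formula.\<close>

lemma levi_civita_push_field:
  assumes S: "riemannian_isometry M g S S'"
    and X: "smooth_vector_field M X" and Y: "smooth_vector_field M Y" and p: "p \<in> pts M"
  shows "levi_civita M g (push_field M S S' X) (push_field M S S' Y) (S p)
    = differential M M S p (levi_civita M g X Y p)"
proof -
  note s = riemannian_isometryD [OF S] and sm = smooth_push_field [OF M S]
  note sp = smooth_mapD(3) [OF s(1) p]
  note on = orthonormal_atD [OF orthonormal_at_push_field [OF M S p orthonormal_at_frame [OF p]]]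
  note lc = is_levi_civita_levi_civita and t = levi_civita_tangent
  show ?thesis
  proof (rule orthonormal_eqI [OF M g sp smooth_field_tangent [OF on(1) sp] on(2) t [OF sm [OF X] sm [OF Y]
      sp]
        differential_tangent [OF M M s(1) p]])
    fix k :: 'e assume k: "k \<in> Basis"
    have "2 * g (S p) (levi_civita M g (push_field M S S' X) (push_field M S S' Y) (S p)) (push_field M S S'
        (E k) (S p))
        = koszul M g X Y (E k) p"
      unfolding koszul_formula [OF M g lc sm [OF X] sm [OF Y] sm [OF E [OF k]] sp]
      by (rule koszul_push_field [OF M g S X Y E [OF k] p])
    also have "\<dots> = 2 * g p (levi_civita M g X Y p) (E k p)"
      by (rule koszul_formula [OF M g lc X Y E [OF k] p, symmetric])
    also have "g p (levi_civita M g X Y p) (E k p)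
        = g (S p) (differential M M S p (levi_civita M g X Y p)) (push_field M S S' (E k) (S p))"
      unfolding push_field_at [OF S p] by (rule s(5) [OF p t [OF X Y p] E_tangent [OF k p], symmetric])
    finally show "g (S p) (levi_civita M g (push_field M S S' X) (push_field M S S' Y) (S p)) (push_field M
        S S' (E k) (S p))
      = g (S p) (differential M M S p (levi_civita M g X Y p)) (push_field M S S' (E k) (S p))" by simp
  qed
qed

end

section \<open>The second fundamental form\<close>

text \<open>A smooth map between Riemannian manifolds with global orthonormal frames.\<close>

locale framed_map = dom: framed_manifold M g E + cod: framed_manifold N h F
  for M :: "('a, 'e::euclidean_space) manifold" and g :: "('a, 'e) metric_tensor"
    and E :: "'e \<Rightarrow> 'a \<Rightarrow> ('a, 'e) tangent"
    and N :: "('b, 'f::euclidean_space) manifold" and h :: "('b, 'f) metric_tensor"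
    and F :: "'f \<Rightarrow> 'b \<Rightarrow> ('b, 'f) tangent" +
  fixes \<phi> :: "'a \<Rightarrow> 'b"
  assumes smooth: "smooth_map M N \<phi>"
begin

text \<open>The Levi-Civita connections of domain and codomain, the pull-back connection, the differential and
  the second fundamental form of the map.\<close>

abbreviation "D \<equiv> levi_civita M g"
abbreviation "D' \<equiv> levi_civita N h"
abbreviation "P \<equiv> pullback_connection M N \<phi> D'"
abbreviation "d\<phi> \<equiv> differential M N \<phi>"
abbreviation "II \<equiv> second_fundamental_form M g N h \<phi>"

lemmas M = dom.M and N = cod.M

lemma \<phi>_point: "p \<in> pts M \<Longrightarrow> \<phi> p \<in> pts N"
  by (rule smooth_mapD(3) [OF smooth])

lemma D_conn: "connection_along M M id D"
  by (rule dom.connection_along_levi_civita)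

lemma P_pullback: "is_pullback_connection M N \<phi> D' P"
  by (rule cod.is_pullback_connection_levi_civita [OF M smooth])

lemma P_conn: "connection_along M N \<phi> P"
  using P_pullback by (simp add: is_pullback_connection_def)

lemma P_pullback_eq:
  assumes "smooth_vector_field M X" "smooth_vector_field N V" "smooth_vector_field N Z" "p \<in> pts M"
    "Z (\<phi> p) = d\<phi> p (X p)"
  shows "P X (\<lambda>q. V (\<phi> q)) p = D' Z V (\<phi> p)"
proof -
  note c = conjunct2 [OF P_pullback [unfolded is_pullback_connection_def]]
  from c [THEN spec, of X, THEN spec, of V, THEN spec, of Z] assms show ?thesis by blast
qed

lemma smooth_d\<phi>: "smooth_vector_field M X \<Longrightarrow> smooth_section M N \<phi> (\<lambda>q. d\<phi> q (X q))"
  by (rule smooth_section_differential [OF M N smooth])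

lemma II_tangent:
  assumes "smooth_vector_field M X" "smooth_vector_field M Y" "p \<in> pts M"
  shows "II X Y p \<in> tangent_space N (\<phi> p)"
  unfolding second_fundamental_form_def
  by (intro tangent_diff [OF N] connection_along_tangent [OF P_conn] smooth_d\<phi> assms
      differential_tangent [OF M N smooth])

lemma II_cong:
  assumes X: "smooth_vector_field M X" and Y: "smooth_vector_field M Y" and p: "p \<in> pts M"
    and eqX: "\<And>q. q \<in> pts M \<Longrightarrow> X q = X' q" and eqY: "\<And>q. q \<in> pts M \<Longrightarrow> Y q = Y' q"
  shows "II X Y p = II X' Y' p"
proof -
  have X': "smooth_vector_field M X'" by (rule smooth_section_cong [OF M X _ eqX]) simp
  have "P X (\<lambda>q. d\<phi> q (Y q)) p = P X' (\<lambda>q. d\<phi> q (Y q)) p"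
    by (rule connection_along_cong_direction [OF M P_conn p X smooth_d\<phi> [OF Y] eqX])
  also have "\<dots> = P X' (\<lambda>q. d\<phi> q (Y' q)) p"
    by (rule connection_along_cong [OF M P_conn p X' smooth_d\<phi> [OF Y]]) (simp only: eqY)
  finally have 1: "P X (\<lambda>q. d\<phi> q (Y q)) p = P X' (\<lambda>q. d\<phi> q (Y' q)) p" .
  have "D X Y p = D X' Y p"
    by (rule connection_along_cong_direction [OF M D_conn p X Y eqX])
  also have "\<dots> = D X' Y' p"
    by (rule connection_along_cong [OF M D_conn p X' Y eqY])
  finally have 2: "D X Y p = D X' Y' p" .
  show ?thesis unfolding second_fundamental_form_def 1 2 ..
qed

lemma d\<phi>_combination:
  "p \<in> pts M \<Longrightarrow> d\<phi> p (\<Sum>i\<in>I. r i *\<^sub>R v i) = (\<Sum>i\<in>I. r i *\<^sub>R d\<phi> p (v i))"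
  by (simp only: differential_sum [OF M smooth] differential_scaleR [OF M smooth])

lemma II_sum_left:
  assumes p: "p \<in> pts M" and Y: "smooth_vector_field M Y"
    and f: "\<And>i. i \<in> I \<Longrightarrow> smooth_function M (f i)" and X: "\<And>i. i \<in> I \<Longrightarrow> smooth_vector_field M (X i)"
  shows "II (\<lambda>q. \<Sum>i\<in>I. f i q *\<^sub>R X i q) Y p = (\<Sum>i\<in>I. f i p *\<^sub>R II (X i) Y p)"
proof -
  have "P (\<lambda>q. \<Sum>i\<in>I. f i q *\<^sub>R X i q) (\<lambda>q. d\<phi> q (Y q)) p = (\<Sum>i\<in>I. f i p *\<^sub>R P (X i) (\<lambda>q. d\<phi> q (Y q)) p)"
    by (rule connection_along_sum_direction [OF M N smooth P_conn p smooth_d\<phi> [OF Y] f X])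
  moreover have "D (\<lambda>q. \<Sum>i\<in>I. f i q *\<^sub>R X i q) Y p = (\<Sum>i\<in>I. f i p *\<^sub>R D (X i) Y p)"
    by (rule connection_along_sum_direction [OF M M smooth_map_id [OF M] D_conn p Y f X])
  ultimately show ?thesis
    unfolding second_fundamental_form_def
        by (simp only: d\<phi>_combination [OF p] sum_subtractf scaleR_diff_right)
qed

lemma II_sum_right:
  assumes p: "p \<in> pts M" and X: "smooth_vector_field M X"
    and f: "\<And>i. i \<in> I \<Longrightarrow> smooth_function M (f i)" and Y: "\<And>i. i \<in> I \<Longrightarrow> smooth_vector_field M (Y i)"
  shows "II X (\<lambda>q. \<Sum>i\<in>I. f i q *\<^sub>R Y i q) p = (\<Sum>i\<in>I. f i p *\<^sub>R II X (Y i) p)"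
proof -
  have sm: "smooth_vector_field M (\<lambda>q. \<Sum>i\<in>I. f i q *\<^sub>R Y i q)"
    by (intro smooth_section_sum [OF M M smooth_map_id [OF M]] smooth_section_scaleR [OF M M] f Y)
  have "P X (\<lambda>q. d\<phi> q (\<Sum>i\<in>I. f i q *\<^sub>R Y i q)) p = P X (\<lambda>q. \<Sum>i\<in>I. f i q *\<^sub>R d\<phi> q (Y i q)) p"
    by (rule connection_along_cong [OF M P_conn p X smooth_d\<phi> [OF sm] d\<phi>_combination])
  also have "\<dots> = (\<Sum>i\<in>I. dir_deriv M p (X p) (f i) *\<^sub>R d\<phi> p (Y i p) + f i p *\<^sub>R P X (\<lambda>q. d\<phi> q (Y i q)) p)"
    by (rule connection_along_sum [OF M N smooth P_conn p X f smooth_d\<phi> [OF Y]])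
  finally have 1: "P X (\<lambda>q. d\<phi> q (\<Sum>i\<in>I. f i q *\<^sub>R Y i q)) p = \<dots>" .
  have "D X (\<lambda>q. \<Sum>i\<in>I. f i q *\<^sub>R Y i q) p
      = (\<Sum>i\<in>I. dir_deriv M p (X p) (f i) *\<^sub>R Y i p + f i p *\<^sub>R D X (Y i) p)"
    by (rule connection_along_sum [OF M M smooth_map_id [OF M] D_conn p X f Y])
  then have 2: "d\<phi> p (D X (\<lambda>q. \<Sum>i\<in>I. f i q *\<^sub>R Y i q) p)
      = (\<Sum>i\<in>I. dir_deriv M p (X p) (f i) *\<^sub>R d\<phi> p (Y i p) + f i p *\<^sub>R d\<phi> p (D X (Y i) p))"
    by (simp only: sum.distrib differential_add [OF M smooth p] d\<phi>_combination [OF p])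
  show ?thesis
    unfolding second_fundamental_form_def 1 2 sum_subtractf [symmetric]
        by (simp only: add_diff_cancel_left scaleR_diff_right)
qed

lemma II_expansion:
  assumes p: "p \<in> pts M" and X: "smooth_vector_field M X" and Y: "smooth_vector_field M Y"
  shows "II X Y p = (\<Sum>k\<in>Basis. \<Sum>l\<in>Basis. (g p (X p) (E k p) * g p (Y p) (E l p)) *\<^sub>R II (E k) (E l) p)"
proof -
  note c = dom.smooth_field_coefficient and Et = dom.E
  have "II X Y p = II (\<lambda>q. \<Sum>k\<in>Basis. g q (X q) (E k q) *\<^sub>R E k q) (\<lambda>q. \<Sum>k\<in>Basis. g q (Y q) (E k q) *\<^sub>R E k
      q) p"
    by (rule II_cong [OF X Y p]) (intro dom.frame_expansion [symmetric] smooth_field_tangent [OF X]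
        smooth_field_tangent [OF Y], assumption+)+
  also have "\<dots> = (\<Sum>k\<in>Basis. g p (X p) (E k p) *\<^sub>R II (E k) (\<lambda>q. \<Sum>k\<in>Basis. g q (Y q) (E k q) *\<^sub>R E k q) p)"
    by (rule II_sum_left [OF p])
      (intro smooth_section_sum [OF M M smooth_map_id [OF M]] smooth_section_scaleR [OF M M]
          c X Y Et, assumption+)+
  also have "\<dots> = (\<Sum>k\<in>Basis. g p (X p) (E k p) *\<^sub>R (\<Sum>l\<in>Basis. g p (Y p) (E l p) *\<^sub>R II (E k) (E l) p))"
    by (intro sum.cong refl arg_cong [of _ _ "\<lambda>v. _ *\<^sub>R v"] II_sum_right [OF p] c Y Et)
  finally show ?thesis by (simp only: scaleR_sum_right scaleR_scaleR)
qed

text \<open>The trace of the second fundamental form does not depend on the orthonormal basis.\<close>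

lemma II_trace:
  assumes p: "p \<in> pts M" and A: "orthonormal_at M g p A"
  shows "(\<Sum>i\<in>Basis. II (A i) (A i) p) = (\<Sum>k\<in>Basis. II (E k) (E k) p)"
proof -
  have At: "A i p \<in> tangent_space M p" if "i \<in> Basis" for i
    by (rule smooth_field_tangent [OF orthonormal_atD(1) [OF A that] p])
  have orth: "(\<Sum>i\<in>Basis. g p (A i p) (E k p) * g p (A i p) (E l p)) = (if k = l then 1 else 0)"
    if k: "k \<in> Basis" and l: "l \<in> Basis" for k l
  proof -
    note Ek = dom.E_tangent [OF k p] and El = dom.E_tangent [OF l p]
    have "(if k = l then 1 else 0) = g p (E k p) (E l p)" using dom.E_orthonormal [OF p k l] by simp
    also have "\<dots> = g p (\<Sum>i\<in>Basis. g p (E k p) (A i p) *\<^sub>R A i p) (E l p)"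
      by (rule arg_cong [of _ _ "\<lambda>v. g p v (E l p)"])
        (rule orthonormal_expansion [OF M dom.g p At orthonormal_atD(2) [OF A] Ek])
    also have "\<dots> = (\<Sum>i\<in>Basis. g p (E k p) (A i p) * g p (A i p) (E l p))"
      by (rule metric_sum_left [OF M dom.g p El]) (rule At)
    also have "\<dots> = (\<Sum>i\<in>Basis. g p (A i p) (E k p) * g p (A i p) (E l p))"
      by (intro sum.cong refl arg_cong [of _ _ "\<lambda>r. r * _"] riemannian_metricD(1) [OF dom.g p Ek At])
    finally show ?thesis by simp
  qed
  have "(\<Sum>i\<in>Basis. II (A i) (A i) p) = (\<Sum>i\<in>Basis. \<Sum>k\<in>Basis. \<Sum>l\<in>Basis.
      (g p (A i p) (E k p) * g p (A i p) (E l p)) *\<^sub>R II (E k) (E l) p)"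
    by (intro sum.cong refl II_expansion [OF p] orthonormal_atD(1) [OF A])
  also have "\<dots> = (\<Sum>k\<in>Basis. \<Sum>i\<in>Basis. \<Sum>l\<in>Basis.
      (g p (A i p) (E k p) * g p (A i p) (E l p)) *\<^sub>R II (E k) (E l) p)"
    by (rule sum.swap)
  also have "\<dots> = (\<Sum>k\<in>Basis. \<Sum>l\<in>Basis. \<Sum>i\<in>Basis.
      (g p (A i p) (E k p) * g p (A i p) (E l p)) *\<^sub>R II (E k) (E l) p)"
    by (rule sum.cong [OF refl]) (rule sum.swap)
  also have "\<dots> = (\<Sum>k\<in>Basis. \<Sum>l\<in>Basis. if l = k then II (E k) (E l) p else 0)"
    by (intro sum.cong refl) (simp only: scaleR_sum_left [symmetric] orth, simp)
  also have "\<dots> = (\<Sum>k\<in>Basis. II (E k) (E k) p)"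
    by (intro sum.cong refl) simp
  finally show ?thesis .
qed

text \<open>The second fundamental form of a map that intertwines an isometry of the domain with one of the
  codomain is preserved by these isometries.\<close>

lemma II_push_field:
  assumes S: "riemannian_isometry M g S S'" and T: "riemannian_isometry N h T T'"
    and ST: "\<And>q. q \<in> pts M \<Longrightarrow> \<phi> (S q) = T (\<phi> q)"
    and X: "smooth_vector_field M X" and Y: "smooth_vector_field M Y" and p: "p \<in> pts M"
  shows "II (push_field M S S' X) (push_field M S S' Y) (S p) = differential N N T (\<phi> p) (II X Y p)"
proof -
  note s = riemannian_isometryD [OF S] and t = riemannian_isometryD [OF T]
  note sm = smooth_push_field [OF M S] and tm = smooth_push_field [OF N T]
  note sp = smooth_mapD(3) [OF s(1)] and tan = smooth_field_tangent
  let ?X = "push_field M S S' X" and ?Y = "push_field M S S' Y"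
  let ?dT = "differential N N T"
  have chain: "d\<phi> (S q) (differential M M S q v) = ?dT (\<phi> q) (d\<phi> q v)"
    if q: "q \<in> pts M" and v: "v \<in> tangent_space M q" for q v
  proof -
    have "d\<phi> (S q) (differential M M S q v) = differential M N (\<phi> \<circ> S) q v"
      by (rule differential_compose [OF M M N s(1) smooth q v, symmetric])
    also have "\<dots> = differential M N (T \<circ> \<phi>) q v"
      by (rule differential_cong [OF M q]) (simp add: ST)
    also have "\<dots> = ?dT (\<phi> q) (d\<phi> q v)"
      by (rule differential_compose [OF M N N smooth t(1) q v])
    finally show ?thesis .
  qed
  note fp = \<phi>_point [OF p]
  have dT_comb: "?dT (\<phi> p) (\<Sum>j\<in>Basis. a j *\<^sub>R u j + b j *\<^sub>R v j)
      = (\<Sum>j\<in>Basis. a j *\<^sub>R ?dT (\<phi> p) (u j) + b j *\<^sub>R ?dT (\<phi> p) (v j))" for a b :: "'f \<Rightarrow> real" and u v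
    by (simp only: differential_sum [OF N t(1) fp] differential_add [OF N t(1) fp]
        differential_scaleR [OF N t(1) fp])
  have 1: "d\<phi> (S p) (D ?X ?Y (S p)) = ?dT (\<phi> p) (d\<phi> p (D X Y p))"
    unfolding dom.levi_civita_push_field [OF S X Y p]
    by (rule chain [OF p dom.levi_civita_tangent [OF X Y p]])
  define w where "w j q = h (\<phi> q) (d\<phi> q (Y q)) (F j (\<phi> q))" for j q
  have w: "smooth_function M (w j)" if "j \<in> Basis" for j
    unfolding w_def by (rule cod.smooth_coefficient [OF M smooth smooth_d\<phi> [OF Y] that])
  have w': "smooth_function M (\<lambda>q. w j (S' q))" if "j \<in> Basis" for j
    by (rule smooth_function_compose [OF M M s(2) w [OF that]])
  have exp: "d\<phi> q (Y q) = (\<Sum>j\<in>Basis. w j q *\<^sub>R F j (\<phi> q))" if q: "q \<in> pts M" for q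
    unfolding w_def by (rule cod.frame_expansion [symmetric, OF \<phi>_point [OF q]
        differential_tangent [OF M N smooth q]])
  have exp': "d\<phi> q (?Y q) = (\<Sum>j\<in>Basis. w j (S' q) *\<^sub>R push_field N T T' (F j) (\<phi> q))" if q: "q \<in> pts M" for
      q
  proof -
    define r where "r = S' q"
    have r: "r \<in> pts M" "S r = q" unfolding r_def using smooth_mapD(3) [OF s(2) q] s(4) [OF q] by auto
    have "d\<phi> (S r) (?Y (S r)) = ?dT (\<phi> r) (d\<phi> r (Y r))"
      unfolding push_field_at [OF S r(1)] by (rule chain [OF r(1) tan [OF Y r(1)]])
    also have "\<dots> = (\<Sum>j\<in>Basis. w j r *\<^sub>R ?dT (\<phi> r) (F j (\<phi> r)))"
      unfolding exp [OF r(1)]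
      by (simp only: differential_sum [OF N t(1) \<phi>_point [OF r(1)]]
          differential_scaleR [OF N t(1) \<phi>_point [OF r(1)]])
    also have "\<dots> = (\<Sum>j\<in>Basis. w j r *\<^sub>R push_field N T T' (F j) (\<phi> (S r)))"
      by (simp only: ST [OF r(1)] push_field_at [OF T \<phi>_point [OF r(1)]])
    finally show ?thesis by (simp only: r(2)) (simp only: r_def)
  qed
  define Z where "Z y = (\<Sum>k\<in>Basis. h (\<phi> p) (d\<phi> p (X p)) (F k (\<phi> p)) *\<^sub>R F k y)" for y
  have Z: "smooth_vector_field N Z"
    unfolding Z_def [abs_def]
    by (intro smooth_section_sum [OF N N smooth_map_id [OF N]] smooth_section_scaleR [OF N N]
        smooth_function_const [OF N] cod.E)
  have Zp: "Z (\<phi> p) = d\<phi> p (X p)"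
    unfolding Z_def by (rule cod.frame_expansion [OF fp differential_tangent [OF M N smooth p]])
  have PF: "P X (\<lambda>q. F j (\<phi> q)) p = D' Z (F j) (\<phi> p)" if "j \<in> Basis" for j
    by (rule P_pullback_eq [OF X cod.E [OF that] Z p Zp])
  have PF': "P ?X (\<lambda>q. push_field N T T' (F j) (\<phi> q)) (S p)
      = ?dT (\<phi> p) (D' Z (F j) (\<phi> p))" if j: "j \<in> Basis" for j
  proof -
    have "push_field N T T' Z (\<phi> (S p)) = d\<phi> (S p) (?X (S p))"
      unfolding ST [OF p] push_field_at [OF T fp] push_field_at [OF S p] Zp
      by (rule chain [OF p tan [OF X p], symmetric])
    then have "P ?X (\<lambda>q. push_field N T T' (F j) (\<phi> q)) (S p)
        = D' (push_field N T T' Z) (push_field N T T' (F j)) (\<phi> (S p))"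
      by (rule P_pullback_eq [OF sm [OF X] tm [OF cod.E [OF j]] tm [OF Z] sp [OF p]])
    also have "\<dots> = ?dT (\<phi> p) (D' Z (F j) (\<phi> p))"
      unfolding ST [OF p] by (rule cod.levi_civita_push_field [OF T Z cod.E [OF j] fp])
    finally show ?thesis .
  qed
  have "P X (\<lambda>q. d\<phi> q (Y q)) p = P X (\<lambda>q. \<Sum>j\<in>Basis. w j q *\<^sub>R F j (\<phi> q)) p"
    by (rule connection_along_cong [OF M P_conn p X smooth_d\<phi> [OF Y] exp])
  also have "\<dots> = (\<Sum>j\<in>Basis. dir_deriv M p (X p) (w j) *\<^sub>R F j (\<phi> p) + w j p *\<^sub>R P X (\<lambda>q. F j (\<phi> q)) p)"
    by (rule connection_along_sum [OF M N smooth P_conn p X w cod.section_along_frame [OF M smooth]])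
  also have "\<dots> = (\<Sum>j\<in>Basis. dir_deriv M p (X p) (w j) *\<^sub>R F j (\<phi> p) + w j p *\<^sub>R D' Z (F j) (\<phi> p))"
    by (rule sum.cong [OF refl]) (simp only: PF)
  finally have P1: "P X (\<lambda>q. d\<phi> q (Y q)) p = \<dots>" .
  have dw: "dir_deriv M (S p) (?X (S p)) (\<lambda>q. w j (S' q))
      = dir_deriv M p (X p) (w j)" if j: "j \<in> Basis" for j
  proof -
    have "dir_deriv M (S p) (?X (S p)) (\<lambda>q. w j (S' q)) = dir_deriv M p (X p) (\<lambda>q. w j (S' (S q)))"
      unfolding push_field_at [OF S p]
      by (rule dir_deriv_compose [OF M M s(1) w' [OF j] p tan [OF X p], symmetric])
    also have "\<dots> = dir_deriv M p (X p) (w j)"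
      by (rule dir_deriv_cong [OF M p]) (simp only: s(3))
    finally show ?thesis .
  qed
  have secT: "smooth_section M N \<phi> (\<lambda>q. push_field N T T' (F j) (\<phi> q))" if j: "j \<in> Basis" for j
    using smooth_section_compose [OF M N N smooth smooth_map_id [OF N] tm [OF cod.E [OF j]]] by simp
  have "P ?X (\<lambda>q. d\<phi> q (?Y q)) (S p)
      = P ?X (\<lambda>q. \<Sum>j\<in>Basis. w j (S' q) *\<^sub>R push_field N T T' (F j) (\<phi> q)) (S p)"
    by (rule connection_along_cong [OF M P_conn sp [OF p] sm [OF X] smooth_d\<phi> [OF sm [OF Y]] exp'])
  also have "\<dots> = (\<Sum>j\<in>Basis. dir_deriv M (S p) (?X (S p)) (\<lambda>q. w j (S' q)) *\<^sub>R push_field N T T' (F j) (\<phi> (S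
      p))
      + w j (S' (S p)) *\<^sub>R P ?X (\<lambda>q. push_field N T T' (F j) (\<phi> q)) (S p))"
    by (rule connection_along_sum [OF M N smooth P_conn sp [OF p] sm [OF X] w' secT])
  also have "\<dots> = (\<Sum>j\<in>Basis. dir_deriv M p (X p) (w j) *\<^sub>R ?dT (\<phi> p) (F j (\<phi> p))
      + w j p *\<^sub>R ?dT (\<phi> p) (D' Z (F j) (\<phi> p)))"
    by (rule sum.cong [OF refl]) (simp only: PF' dw s(3) [OF p] ST [OF p] push_field_at [OF T fp])
  also have "\<dots> = ?dT (\<phi> p) (P X (\<lambda>q. d\<phi> q (Y q)) p)"
    unfolding P1 dT_comb ..
  finally have 2: "P ?X (\<lambda>q. d\<phi> q (?Y q)) (S p) = ?dT (\<phi> p) (P X (\<lambda>q. d\<phi> q (Y q)) p)" .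
  have "?dT (\<phi> p) (u - v) = ?dT (\<phi> p) u - ?dT (\<phi> p) v" for u v
    using differential_add [OF N t(1) fp, of "u - v" v] by (simp only: diff_add_cancel eq_diff_eq)
  then show ?thesis
    unfolding second_fundamental_form_def 1 2 by simp
qed

text \<open>Push the orthonormal family that defines the trace forward by \<open>S\<close>: the trace does not change, but each
  summand is mapped to its negative.\<close>

theorem tension_field_eq_0_of_symmetry:
  assumes S: "riemannian_isometry M g S S'" and T: "riemannian_isometry N h T T'"
    and ST: "\<And>q. q \<in> pts M \<Longrightarrow> \<phi> (S q) = T (\<phi> q)" and p: "p \<in> pts M"
    and fix_S: "S p = p"
    and dT: "\<And>v. v \<in> tangent_space N (\<phi> p) \<Longrightarrow> differential N N T (\<phi> p) v = - v"
  shows "tension_field M g N h \<phi> p = 0"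
proof -
  define A where "A = (SOME A. orthonormal_at M g p A)"
  have A: "orthonormal_at M g p A"
    unfolding A_def by (rule someI [of "orthonormal_at M g p", OF dom.orthonormal_at_frame [OF p]])
  let ?t = "\<Sum>i\<in>Basis. II (A i) (A i) p"
  have "?t = (\<Sum>i\<in>Basis. II (push_field M S S' (A i)) (push_field M S S' (A i)) p)"
    unfolding II_trace [OF p A] II_trace [OF p orthonormal_at_push_field [OF M S p A, unfolded fix_S]] ..
  also have "\<dots> = (\<Sum>i\<in>Basis. - II (A i) (A i) p)"
  proof (rule sum.cong [OF refl])
    fix i :: 'e assume "i \<in> Basis"
    note Ai = orthonormal_atD(1) [OF A this]
    show "II (push_field M S S' (A i)) (push_field M S S' (A i)) p = - II (A i) (A i) p"
      using II_push_field [OF S T ST Ai Ai p] dT [OF II_tangent [OF Ai Ai p]] by (simp only: fix_S)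
  qed
  finally have neg: "?t = - ?t" by (simp only: sum_negf)
  have "2 *\<^sub>R ?t = ?t + ?t" by (rule scaleR_2)
  also have "\<dots> = ?t + - ?t" by (rule arg_cong [OF neg])
  finally have "?t = 0" by (simp only: add.right_inverse scaleR_eq_0_iff) simp
  then show ?thesis unfolding tension_field_def Let_def A_def .
qed

end

section \<open>Maps into product manifolds\<close>

lemma smooth_map_const:
  assumes M: "smooth_manifold M" and N: "smooth_manifold N" and a: "a \<in> pts N"
  shows "smooth_map M N (\<lambda>q. a)"
  unfolding smooth_map_def
proof (intro conjI ballI)
  show "continuous_map (man_top M) (man_top N) (\<lambda>q. a)" using a by simp
  fix c d assume c: "c \<in> man_atlas M" and d: "d \<in> man_atlas N"
  have "open (snd c ` {p \<in> fst c. a \<in> fst d})"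
    using smooth_manifold_chart(4) [OF M c] by (cases "a \<in> fst d") auto
  from smooth_on_const [OF this]
  show "smooth_on (snd c ` {p \<in> fst c. a \<in> fst d}) (snd d \<circ> (\<lambda>q. a) \<circ> chart_inv c)"
    by (simp add: o_def)
qed

text \<open>The chart of a product manifold that is given by charts of the factors.\<close>

definition prod_chart :: "('a, 'e) chart \<Rightarrow> ('b, 'f) chart \<Rightarrow> ('a \<times> 'b, 'e \<times> 'f) chart" where
  "prod_chart c d = (fst c \<times> fst d, map_prod (snd c) (snd d))"

lemma prod_chart_atlas:
  "c \<in> man_atlas M \<Longrightarrow> d \<in> man_atlas N \<Longrightarrow> prod_chart c d \<in> man_atlas (prod_manifold M N)"
  unfolding prod_manifold_def prod_chart_def by (simp del: split_paired_Ex) blast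

lemma prod_chart_inv:
  assumes M: "smooth_manifold M" and N: "smooth_manifold N"
    and c: "c \<in> man_atlas M" and d: "d \<in> man_atlas N" and p: "p \<in> fst c" "q \<in> fst d"
  shows "chart_inv (prod_chart c d) (snd c p, snd d q) = (p, q)"
proof -
  have "inj_on (map_prod (snd c) (snd d)) (fst c \<times> fst d)"
    by (rule map_prod_inj_on [OF smooth_manifold_chart(3) [OF M c] smooth_manifold_chart(3) [OF N d]])
  from inv_into_f_f [OF this, of "(p, q)"] show ?thesis
    using p by (simp add: chart_inv_def prod_chart_def)
qed

lemma smooth_map_prod_coord:
  assumes M: "smooth_manifold M" and N: "smooth_manifold N" and m: "smooth_map (prod_manifold M N) K m"
    and c: "c \<in> man_atlas M" and d: "d \<in> man_atlas N" and e: "e \<in> man_atlas K"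
  shows "smooth_on {(snd c p, snd d q) | p q. p \<in> fst c \<and> q \<in> fst d \<and> m (p, q) \<in> fst e}
    (\<lambda>(x, y). snd e (m (chart_inv c x, chart_inv d y)))"
proof -
  have eq: "snd (prod_chart c d) ` {pq \<in> fst (prod_chart c d). m pq \<in> fst e}
      = {(snd c p, snd d q) | p q. p \<in> fst c \<and> q \<in> fst d \<and> m (p, q) \<in> fst e}"
    by (auto simp: prod_chart_def image_iff)
  from smooth_mapD(2) [OF m prod_chart_atlas [OF c d] e, unfolded eq]
  show ?thesis
    by (rule smooth_on_cong)
      (auto simp: prod_chart_inv [OF M N c d] chart_inv_left [OF M c] chart_inv_left [OF N d])
qed

lemma smooth_map_prod_compose:
  assumes L: "smooth_manifold L" and M: "smooth_manifold M" and N: "smooth_manifold N"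
      and K: "smooth_manifold K"
    and m: "smooth_map (prod_manifold M N) K m" and f: "smooth_map L M f" and h: "smooth_map L N h"
  shows "smooth_map L K (\<lambda>q. m (f q, h q))"
  unfolding smooth_map_def
proof (intro conjI ballI)
  have "continuous_map (man_top L) (man_top (prod_manifold M N)) (\<lambda>q. (f q, h q))"
    using smooth_mapD(1) [OF f] smooth_mapD(1) [OF h] by (simp add: prod_manifold_def continuous_map_paired)
  from continuous_map_compose [OF this smooth_mapD(1) [OF m]]
  show cont: "continuous_map (man_top L) (man_top K) (\<lambda>q. m (f q, h q))" by (simp add: o_def)
  fix c e assume c: "c \<in> man_atlas L" and e: "e \<in> man_atlas K"
  have op: "openin (man_top L) {p \<in> pts L. m (f p, h p) \<in> fst e}"
    by (rule openin_continuous_map_preimage [OF cont smooth_manifold_chart(1) [OF K e]])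
  have eq: "{p \<in> fst c. m (f p, h p) \<in> fst e} = fst c \<inter> {p \<in> pts L. m (f p, h p) \<in> fst e}"
    using smooth_manifold_chart(2) [OF L c] by auto
  show "smooth_on (snd c ` {p \<in> fst c. m (f p, h p) \<in> fst e}) (snd e \<circ> (\<lambda>q. m (f q, h q)) \<circ> chart_inv c)"
  proof (rule smooth_on_local)
    show "open (snd c ` {p \<in> fst c. m (f p, h p) \<in> fst e})"
      unfolding eq by (rule chart_image_open [OF L c op])
    fix x assume "x \<in> snd c ` {p \<in> fst c. m (f p, h p) \<in> fst e}"
    then obtain p where p: "p \<in> fst c" "m (f p, h p) \<in> fst e" "x = snd c p" by auto
    have pL: "p \<in> pts L" using p(1) smooth_manifold_chart(2) [OF L c] by auto
    obtain d1 where d1: "d1 \<in> charts_at M (f p)" using charts_at_exists [OF M smooth_mapD(3) [OF f pL]]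
        by blast
    obtain d2 where d2: "d2 \<in> charts_at N (h p)" using charts_at_exists [OF N smooth_mapD(3) [OF h pL]]
        by blast
    note d1' = charts_atD [OF M d1] and d2' = charts_atD [OF N d2]
    let ?U = "snd c ` (fst c \<inter> ({p \<in> pts L. f p \<in> fst d1} \<inter>
        ({p \<in> pts L. h p \<in> fst d2} \<inter> {p \<in> pts L. m (f p, h p) \<in> fst e})))"
    have U: "open ?U"
      by (intro chart_image_open [OF L c] openin_Int op smooth_map_preimage_open [OF L f M d1'(1)]
          smooth_map_preimage_open [OF L h N d2'(1)])
    have "smooth_on ?U (\<lambda>x. ((snd d1 \<circ> f \<circ> chart_inv c) x, (snd d2 \<circ> h \<circ> chart_inv c) x))"
      by (rule smooth_on_Pair; rule smooth_on_subset [OF smooth_mapD(2) [OF f c d1'(1)] U]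
          smooth_on_subset [OF smooth_mapD(2) [OF h c d2'(1)] U]) auto
    then have "smooth_on ?U (\<lambda>x. (\<lambda>(x, y). snd e (m (chart_inv d1 x, chart_inv d2 y)))
        ((snd d1 \<circ> f \<circ> chart_inv c) x, (snd d2 \<circ> h \<circ> chart_inv c) x))"
    proof (rule smooth_on_compose [OF _ smooth_map_prod_coord [OF M N m d1'(1) d2'(1) e]])
      show "(\<lambda>x. ((snd d1 \<circ> f \<circ> chart_inv c) x, (snd d2 \<circ> h \<circ> chart_inv c) x)) ` ?U
          \<subseteq> {(snd d1 p, snd d2 q) | p q. p \<in> fst d1 \<and> q \<in> fst d2 \<and> m (p, q) \<in> fst e}"
      proof (rule image_subsetI)
        fix y assume "y \<in> ?U"
        then obtain q where q: "q \<in> fst c" "f q \<in> fst d1" "h q \<in> fst d2" "m (f q, h q) \<in> fst e" "y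
            = snd c q"
          by auto
        then have "((snd d1 \<circ> f \<circ> chart_inv c) y, (snd d2 \<circ> h \<circ> chart_inv c) y)
            = (snd d1 (f q), snd d2 (h q))"
          using chart_inv_left [OF L c] by simp
        then show "((snd d1 \<circ> f \<circ> chart_inv c) y, (snd d2 \<circ> h \<circ> chart_inv c) y)
            \<in> {(snd d1 p, snd d2 q) | p q. p \<in> fst d1 \<and> q \<in> fst d2 \<and> m (p, q) \<in> fst e}"
          using q by blast
      qed
    qed
    then have "smooth_on ?U (snd e \<circ> (\<lambda>q. m (f q, h q)) \<circ> chart_inv c)"
      by (rule smooth_on_cong)
        (use chart_inv_left [OF L c] chart_inv_left [OF M d1'(1)] chart_inv_left [OF N d2'(1)] in auto)
    moreover have "x \<in> ?U" using p pL d1' d2' by auto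
    ultimately show "\<exists>U. x \<in> U \<and> smooth_on U (snd e \<circ> (\<lambda>q. m (f q, h q)) \<circ> chart_inv c)"
      by (intro exI conjI)
  qed
qed

section \<open>Orthonormal bases of tangent spaces\<close>

text \<open>The Gram-Schmidt process, applied to the coordinate vectors of a chart. The induction runs over
  subsets \<open>A\<close> of the basis of the model space and keeps the components of the vectors in the span of \<open>A\<close>.\<close>

lemma orthonormal_basis_exists:
  fixes M :: "('a, 'e::euclidean_space) manifold"
  assumes M: "smooth_manifold M" and g: "riemannian_metric M g" and p: "p \<in> pts M"
  shows "\<exists>u :: 'e \<Rightarrow> ('a, 'e) tangent. \<forall>i\<in>Basis. u i \<in> tangent_space M p \<and>
    (\<forall>j\<in>Basis. g p (u i) (u j) = (if i = j then 1 else 0))"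
proof -
  obtain c where c: "c \<in> charts_at M p" using charts_at_exists [OF M p] by blast
  note rm = riemannian_metricD [OF g p]
  have "\<exists>u :: 'e \<Rightarrow> ('a, 'e) tangent. \<forall>i\<in>A. u i \<in> tangent_space M p \<and> u i c \<in> span A \<and>
      (\<forall>j\<in>A. g p (u i) (u j) = (if i = j then 1 else 0))" if "finite A" "A \<subseteq> Basis" for A :: "'e set"
    using that
  proof (induction A rule: finite_induct)
    case empty
    show ?case by simp
  next
    case (insert b A)
    then obtain u :: "'e \<Rightarrow> ('a, 'e) tangent" where u: "\<And>i. i \<in> A \<Longrightarrow> u i \<in> tangent_space M p" "\<And>i. i \<in> A \<Longrightarrow>
        u i c \<in> span A"
      "\<And>i j. i \<in> A \<Longrightarrow> j \<in> A \<Longrightarrow> g p (u i) (u j) = (if i = j then 1 else 0)" by auto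
    define v where "v = coord_vector M c p b"
    have v: "v \<in> tangent_space M p" "v c = b"
      unfolding v_def using coord_vector_tangent [OF M c] by auto
    define s where "s = (\<Sum>i\<in>A. g p v (u i) *\<^sub>R u i)"
    have s: "s \<in> tangent_space M p" unfolding s_def by (intro tangent_sum tangent_scaleR M u)
    have sc: "s c \<in> span A" unfolding s_def sum_component scaleR_fun_apply by (intro span_sum span_scale u)
    define w where "w = v - s"
    have w: "w \<in> tangent_space M p" unfolding w_def by (rule tangent_diff [OF M v(1) s])
    \<comment> \<open>the new vector is nonzero since the basis is independent\<close>
    have "b \<notin> span A"
    proof
      assume "b \<in> span A"
      moreover have "A \<subseteq> Basis - {b}" using insert by auto
      ultimately have "b \<in> span (Basis - {b})" using span_mono by blast
      then show False using independent_Basis insert.prems unfolding dependent_def by blast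
    qed
    then have "w c \<noteq> 0" using sc v(2) by (auto simp: w_def)
    then have "w \<noteq> 0" by auto
    then have pos: "0 < g p w w" by (rule rm(4) [OF w])
    have wu: "g p w (u j) = 0" if j: "j \<in> A" for j
    proof -
      have "g p s (u j) = (\<Sum>i\<in>A. g p v (u i) * g p (u i) (u j))"
        unfolding s_def by (rule metric_sum_left [OF M g p u(1) [OF j]]) (rule u(1))
      also have "\<dots> = (\<Sum>i\<in>A. if i = j then g p v (u i) else 0)"
        by (intro sum.cong refl) (simp add: u(3) j)
      also have "\<dots> = g p v (u j)" using insert(1) j by simp
      finally show ?thesis unfolding w_def metric_diff_left [OF M g p v(1) s u(1) [OF j]] by simp
    qed
    define r where "r = 1 / sqrt (g p w w)"
    define u' where "u' = u(b := r *\<^sub>R w)"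
    have rw: "r *\<^sub>R w \<in> tangent_space M p" by (rule tangent_scaleR [OF M w])
    have rwu: "g p (r *\<^sub>R w) (u j) = 0" "g p (u j) (r *\<^sub>R w) = 0" if j: "j \<in> A" for j
    proof -
      show 1: "g p (r *\<^sub>R w) (u j) = 0" unfolding rm(3) [OF w u(1) [OF j]] wu [OF j] by simp
      show "g p (u j) (r *\<^sub>R w) = 0" unfolding rm(1) [OF u(1) [OF j] rw] by (rule 1)
    qed
    have rwrw: "g p (r *\<^sub>R w) (r *\<^sub>R w) = 1"
      unfolding rm(3) [OF w rw] rm(1) [OF w rw] rm(3) [OF w w] using pos by (simp add: r_def)
    have wc: "(r *\<^sub>R w) c \<in> span (insert b A)"
    proof -
      have "s c \<in> span (insert b A)" using sc span_mono [of A "insert b A"] by blast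
      then show ?thesis
        unfolding scaleR_fun_apply w_def minus_apply v(2)
        by (intro span_scale span_diff) (simp_all add: span_base)
    qed
    have uc: "u i c \<in> span (insert b A)" if "i \<in> A" for i
      using u(2) [OF that] span_mono [of A "insert b A"] by blast
    have nb: "i \<noteq> b" if "i \<in> A" for i using that insert(2) by auto
    have "u' i \<in> tangent_space M p \<and> u' i c \<in> span (insert b A) \<and>
        (\<forall>j\<in>insert b A. g p (u' i) (u' j) = (if i = j then 1 else 0))" if i: "i \<in> insert b A" for i
    proof (cases "i = b")
      case True
      then show ?thesis using rw wc rwrw rwu nb by (auto simp: u'_def simp del: scaleR_fun_apply)
    next
      case False
      then show ?thesis using i u uc rwu nb by (auto simp: u'_def simp del: scaleR_fun_apply)
    qed
    then show ?case by blast
  qed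
  from this [OF finite_Basis subset_refl] show ?thesis by blast
qed

section \<open>Lie groups\<close>

text \<open>A Lie group \<open>G\<close> with its manifold structure \<open>M\<close>.\<close>

locale lie_group_manifold =
  fixes G :: "('a, 'b) monoid_scheme" (structure) and M :: "('a, 'e::euclidean_space) manifold"
  assumes lie: "lie_group G M"
begin

sublocale group G using lie by (simp add: lie_group_def)

lemma M: "smooth_manifold M" and points: "pts M = carrier G"
  and smooth_mult: "smooth_map (prod_manifold M M) M (\<lambda>(p, q). p \<otimes> q)"
  and smooth_inv: "smooth_map M M (\<lambda>p. inv p)"
  using lie by (auto simp: lie_group_def)

abbreviation "d f \<equiv> differential M M f"

lemma smooth_map_mult:
  assumes "smooth_map M M f" "smooth_map M M h"
  shows "smooth_map M M (\<lambda>q. f q \<otimes> h q)"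
  using smooth_map_prod_compose [OF M M M M smooth_mult assms] by simp

lemma smooth_left: "a \<in> carrier G \<Longrightarrow> smooth_map M M (\<lambda>q. a \<otimes> q)"
  using smooth_map_mult [OF smooth_map_const [OF M M] smooth_map_id [OF M]] by (simp add: points)

lemma smooth_right: "a \<in> carrier G \<Longrightarrow> smooth_map M M (\<lambda>q. q \<otimes> a)"
  using smooth_map_mult [OF smooth_map_id [OF M] smooth_map_const [OF M M]] by (simp add: points)

section \<open>Left-invariant vector fields\<close>

text \<open>In charts, a left-invariant field is a partial derivative of the multiplication at \<open>(p, \<one>)\<close> in the
  second variable.\<close>

lemma smooth_left_invariant_field: "smooth_vector_field M (left_invariant_field G M u)"
proof (rule smooth_sectionI)
  show "left_invariant_field G M u p \<in> tangent_space M (id p)" if "p \<in> pts M" for p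
    unfolding left_invariant_field_def
    using differential_tangent [OF M M smooth_left [of p], of \<one> u] that by (simp add: points)
  fix c e assume c: "c \<in> man_atlas M" and e: "e \<in> man_atlas M"
  let ?s = "some_chart_at M \<one>"
  have s: "?s \<in> charts_at M \<one>" by (rule some_chart_at [OF M]) (simp add: points)
  note s' = charts_atD [OF M s]
  define H where "H = (\<lambda>(x, y). snd e (chart_inv c x \<otimes> chart_inv ?s y))"
  let ?W = "{(snd c p, snd ?s q) | p q. p \<in> fst c \<and> q \<in> fst ?s \<and> p \<otimes> q \<in> fst e}"
  let ?U = "snd c ` {p \<in> fst c. id p \<in> fst e}"
  have H: "smooth_on ?W H"
    using smooth_map_prod_coord [OF M M smooth_mult c s'(1) e] by (simp add: H_def)
  have U: "open ?U" by (rule chart_preimage_image_open [OF M smooth_map_id [OF M] M c e])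
  have cp: "p \<in> carrier G" if "p \<in> fst c" for p using that smooth_manifold_chart(2) [OF M c] points by auto
  have "smooth_on ?U (\<lambda>x. fderiv H (x, snd ?s \<one>) (0, u ?s))"
    by (rule smooth_on_compose [OF smooth_on_Pair [OF smooth_on_ident [OF U] smooth_on_const [OF U]]
        smooth_on_fderiv_const [OF H]])
      (use s' cp in force)
  then show "smooth_on ?U (\<lambda>x. left_invariant_field G M u (chart_inv c x) e)"
  proof (rule smooth_on_cong)
    fix x assume "x \<in> ?U"
    then obtain p where p: "p \<in> fst c" "p \<in> fst e" "x = snd c p" by auto
    have pG: "p \<in> carrier G" by (rule cp [OF p(1)])
    have px: "chart_inv c x = p" using p chart_inv_left [OF M c p(1)] by simp
    have "p \<otimes> \<one> \<in> fst e" using p pG by simp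
    then have xW: "(x, snd ?s \<one>) \<in> ?W" using p s' by blast
    have "((\<lambda>y. (x, y)) has_derivative (\<lambda>v. (0, v))) (at (snd ?s \<one>))"
      by (intro has_derivative_Pair has_derivative_const has_derivative_ident)
    from fderiv_compose [OF this smooth_on_has_derivative [OF H xW], of "u ?s"]
    have 1: "fderiv (\<lambda>y. H (x, y)) (snd ?s \<one>) (u ?s) = fderiv H (x, snd ?s \<one>) (0, u ?s)" .
    have "(\<lambda>y. H (x, y)) = snd e \<circ> (\<lambda>q. p \<otimes> q) \<circ> chart_inv ?s"
      by (auto simp: H_def px)
    moreover have "e \<in> charts_at M (p \<otimes> \<one>)" using p e pG by (simp add: charts_at_def)
    ultimately show "fderiv H (x, snd ?s \<one>) (0, u ?s) = left_invariant_field G M u (chart_inv c x) e"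
      unfolding px left_invariant_field_def differential_def Let_def using 1 by simp
  qed
qed

section \<open>The differential of the inversion\<close>

text \<open>Differentiate \<open>x x\<^sup>-\<^sup>1 = \<one>\<close> at the identity.\<close>

lemma differential_inv_one:
  assumes u: "u \<in> tangent_space M \<one>"
  shows "d (\<lambda>p. inv p) \<one> u = - u"
proof -
  let ?s = "some_chart_at M \<one>"
  have one: "\<one> \<in> pts M" by (simp add: points)
  have s: "?s \<in> charts_at M \<one>" by (rule some_chart_at [OF M one])
  note s' = charts_atD [OF M s]
  let ?o = "snd ?s \<one>"
  define H where "H = (\<lambda>(x, y). snd ?s (chart_inv ?s x \<otimes> chart_inv ?s y))"
  define J where "J = snd ?s \<circ> (\<lambda>p. inv p) \<circ> chart_inv ?s"
  let ?W = "{(snd ?s p, snd ?s q) | p q. p \<in> fst ?s \<and> q \<in> fst ?s \<and> p \<otimes> q \<in> fst ?s}"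
  have H: "smooth_on ?W H"
    using smooth_map_prod_coord [OF M M smooth_mult s'(1) s'(1) s'(1)] by (simp add: H_def)
  have so: "chart_inv ?s ?o = \<one>" by (rule chart_inv_left [OF M s'(1,2)])
  have oW: "(?o, ?o) \<in> ?W" using s' by force
  note DH = smooth_on_has_derivative [OF H oW]
  have sG: "p \<in> carrier G" if "p \<in> fst ?s" for p using that smooth_manifold_chart(2) [OF M s'(1)]
      points by auto
  have open_s: "open (snd ?s ` fst ?s)" by (rule smooth_manifold_chart(4) [OF M s'(1)])
  have o_in: "?o \<in> snd ?s ` fst ?s" using s' by auto
  \<comment> \<open>both partial derivatives of the multiplication at the identity are the identity\<close>
  have left: "fderiv H (?o, ?o) (v, 0) = v" for v
  proof -
    have "((\<lambda>x. (x, ?o)) has_derivative (\<lambda>v. (v, 0))) (at ?o)"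
      by (intro has_derivative_Pair has_derivative_const has_derivative_ident)
    from fderiv_compose [OF this DH, of v]
    have "fderiv H (?o, ?o) (v, 0) = fderiv (\<lambda>x. H (x, ?o)) ?o v" by simp
    also have "\<dots> = fderiv (\<lambda>x. x) ?o v"
      by (rule fun_cong [OF fderiv_cong_open [OF open_s o_in]])
        (use sG chart_inv_left [OF M s'(1)] in \<open>auto simp: H_def so\<close>)
    finally show ?thesis by simp
  qed
  have right: "fderiv H (?o, ?o) (0, v) = v" for v
  proof -
    have "((\<lambda>x. (?o, x)) has_derivative (\<lambda>v. (0, v))) (at ?o)"
      by (intro has_derivative_Pair has_derivative_const has_derivative_ident)
    from fderiv_compose [OF this DH, of v]
    have "fderiv H (?o, ?o) (0, v) = fderiv (\<lambda>x. H (?o, x)) ?o v" by simp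
    also have "\<dots> = fderiv (\<lambda>x. x) ?o v"
      by (rule fun_cong [OF fderiv_cong_open [OF open_s o_in]])
        (use sG chart_inv_left [OF M s'(1)] in \<open>auto simp: H_def so\<close>)
    finally show ?thesis by simp
  qed
  have s1: "?s \<in> charts_at M (inv \<one>)" using s by simp
  have DJ: "(J has_derivative coord_deriv (\<lambda>p. inv p) ?s ?s \<one>) (at ?o)"
    unfolding J_def by (rule coord_has_derivative [OF smooth_inv s s1])
  let ?J' = "coord_deriv (\<lambda>p. inv p) ?s ?s \<one>"
  have Jo: "J ?o = ?o" by (simp add: J_def so)
  have "((\<lambda>x. (x, J x)) has_derivative (\<lambda>v. (v, ?J' v))) (at ?o)"
    by (rule has_derivative_Pair [OF has_derivative_ident DJ])
  from fderiv_compose [OF this, of H "fderiv H (?o, ?o)"] DH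
  have "fderiv (\<lambda>x. H (x, J x)) ?o v = fderiv H (?o, ?o) (v, ?J' v)" for v by (simp add: Jo)
  moreover have "fderiv (\<lambda>x. H (x, J x)) ?o v = fderiv (\<lambda>x. ?o) ?o v" for v
  proof (rule fun_cong [OF fderiv_cong_open])
    show "open (snd ?s ` {p \<in> fst ?s. inv p \<in> fst ?s})"
      by (rule chart_preimage_image_open [OF M smooth_inv M s'(1) s'(1)])
    show "?o \<in> snd ?s ` {p \<in> fst ?s. inv p \<in> fst ?s}" using s' by force
    show "H (y, J y) = ?o" if "y \<in> snd ?s ` {p \<in> fst ?s. inv p \<in> fst ?s}" for y
      using that sG chart_inv_left [OF M s'(1)] by (auto simp: H_def J_def)
  qed
  moreover have "fderiv H (?o, ?o) (v, ?J' v) = v + ?J' v" for v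
  proof -
    have "fderiv H (?o, ?o) (v, ?J' v) = fderiv H (?o, ?o) ((v, 0) + (0, ?J' v))" by simp
    also have "\<dots> = fderiv H (?o, ?o) (v, 0) + fderiv H (?o, ?o) (0, ?J' v)"
      by (rule linear_add [OF has_derivative_linear [OF DH]])
    finally show ?thesis unfolding left right .
  qed
  ultimately have "v + ?J' v = 0" for v by simp
  then have J': "?J' v = - v" for v by (simp add: eq_neg_iff_add_eq_0 add.commute)
  show ?thesis
  proof (rule tangent_eqI [OF _ _ s])
    show "d (\<lambda>p. inv p) \<one> u \<in> tangent_space M \<one>"
      using differential_tangent [OF M M smooth_inv one, of u] by simp
    show "- u \<in> tangent_space M \<one>" by (rule tangent_minus [OF M u])
    show "d (\<lambda>p. inv p) \<one> u ?s = (- u) ?s"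
      unfolding differential_component [OF M M smooth_inv s s1 u] by (simp only: J' uminus_apply)
  qed
qed

end

section \<open>Isometries of a bi-invariant metric\<close>

lemma riemannian_isometry_compose:
  assumes M: "smooth_manifold M" and S: "riemannian_isometry M g S S'" and R: "riemannian_isometry M g R R'"
  shows "riemannian_isometry M g (S \<circ> R) (R' \<circ> S')"
  unfolding riemannian_isometry_def
proof (intro conjI ballI)
  note s = riemannian_isometryD [OF S] and r = riemannian_isometryD [OF R]
  show "smooth_map M M (S \<circ> R)" "smooth_map M M (R' \<circ> S')"
    by (intro smooth_map_compose [OF M M M] s r)+
  fix q assume q: "q \<in> pts M"
  note Rq = smooth_mapD(3) [OF r(1) q] and Sq = smooth_mapD(3) [OF s(2) q]
  show "(R' \<circ> S') ((S \<circ> R) q) = q" "(S \<circ> R) ((R' \<circ> S') q) = q"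
    by (simp_all add: s(3) [OF Rq] r(3) [OF q] r(4) [OF Sq] s(4) [OF q])
  fix u v assume u: "u \<in> tangent_space M q" and v: "v \<in> tangent_space M q"
  show "g ((S \<circ> R) q) (differential M M (S \<circ> R) q u) (differential M M (S \<circ> R) q v) = g q u v"
    unfolding differential_compose [OF M M M r(1) s(1) q u] differential_compose [OF M M M r(1) s(1) q v]
        o_apply
      s(5) [OF Rq differential_tangent [OF M M r(1) q] differential_tangent [OF M M r(1) q]]
    by (rule r(5) [OF q u v])
qed

lemma bi_invariant_metricD:
  assumes "bi_invariant_metric G M g"
  shows "riemannian_metric M g"
    "a \<in> carrier G \<Longrightarrow> p \<in> carrier G \<Longrightarrow> u \<in> tangent_space M p \<Longrightarrow> v \<in> tangent_space M p \<Longrightarrow>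
      g (a \<otimes>\<^bsub>G\<^esub> p) (differential M M (\<lambda>q. a \<otimes>\<^bsub>G\<^esub> q) p u) (differential M M (\<lambda>q. a \<otimes>\<^bsub>G\<^esub> q) p v) = g p u v"
    "a \<in> carrier G \<Longrightarrow> p \<in> carrier G \<Longrightarrow> u \<in> tangent_space M p \<Longrightarrow> v \<in> tangent_space M p \<Longrightarrow>
      g (p \<otimes>\<^bsub>G\<^esub> a) (differential M M (\<lambda>q. q \<otimes>\<^bsub>G\<^esub> a) p u) (differential M M (\<lambda>q. q \<otimes>\<^bsub>G\<^esub> a) p v) = g p u v"
  using assms unfolding bi_invariant_metric_def by blast+

context lie_group_manifold
begin

lemma riemannian_isometry_left:
  assumes g: "bi_invariant_metric G M g" and a: "a \<in> carrier G"
  shows "riemannian_isometry M g (\<lambda>q. a \<otimes> q) (\<lambda>q. inv a \<otimes> q)"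
  unfolding riemannian_isometry_def points
proof (intro conjI ballI)
  show "smooth_map M M (\<lambda>q. a \<otimes> q)" "smooth_map M M (\<lambda>q. inv a \<otimes> q)"
    by (rule smooth_left [OF a], rule smooth_left [OF inv_closed [OF a]])
  show "inv a \<otimes> (a \<otimes> q) = q" "a \<otimes> (inv a \<otimes> q) = q" if "q \<in> carrier G" for q
    using a that by (simp_all add: m_assoc [symmetric])
qed (rule bi_invariant_metricD(2) [OF g a])

lemma riemannian_isometry_right:
  assumes g: "bi_invariant_metric G M g" and a: "a \<in> carrier G"
  shows "riemannian_isometry M g (\<lambda>q. q \<otimes> a) (\<lambda>q. q \<otimes> inv a)"
  unfolding riemannian_isometry_def points
proof (intro conjI ballI)
  show "smooth_map M M (\<lambda>q. q \<otimes> a)" "smooth_map M M (\<lambda>q. q \<otimes> inv a)"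
    by (rule smooth_right [OF a], rule smooth_right [OF inv_closed [OF a]])
  show "(q \<otimes> a) \<otimes> inv a = q" "(q \<otimes> inv a) \<otimes> a = q" if "q \<in> carrier G" for q
    using a that by (simp_all add: m_assoc)
qed (rule bi_invariant_metricD(3) [OF g a])

text \<open>Let \<open>f\<close> fix the identity and suppose that around each point it arises from its behaviour at the
    identity
  by composition with a left translation on one side and an isometry on the other. Then \<open>f\<close> is an
  isometry as soon as its differential at the identity preserves the inner product there.\<close>

lemma riemannian_isometryI_at_one:
  assumes g: "bi_invariant_metric G M g"
    and f: "smooth_map M M f" and f': "smooth_map M M f'"
    and inverse: "\<And>q. q \<in> carrier G \<Longrightarrow> f' (f q) = q" "\<And>q. q \<in> carrier G \<Longrightarrow> f (f' q) = q"
    and one: "f \<one> = \<one>"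
    and translate: "\<And>q. q \<in> carrier G \<Longrightarrow> \<exists>A A'. riemannian_isometry M g A A' \<and>
      (\<forall>x\<in>carrier G. f x = A (f (inv q \<otimes> x)))"
    and at_one: "\<And>u v. u \<in> tangent_space M \<one> \<Longrightarrow> v \<in> tangent_space M \<one> \<Longrightarrow> g \<one> (d f \<one> u) (d f \<one> v) = g \<one> u v"
  shows "riemannian_isometry M g f f'"
  unfolding riemannian_isometry_def points
proof (intro conjI ballI f f' inverse)
  fix q u v assume q: "q \<in> carrier G" and u: "u \<in> tangent_space M q" and v: "v \<in> tangent_space M q"
  obtain A A' where A: "riemannian_isometry M g A A'" and fA: "\<And>x. x \<in> carrier G \<Longrightarrow> f x = A (f (inv q \<otimes> x))"
    using translate [OF q] by blast
  note a = riemannian_isometryD [OF A]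
  let ?L = "\<lambda>x. inv q \<otimes> x"
  have qM: "q \<in> pts M" and oneM: "\<one> \<in> pts M" using q points by auto
  have L: "smooth_map M M ?L" by (rule smooth_left [OF inv_closed [OF q]])
  have Lq: "?L q = \<one>" using q by simp
  have fL: "smooth_map M M (f \<circ> ?L)" by (rule smooth_map_compose [OF M M M L f])
  have df: "d f q w = d A \<one> (d f \<one> (d ?L q w))" if w: "w \<in> tangent_space M q" for w
  proof -
    have "d f q w = d (A \<circ> (f \<circ> ?L)) q w"
      by (rule differential_cong [OF M qM]) (simp add: fA points)
    also have "\<dots> = d A ((f \<circ> ?L) q) (d (f \<circ> ?L) q w)"
      by (rule differential_compose [OF M M M fL a(1) qM w])
    also have "d (f \<circ> ?L) q w = d f (?L q) (d ?L q w)"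
      by (rule differential_compose [OF M M M L f qM w])
    finally show ?thesis by (simp only: o_apply Lq one)
  qed
  have t: "d ?L q w \<in> tangent_space M \<one>" for w
    using differential_tangent [OF M M L qM, of w] by (simp only: Lq)
  have t': "d f \<one> w \<in> tangent_space M \<one>" for w
    using differential_tangent [OF M M f oneM, of w] by (simp only: one)
  have fq: "f q = A \<one>" using fA [OF q] by (simp only: Lq one)
  have "g (f q) (d f q u) (d f q v) = g \<one> (d f \<one> (d ?L q u)) (d f \<one> (d ?L q v))"
    unfolding df [OF u] df [OF v] fq by (rule a(5) [OF oneM t' t'])
  also have "\<dots> = g (?L q) (d ?L q u) (d ?L q v)"
    unfolding at_one [OF t t] Lq ..
  also have "\<dots> = g q u v" by (rule bi_invariant_metricD(2) [OF g inv_closed [OF q] q u v])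
  finally show "g (f q) (d f q u) (d f q v) = g q u v" .
qed

lemma riemannian_isometry_inv:
  assumes g: "bi_invariant_metric G M g"
  shows "riemannian_isometry M g (\<lambda>q. inv q) (\<lambda>q. inv q)"
proof (rule riemannian_isometryI_at_one [OF g smooth_inv smooth_inv])
  fix u v assume u: "u \<in> tangent_space M \<one>" and v: "v \<in> tangent_space M \<one>"
  have one: "\<one> \<in> pts M" by (simp add: points)
  note rm = riemannian_metricD [OF bi_invariant_metricD(1) [OF g] one]
  note u' = tangent_minus [OF M u] and v' = tangent_minus [OF M v]
  have neg: "g \<one> (- w) z = - g \<one> w z" if "w \<in> tangent_space M \<one>" "z \<in> tangent_space M \<one>" for w z
    using rm(3) [OF that, of "-1"] by (simp only: scaleR_minus1_left mult_minus1)
  have "g \<one> (- u) (- v) = - g \<one> u (- v)" by (rule neg [OF u v'])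
  also have "g \<one> u (- v) = g \<one> (- v) u" by (rule rm(1) [OF u v'])
  also have "\<dots> = - g \<one> v u" by (rule neg [OF v u])
  also have "g \<one> v u = g \<one> u v" by (rule rm(1) [OF v u])
  finally show "g \<one> (d (\<lambda>q. inv q) \<one> u) (d (\<lambda>q. inv q) \<one> v) = g \<one> u v"
    unfolding differential_inv_one [OF u] differential_inv_one [OF v] minus_minus .
next
  fix q assume q: "q \<in> carrier G"
  show "\<exists>A A'. riemannian_isometry M g A A' \<and> (\<forall>x\<in>carrier G. inv x = A (inv (inv q \<otimes> x)))"
  proof (intro exI conjI ballI)
    show "riemannian_isometry M g (\<lambda>x. x \<otimes> inv q) (\<lambda>x. x \<otimes> inv (inv q))"
      by (rule riemannian_isometry_right [OF g inv_closed [OF q]])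
    show "inv x = inv (inv q \<otimes> x) \<otimes> inv q" if "x \<in> carrier G" for x
      using q that by (simp add: inv_mult_group m_assoc)
  qed
qed simp_all

text \<open>The geodesic symmetry of a bi-invariant metric at a point \<open>b\<close>.\<close>

lemma riemannian_isometry_symmetry:
  assumes g: "bi_invariant_metric G M g" and b: "b \<in> carrier G"
  shows "\<exists>T'. riemannian_isometry M g (\<lambda>q. b \<otimes> (inv q \<otimes> b)) T'"
proof -
  have "riemannian_isometry M g ((\<lambda>q. b \<otimes> q) \<circ> ((\<lambda>q. q \<otimes> b) \<circ> (\<lambda>q. inv q)))
      (((\<lambda>q. inv q) \<circ> (\<lambda>q. q \<otimes> inv b)) \<circ> (\<lambda>q. inv b \<otimes> q))"
    by (intro riemannian_isometry_compose [OF M] riemannian_isometry_left [OF g b]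
        riemannian_isometry_right [OF g b] riemannian_isometry_inv [OF g])
  then show ?thesis by (auto simp: o_def)
qed

text \<open>At \<open>b\<close> the geodesic symmetry is the conjugate of the inversion by the left translation by \<open>b\<close>.\<close>

lemma differential_symmetry:
  assumes b: "b \<in> carrier G" and v: "v \<in> tangent_space M b"
  shows "d (\<lambda>q. b \<otimes> (inv q \<otimes> b)) b v = - v"
proof -
  let ?L = "\<lambda>q. b \<otimes> q" and ?L' = "\<lambda>q. inv b \<otimes> q" and ?I = "\<lambda>q. inv q"
  note L = smooth_left [OF b] and L' = smooth_left [OF inv_closed [OF b]]
  have bM: "b \<in> pts M" and oneM: "\<one> \<in> pts M" using b points by auto
  have L'b: "?L' b = \<one>" using b by simp
  have w: "d ?L' b v \<in> tangent_space M \<one>"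
    using differential_tangent [OF M M L' bM, of v] by (simp only: L'b)
  have "d (\<lambda>q. b \<otimes> (inv q \<otimes> b)) b v = d (?L \<circ> (?I \<circ> ?L')) b v"
    by (rule differential_cong [OF M bM]) (use b points in \<open>auto simp: inv_mult_group\<close>)
  also have "\<dots> = d ?L ((?I \<circ> ?L') b) (d (?I \<circ> ?L') b v)"
    by (rule differential_compose [OF M M M smooth_map_compose [OF M M M L' smooth_inv] L bM v])
  also have "d (?I \<circ> ?L') b v = d ?I (?L' b) (d ?L' b v)"
    by (rule differential_compose [OF M M M L' smooth_inv bM v])
  also have "\<dots> = - d ?L' b v" unfolding L'b by (rule differential_inv_one [OF w])
  also have "(?I \<circ> ?L') b = \<one>" using b by simp
  also have "d ?L \<one> (- d ?L' b v) = - d ?L \<one> (d ?L' b v)"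
    using differential_scaleR [OF M L oneM, of "-1"] by (simp only: scaleR_minus1_left)
  also have "d ?L \<one> (d ?L' b v) = d (?L \<circ> ?L') b v"
    unfolding differential_compose [OF M M M L' L bM v] L'b ..
  also have "\<dots> = d id b v"
    by (rule differential_cong [OF M bM]) (use b points in \<open>auto simp: m_assoc [symmetric]\<close>)
  also have "\<dots> = v" by (rule differential_id [OF M bM v])
  finally show ?thesis .
qed

text \<open>An orthonormal basis at the identity, extended by left translations.\<close>

lemma left_invariant_orthonormal_frame:
  assumes g: "bi_invariant_metric G M g"
  shows "\<exists>E. framed_manifold M g E"
proof -
  note rm = bi_invariant_metricD(1) [OF g]
  have one: "\<one> \<in> pts M" by (simp add: points)
  obtain u :: "'e \<Rightarrow> ('a, 'e) tangent" where u: "\<And>i. i \<in> Basis \<Longrightarrow> u i \<in> tangent_space M \<one>"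
    "\<And>i j. i \<in> Basis \<Longrightarrow> j \<in> Basis \<Longrightarrow> g \<one> (u i) (u j) = (if i = j then 1 else 0)"
    using orthonormal_basis_exists [OF M rm one] by blast
  have "framed_manifold M g (\<lambda>i. left_invariant_field G M (u i))"
  proof (rule framed_manifold.intro [OF M rm smooth_left_invariant_field])
    fix p and i j :: 'e assume p: "p \<in> pts M" and ij: "i \<in> Basis" "j \<in> Basis"
    have pG: "p \<in> carrier G" using p by (simp add: points)
    have "g (p \<otimes> \<one>) (d (\<lambda>q. p \<otimes> q) \<one> (u i)) (d (\<lambda>q. p \<otimes> q) \<one> (u j)) = g \<one> (u i) (u j)"
      by (rule bi_invariant_metricD(2) [OF g pG one_closed u(1) [OF ij(1)] u(1) [OF ij(2)]])
    then show "g p (left_invariant_field G M (u i) p) (left_invariant_field G M (u j) p) = (if i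
        = j then 1 else 0)"
      using pG by (simp add: left_invariant_field_def u(2) [OF ij])
  qed
  then show ?thesis by blast
qed

end

section \<open>The Cartan map\<close>

text \<open>A Lie group with a smooth involutive automorphism \<open>\<sigma>\<close>.\<close>

locale lie_group_involution = lie_group_manifold G M for G :: "('a, 'b) monoid_scheme" (structure)
    and M :: "('a, 'e::euclidean_space) manifold" +
  fixes \<sigma> :: "'a \<Rightarrow> 'a"
  assumes \<sigma>_iso: "\<sigma> \<in> iso G G" and smooth_\<sigma>: "smooth_map M M \<sigma>"
    and \<sigma>_\<sigma>: "\<And>p. p \<in> carrier G \<Longrightarrow> \<sigma> (\<sigma> p) = p"
begin

lemma \<sigma>_hom: "\<sigma> \<in> hom G G"
  using \<sigma>_iso by (simp add: iso_def)

sublocale \<sigma>: group_hom G G \<sigma>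
  by unfold_locales (rule \<sigma>_hom)

lemma smooth_cartan_map: "smooth_map M M (cartan_map G \<sigma>)"
  using smooth_map_mult [OF smooth_map_id [OF M] smooth_map_compose [OF M M M smooth_inv smooth_\<sigma>]]
  by (simp add: cartan_map_def [abs_def])

text \<open>The vector \<open>x + d\<sigma>(x)\<close> lies in \<open>\<kk>\<close> and \<open>x
    - d\<sigma>(x)\<close> lies in \<open>\<pp>\<close>; adding the orthogonality relations for the pairs
  \<open>(u, v)\<close> and \<open>(v, u)\<close> gives the claim.\<close>

lemma metric_\<sigma>_at_one:
  assumes g: "riemannian_metric M g"
    and orth: "\<And>u v. u \<in> cartan_k G M \<sigma> \<Longrightarrow> v \<in> cartan_p G M \<sigma> \<Longrightarrow> g \<one> u v = 0"
    and u: "u \<in> tangent_space M \<one>" and v: "v \<in> tangent_space M \<one>"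
  shows "g \<one> (d \<sigma> \<one> u) (d \<sigma> \<one> v) = g \<one> u v"
proof -
  have one: "\<one> \<in> pts M" by (simp add: points)
  note rm = riemannian_metricD [OF g one]
  have T: "d \<sigma> \<one> w \<in> tangent_space M \<one>" for w
    using differential_tangent [OF M M smooth_\<sigma> one, of w] by simp
  have dd: "d \<sigma> \<one> (d \<sigma> \<one> w) = w" if w: "w \<in> tangent_space M \<one>" for w
  proof -
    have "d \<sigma> \<one> (d \<sigma> \<one> w) = d (\<sigma> \<circ> \<sigma>) \<one> w"
      using differential_compose [OF M M M smooth_\<sigma> smooth_\<sigma> one w] by simp
    also have "\<dots> = d id \<one> w" by (rule differential_cong [OF M one]) (simp add: points \<sigma>_\<sigma>)
    also have "\<dots> = w" by (rule differential_id [OF M one w])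
    finally show ?thesis .
  qed
  have add: "d \<sigma> \<one> (x + y) = d \<sigma> \<one> x + d \<sigma> \<one> y" for x y by (rule differential_add [OF M smooth_\<sigma> one])
  have diff: "d \<sigma> \<one> (x - y) = d \<sigma> \<one> x - d \<sigma> \<one> y" for x y
    using add [of "x - y" y] by (simp only: diff_add_cancel eq_diff_eq)
  have k: "x + d \<sigma> \<one> x \<in> cartan_k G M \<sigma>" if x: "x \<in> tangent_space M \<one>" for x
    unfolding cartan_k_def using x T by (auto intro: tangent_add [OF M] simp: add dd add.commute)
  have p: "x - d \<sigma> \<one> x \<in> cartan_p G M \<sigma>" if x: "x \<in> tangent_space M \<one>" for x
    unfolding cartan_p_def using x T by (auto intro: tangent_diff [OF M] simp: diff dd)
  have exp: "g \<one> (x + d \<sigma> \<one> x) (y - d \<sigma> \<one> y)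
      = g \<one> x y - g \<one> x (d \<sigma> \<one> y) + g \<one> (d \<sigma> \<one> x) y - g \<one> (d \<sigma> \<one> x) (d \<sigma> \<one> y)"
    if x: "x \<in> tangent_space M \<one>" and y: "y \<in> tangent_space M \<one>" for x y
  proof -
    have right: "g \<one> w (y - d \<sigma> \<one> y) = g \<one> w y - g \<one> w (d \<sigma> \<one> y)" if w: "w \<in> tangent_space M \<one>" for w
      using metric_diff_left [OF M g one y T w, of y] rm(1) [OF w tangent_diff [OF M y T]] rm(1) [OF w y]
          rm(1) [OF w T]
      by simp
    show ?thesis
      unfolding rm(2) [OF x T tangent_diff [OF M y T]] right [OF x] right [OF T] by simp
  qed
  show ?thesis
    using orth [OF k [OF u] p [OF v]] orth [OF k [OF v] p [OF u]]
      rm(1) [OF u v] rm(1) [OF u T, of v] rm(1) [OF v T, of u] rm(1) [OF T T, of u v]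
    unfolding exp [OF u v] exp [OF v u] by linarith
qed

lemma riemannian_isometry_\<sigma>:
  assumes g: "bi_invariant_metric G M g"
    and orth: "\<And>u v. u \<in> cartan_k G M \<sigma> \<Longrightarrow> v \<in> cartan_p G M \<sigma> \<Longrightarrow> g \<one> u v = 0"
  shows "riemannian_isometry M g \<sigma> \<sigma>"
proof (rule riemannian_isometryI_at_one [OF g smooth_\<sigma> smooth_\<sigma> \<sigma>_\<sigma> \<sigma>_\<sigma>])
  fix q assume q: "q \<in> carrier G"
  show "\<exists>A A'. riemannian_isometry M g A A' \<and> (\<forall>x\<in>carrier G. \<sigma> x = A (\<sigma> (inv q \<otimes> x)))"
  proof (intro exI conjI ballI)
    show "riemannian_isometry M g (\<lambda>x. \<sigma> q \<otimes> x) (\<lambda>x. inv (\<sigma> q) \<otimes> x)"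
      using q by (intro riemannian_isometry_left [OF g]) simp
    show "\<sigma> x = \<sigma> q \<otimes> \<sigma> (inv q \<otimes> x)" if "x \<in> carrier G" for x
      using q that by (simp add: m_assoc [symmetric])
  qed
qed (simp_all add: metric_\<sigma>_at_one [OF bi_invariant_metricD(1) [OF g] orth])

lemma cartan_map_closed: "p \<in> carrier G \<Longrightarrow> cartan_map G \<sigma> p \<in> carrier G"
  by (simp add: cartan_map_def)

lemma inv_cartan_map: "p \<in> carrier G \<Longrightarrow> inv (cartan_map G \<sigma> p) = \<sigma> (cartan_map G \<sigma> p)"
  by (simp add: cartan_map_def inv_mult_group \<sigma>_\<sigma>)

text \<open>The Cartan map intertwines \<open>x \<mapsto> b \<sigma>(x)\<close>, which fixes \<open>p\<close>, with the geodesic symmetry at \<open>b\<close>.\<close>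

lemma cartan_map_equivariant:
  assumes p: "p \<in> carrier G" and q: "q \<in> carrier G"
  defines "b \<equiv> cartan_map G \<sigma> p"
  shows "cartan_map G \<sigma> (b \<otimes> \<sigma> q) = b \<otimes> (inv (cartan_map G \<sigma> q) \<otimes> b)"
proof -
  have b: "b \<in> carrier G" unfolding b_def by (rule cartan_map_closed [OF p])
  have "\<sigma> b = inv b" unfolding b_def by (rule inv_cartan_map [OF p, symmetric])
  then show ?thesis
    using b q by (simp add: cartan_map_def [of _ _ "b \<otimes> \<sigma> q"] cartan_map_def [of _ _ q]
        inv_mult_group \<sigma>_\<sigma> m_assoc)
qed

theorem harmonic_cartan_map:
  assumes g: "bi_invariant_metric G M g"
    and orth: "\<And>u v. u \<in> cartan_k G M \<sigma> \<Longrightarrow> v \<in> cartan_p G M \<sigma> \<Longrightarrow> g \<one> u v = 0"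
  shows "harmonic_map M g M g (cartan_map G \<sigma>)"
  unfolding harmonic_map_def
proof (intro conjI ballI smooth_cartan_map)
  fix p assume "p \<in> pts M"
  then have p: "p \<in> carrier G" by (simp add: points)
  obtain E where "framed_manifold M g E" using left_invariant_orthonormal_frame [OF g] by blast
  then interpret framed_map M g E M g E "cartan_map G \<sigma>"
    by (intro framed_map.intro framed_map_axioms.intro smooth_cartan_map)
  define b where "b = cartan_map G \<sigma> p"
  have b: "b \<in> carrier G" unfolding b_def by (rule cartan_map_closed [OF p])
  obtain T' where T: "riemannian_isometry M g (\<lambda>q. b \<otimes> (inv q \<otimes> b)) T'"
    using riemannian_isometry_symmetry [OF g b] by blast
  have S: "riemannian_isometry M g ((\<lambda>q. b \<otimes> q) \<circ> \<sigma>) (\<sigma> \<circ> (\<lambda>q. inv b \<otimes> q))"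
    by (rule riemannian_isometry_compose [OF dom.M riemannian_isometry_left [OF g b]
        riemannian_isometry_\<sigma> [OF g orth]])
  show "tension_field M g M g (cartan_map G \<sigma>) p = 0"
  proof (rule tension_field_eq_0_of_symmetry [OF S T])
    show "cartan_map G \<sigma> (((\<lambda>q. b \<otimes> q) \<circ> \<sigma>) q) = b \<otimes> (inv cartan_map G \<sigma> q \<otimes> b)" if "q \<in> pts M" for q
      using cartan_map_equivariant [OF p, of q] that by (simp add: points b_def)
    show "p \<in> pts M" using p by (simp add: points)
    show "((\<lambda>q. b \<otimes> q) \<circ> \<sigma>) p = p"
      using p by (simp add: b_def cartan_map_def m_assoc)
    show "differential M M (\<lambda>q. b \<otimes> (inv q \<otimes> b)) (cartan_map G \<sigma> p) v = - v"
      if "v \<in> tangent_space M (cartan_map G \<sigma> p)" for v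
      using differential_symmetry [OF b, of v] that by (simp add: b_def)
  qed
qed

end

theorem theorem6p13:
  fixes G :: "('a, 'b) monoid_scheme"
    and M :: "('a, 'e::euclidean_space) manifold"
    and g :: "('a, 'e) metric_tensor"
    and K :: "'a set"
    and \<sigma> :: "'a \<Rightarrow> 'a"
    and n :: nat
  assumes "symmetric_triple G M K \<sigma>"
    and "compact_type G M \<sigma>"
    and "K = fixed_points G \<sigma>"
    and "has_manifold_dimension (coset_space G M K) n" and "n \<ge> 2"
    and "compact_space (man_top M)"
    and "bi_invariant_metric G M g"
    and "\<forall>u\<in>cartan_k G M \<sigma>. \<forall>v\<in>cartan_p G M \<sigma>. g \<one>\<^bsub>G\<^esub> u v = 0"
  shows "harmonic_map M g M g (cartan_map G \<sigma>)"
proof -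
  interpret lie_group_involution G M \<sigma>
    using assms(1) by unfold_locales (auto simp: symmetric_triple_def)
  show ?thesis
    by (rule harmonic_cartan_map [OF assms(7)]) (use assms(8) in blast)
qed

end
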